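(* Suppose that either $d=4$ and $1\le r<4$, or $d\ge5$ and $1\le r\le\frac{2(d+2)}3$. Then there is a constant $C$ such that, for all $W\in\ell^r(\mathbb Z^d)$ and all $f\in\ell^2(\mathbb Z^d)$, $$\int_{\mathbb R}\left\|We^{-itH_0}f\right\|_{\ell^2}^2\,dt\le C\|W\|_{\ell^r}^2\|f\|_{\ell^2}^2.$$
   Context: The discrete Laplacian $H_0$ on $\ell^2(\mathbb Z^d)$ is the Fourier multiplier (with $\widehat f(\xi)=\sum_{n}f(n)e^{-2\pi i n\cdot\xi}$ on $\mathbb T^d=(-1/2,1/2]^d$) with symbol $h_0(\xi)=4\sum_{j=1}^d\sin^2(\pi\xi_j)$. $W:\mathbb Z^d\to\mathbb C$ also denotes the multiplication operator $(Wf)(n)=W(n)f(n)$. *)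

theory Defs
  imports "HOL-Analysis.Analysis"
begin

text \<open>The lattice of dimension d is \<open>int ^ 'd\<close> with \<open>d = CARD('d)\<close>.\<close>

definition lp_space :: "real \<Rightarrow> (int ^ 'd::finite \<Rightarrow> complex) set" where
  "lp_space p = {f. (\<lambda>n. cmod (f n) powr p) summable_on UNIV}"

text \<open>Meaningful on \<open>lp_space p\<close> only: \<open>infsum\<close> is 0 on non-summable families.\<close>

definition lp_norm :: "real \<Rightarrow> (int ^ 'd::finite \<Rightarrow> complex) \<Rightarrow> real" where
  "lp_norm p f = (\<Sum>\<^sub>\<infinity>n. cmod (f n) powr p) powr (1 / p)"

definition torus :: "(real ^ 'd::finite) set" where
  "torus = {\<xi>. \<forall>j. - 1 / 2 < \<xi> $ j \<and> \<xi> $ j \<le> 1 / 2}"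

definition phase :: "int ^ 'd::finite \<Rightarrow> real ^ 'd \<Rightarrow> real" where
  "phase n \<xi> = (\<Sum>j\<in>UNIV. of_int (n $ j) * \<xi> $ j)"

definition L2_torus :: "(real ^ 'd::finite \<Rightarrow> complex) set" where
  "L2_torus = {F. F \<in> borel_measurable (lebesgue_on torus) \<and>
                  integrable (lebesgue_on torus) (\<lambda>\<xi>. (cmod (F \<xi>))\<^sup>2)}"

text \<open>For square summable \<open>f\<close> the Fourier series need not converge absolutely; its sum is
  understood as an unconditional limit in the space \<open>L2_torus\<close>, which determines it up to
  null sets.\<close>

definition is_fourier_transform ::
    "(int ^ 'd::finite \<Rightarrow> complex) \<Rightarrow> (real ^ 'd \<Rightarrow> complex) \<Rightarrow> bool" where
  "is_fourier_transform f F \<longleftrightarrow> F \<in> L2_torus \<and>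
     ((\<lambda>S. LINT \<xi>|lebesgue_on torus.
              (cmod (F \<xi> - (\<Sum>n\<in>S. f n * exp (- 2 * pi * \<i> * phase n \<xi>))))\<^sup>2)
        \<longlongrightarrow> 0) (finite_subsets_at_top UNIV)"

text \<open>An arbitrary representative; all uses below are integrals over the torus.\<close>

definition fourier :: "(int ^ 'd::finite \<Rightarrow> complex) \<Rightarrow> real ^ 'd \<Rightarrow> complex" where
  "fourier f = (SOME F. is_fourier_transform f F)"

definition inverse_fourier :: "(real ^ 'd::finite \<Rightarrow> complex) \<Rightarrow> int ^ 'd \<Rightarrow> complex" where
  "inverse_fourier F n = (LINT \<xi>|lebesgue_on torus. F \<xi> * exp (2 * pi * \<i> * phase n \<xi>))"

definition fourier_multiplier ::
    "(real ^ 'd::finite \<Rightarrow> complex) \<Rightarrow> (int ^ 'd \<Rightarrow> complex) \<Rightarrow> int ^ 'd \<Rightarrow> complex" where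
  "fourier_multiplier m f = inverse_fourier (\<lambda>\<xi>. m \<xi> * fourier f \<xi>)"

definition laplacian_symbol :: "real ^ 'd::finite \<Rightarrow> real" where
  "laplacian_symbol \<xi> = 4 * (\<Sum>j\<in>UNIV. (sin (pi * \<xi> $ j))\<^sup>2)"

text \<open>Functional calculus: the Fourier transform turns the discrete Laplacian
  into multiplication by \<open>laplacian_symbol\<close>, so a function \<open>\<phi>\<close> of the operator is
  the Fourier multiplier with symbol \<open>\<phi> \<circ> laplacian_symbol\<close>.\<close>

definition laplacian_calculus ::
    "(real \<Rightarrow> complex) \<Rightarrow> (int ^ 'd::finite \<Rightarrow> complex) \<Rightarrow> int ^ 'd \<Rightarrow> complex" where
  "laplacian_calculus \<phi> = fourier_multiplier (\<lambda>\<xi>. \<phi> (laplacian_symbol \<xi>))"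

definition discrete_laplacian ::
    "(int ^ 'd::finite \<Rightarrow> complex) \<Rightarrow> int ^ 'd \<Rightarrow> complex" where
  "discrete_laplacian = laplacian_calculus of_real"

definition propagator ::
    "real \<Rightarrow> (int ^ 'd::finite \<Rightarrow> complex) \<Rightarrow> int ^ 'd \<Rightarrow> complex" where
  "propagator t = laplacian_calculus (\<lambda>x. exp (- \<i> * t * x))"

definition mult_op ::
    "(int ^ 'd::finite \<Rightarrow> complex) \<Rightarrow> (int ^ 'd \<Rightarrow> complex) \<Rightarrow> int ^ 'd \<Rightarrow> complex" where
  "mult_op W f n = W n * f n"

end

theory Submission
  imports Defs
begin

text \<open>
  On the Fourier side \<open>(e\<^bsup>-itH\<^esup> f) n\<close> is the pairing of the transform of \<open>f\<close> with the plane wave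
  \<open>wave t n\<close>. By duality (lemma \<open>duality\<close>) the smoothing estimate says that superpositions
  of plane waves, with coefficients \<open>W n * F (t, n)\<close>, have norm at most a multiple of
  \<open>\<parallel>W\<parallel>\<close> times the \<open>\<ell>\<^sup>2\<close> norm of \<open>F\<close>. Only integer times have to be treated: the integral over the
  real line is the integral over \<open>s \<in> [0, 1)\<close> of the sums over \<open>s + \<int>\<close>, and the shift by \<open>s\<close>
  is absorbed into the transform of \<open>f\<close>. Hence the core of the argument is about finite sums.

  The Gram matrix of the plane waves is the propagator kernel, a product of \<open>d\<close> values of Bessel
  functions \<open>J\<^sub>m (2 t)\<close>. Van der Corput's lemma gives \<open>|J\<^sub>m (2 t)| \<le> C t\<^bsup>-1/4\<^esup> (t\<^bsup>1/3\<^esup> + |2 t - |m||)\<^bsup>-1/4\<^esup>\<close>: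
  the slow decay \<open>t\<^bsup>-1/3\<^esup>\<close> occurs only in a window of length \<open>t\<^bsup>1/3\<^esup>\<close> around the turning point
  \<open>|m| = 2 t\<close>. Summation over \<open>t\<close> profits from this and yields, uniformly in \<open>m\<close>, a finite moment
  \<open>\<Sum>t. t\<^bsup>\<beta>\<^esup> |J\<^sub>m (2 t)|\<^bsup>d\<^esup>\<close> with \<open>\<beta> = (d - 1) / 3\<close> for \<open>d \<ge> 5\<close> and every \<open>\<beta> < 1\<close> for \<open>d = 4\<close>
  (\<open>kernel_moment_dim_ge5\<close>, \<open>kernel_moment_dim4\<close>). So the part of the kernel with time
  difference at least \<open>X\<close> has total mass \<open>O(X\<^bsup>-\<beta>\<^esup>)\<close> (\<open>wave_decay\<close>).

  The exponent \<open>r = 2 (1 + \<beta>)\<close> is then reached by a real-variable argument. For \<open>\<parallel>W\<parallel> = 1\<close>, cut \<open>W\<close> into level sets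
  on which \<open>|W|\<^bsup>r\<^esup>\<close> is about \<open>2\<^bsup>-i\<^esup>\<close>, so that there are at most \<open>2\<^bsup>i+1\<^esup>\<close> sites. For two levels
  \<open>i \<le> l\<close> cut time into blocks of length \<open>X\<close>. Neighbouring blocks are handled by the
  Cauchy-Schwarz inequality and orthonormality at fixed time, remote blocks by the decay
  of the kernel (\<open>pairing_bound\<close>). The choice \<open>X = 2\<^bsup>2 (2 l + i) / (3 r)\<^esup>\<close> gives
  geometric decay in \<open>l - i\<close>, and Schur's test sums the interactions of all levels without
  loss (\<open>weighted_energy_normalized\<close>).
\<close>

section \<open>Oscillatory integrals and the one-dimensional kernel\<close>

text \<open>Integration by parts: \<open>cis \<circ> \<phi>\<close> is the derivative of \<open>- \<i> cis \<phi> /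
  p\<close> up to an error of modulus \<open>\<bar>p'\<bar> / p\<^sup>2\<close>. As \<open>p\<close> is monotone, this
  modulus is the derivative of \<open>- 1 / p\<close> and integrates explicitly.\<close>

lemma van_der_corput:
  fixes \<phi> p p' :: "real \<Rightarrow> real"
  assumes ab: "a \<le> b" and eta: "\<eta> > 0"
    and d\<phi>: "\<And>x. x \<in> {a..b} \<Longrightarrow> (\<phi> has_real_derivative p x) (at x)"
    and dp: "\<And>x. x \<in> {a..b} \<Longrightarrow> (p has_real_derivative p' x) (at x)"
    and p': "\<And>x. x \<in> {a..b} \<Longrightarrow> p' x \<ge> 0"
    and p: "\<And>x. x \<in> {a..b} \<Longrightarrow> \<bar>p x\<bar> \<ge> \<eta>"
  shows "cmod (integral {a..b} (\<lambda>x. cis (\<phi> x))) \<le> 4 / \<eta>"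
proof -
  have p0: "p x \<noteq> 0" if "x \<in> {a..b}" for x using p[OF that] eta by auto
  have c\<phi>: "continuous_on {a..b} \<phi>"
    using d\<phi> by (meson DERIV_isCont continuous_at_imp_continuous_on)
  define F where "F x = - \<i> * cis (\<phi> x) * of_real (1 / p x)" for x
  define R where "R x = \<i> * cis (\<phi> x) * of_real (p' x / (p x)\<^sup>2)" for x
  have dF: "(F has_vector_derivative (cis (\<phi> x) + R x)) (at x within {a..b})" if x: "x \<in> {a..b}" for x
  proof -
    have 1: "((\<lambda>x. cis (\<phi> x)) has_vector_derivative (\<i> * p x * cis (\<phi> x))) (at x within {a..b})"
    proof -
      have "(\<phi> has_derivative (\<lambda>h. p x * h)) (at x within {a..b})"
        using d\<phi>[OF x] has_field_derivative_at_within has_field_derivative_imp_has_derivative by blast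
      then have "((\<lambda>x. cis (\<phi> x)) has_derivative (\<lambda>h. (p x * h) *\<^sub>R (\<i> * cis (\<phi> x)))) (at x within {a..b})"
        by (rule has_derivative_cis)
      then show ?thesis unfolding has_vector_derivative_def
        by (rule has_derivative_eq_rhs) (auto simp: fun_eq_iff scaleR_conv_of_real)
    qed
    have 2: "((\<lambda>x. 1 / p x) has_real_derivative (- (p' x / (p x)\<^sup>2))) (at x within {a..b})"
      using dp[OF x, THEN DERIV_subset, of "{a..b}"] p0[OF x]
      by (auto intro!: derivative_eq_intros simp: power2_eq_square)
    have 3: "((\<lambda>x. complex_of_real (1 / p x)) has_vector_derivative of_real (- (p' x / (p x)\<^sup>2))) (at x within {a..b})"
      using 2 unfolding has_real_derivative_iff_has_vector_derivative
      by (rule bounded_linear.has_vector_derivative[OF bounded_linear_of_real])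
    have 4: "((\<lambda>x. cis (\<phi> x) * complex_of_real (1 / p x)) has_vector_derivative
        (cis (\<phi> x) * of_real (- (p' x / (p x)\<^sup>2)) + (\<i> * p x * cis (\<phi> x)) * of_real (1 / p x))) (at x within {a..b})"
      by (rule has_vector_derivative_mult[OF 1 3])
    have "((\<lambda>x. -\<i> * (cis (\<phi> x) * complex_of_real (1 / p x))) has_vector_derivative
        (-\<i> * (cis (\<phi> x) * of_real (- (p' x / (p x)\<^sup>2)) + (\<i> * p x * cis (\<phi> x)) * of_real (1 / p x)))) (at x within {a..b})"
      by (rule has_vector_derivative_mult_right[OF 4])
    moreover have "-\<i> * (cis (\<phi> x) * of_real (- (p' x / (p x)\<^sup>2)) + (\<i> * p x * cis (\<phi> x)) * of_real (1 / p x))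
        = cis (\<phi> x) + R x"
      using p0[OF x] by (simp add: R_def algebra_simps)
    ultimately show ?thesis unfolding F_def by (simp add: mult.assoc)
  qed
  have iF: "((\<lambda>x. cis (\<phi> x) + R x) has_integral F b - F a) {a..b}"
    by (rule fundamental_theorem_of_calculus[OF ab dF])
  have ic: "(\<lambda>x. cis (\<phi> x)) integrable_on {a..b}"
    by (intro integrable_continuous_real continuous_intros c\<phi>)
  have iR: "R integrable_on {a..b}"
    using integrable_diff[OF has_integral_integrable[OF iF] ic] by simp
  have iq: "((\<lambda>x. p' x / (p x)\<^sup>2) has_integral (- (1 / p b) - (- (1 / p a)))) {a..b}"
  proof (rule fundamental_theorem_of_calculus[OF ab])
    fix x assume x: "x \<in> {a..b}"
    show "((\<lambda>x. - (1 / p x)) has_vector_derivative p' x / (p x)\<^sup>2) (at x within {a..b})"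
      using dp[OF x, THEN DERIV_subset, of "{a..b}"] p0[OF x]
      unfolding has_real_derivative_iff_has_vector_derivative[symmetric]
      by (auto intro!: derivative_eq_intros simp: power2_eq_square)
  qed
  have "cmod (integral {a..b} R) \<le> integral {a..b} (\<lambda>x. p' x / (p x)\<^sup>2)"
    by (rule integral_norm_bound_integral[OF iR has_integral_integrable[OF iq]])
       (simp add: R_def norm_mult norm_divide norm_power p')
  also have "\<dots> = 1 / p a - 1 / p b" using integral_unique[OF iq] by simp
  also have "\<dots> \<le> \<bar>1 / p a\<bar> + \<bar>1 / p b\<bar>" by linarith
  finally have nR: "cmod (integral {a..b} R) \<le> \<bar>1 / p a\<bar> + \<bar>1 / p b\<bar>" .
  have b1: "\<bar>1 / p x\<bar> \<le> 1 / \<eta>" if "x \<in> {a..b}" for x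
    using p[OF that] eta by (simp add: frac_le)
  have "integral {a..b} (\<lambda>x. cis (\<phi> x)) = F b - F a - integral {a..b} R"
    using integral_unique[OF iF] integral_add[OF ic iR] by (simp add: algebra_simps)
  then have "cmod (integral {a..b} (\<lambda>x. cis (\<phi> x))) \<le> cmod (F b) + cmod (F a) + cmod (integral {a..b} R)"
    using norm_triangle_ineq4[of "F b - F a" "integral {a..b} R"] norm_triangle_ineq4[of "F b" "F a"]
    by simp
  also have "cmod (F b) = \<bar>1 / p b\<bar>" by (simp add: F_def norm_mult norm_divide)
  also have "cmod (F a) = \<bar>1 / p a\<bar>" by (simp add: F_def norm_mult norm_divide)
  finally have "cmod (integral {a..b} (\<lambda>x. cis (\<phi> x))) \<le> 2 * \<bar>1 / p a\<bar> + 2 * \<bar>1 / p b\<bar>"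
    using nR by linarith
  also have "\<dots> \<le> 4 / \<eta>" using b1[of a] b1[of b] ab by simp
  finally show ?thesis .
qed

text \<open>If the level is not attained, \<open>c\<close> is an endpoint of the interval; then one of the two sides
  is empty, and the bound at \<open>c\<close> itself is claimed only for a side of positive length.\<close>

lemma increasing_level_split:
  fixes p :: "real \<Rightarrow> real"
  assumes "a \<le> b" "continuous_on {a..b} p" "mono_on {a..b} p"
  obtains c where "c \<in> {a..b}" "\<And>x. x \<in> {a..b} \<Longrightarrow> x < c \<Longrightarrow> p x \<le> y"
    "\<And>x. x \<in> {a..b} \<Longrightarrow> c < x \<Longrightarrow> y \<le> p x" "a < c \<Longrightarrow> p c \<le> y" "c < b \<Longrightarrow> y \<le> p c"
proof -
  consider "p b < y" | "y < p a" | "p a \<le> y \<and> y \<le> p b" by linarith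
  then show ?thesis
  proof cases
    case 1
    have "p x \<le> y" if "x \<in> {a..b}" for x
      using monotone_onD[OF assms(3) that, of b] that 1 assms(1) by auto
    then show ?thesis using that[of b] assms(1) 1 by auto
  next
    case 2
    have "p x \<ge> y" if "x \<in> {a..b}" for x
      using monotone_onD[OF assms(3) _ that, of a] that 2 assms(1) by auto
    then show ?thesis using that[of a] assms(1) 2 by auto
  next
    case 3
    then obtain c where c: "a \<le> c" "c \<le> b" "p c = y"
      using IVT'[of p a y b] assms by auto
    show ?thesis
    proof (rule that[of c])
      show "p x \<le> y" if "x \<in> {a..b}" "x < c" for x
        using monotone_onD[OF assms(3) that(1), of c] that c by auto
      show "p x \<ge> y" if "x \<in> {a..b}" "c < x" for x
        using monotone_onD[OF assms(3) _ that(1), of c] that c by auto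
    qed (use c in auto)
  qed
qed

text \<open>The derivative of the phase is monotone on the half period. The interval on which its modulus is at most
  \<open>\<eta>\<close> contributes no more than its length; on the two remaining intervals the van der Corput bound
  applies. The phase carries a minus sign so that its derivative increases.\<close>

lemma oscillatory_integral_sublevel:
  fixes \<tau> m :: real
  assumes ab: "a \<le> b" "-(pi/2) \<le> a" "b \<le> pi/2" and tau: "\<tau> \<ge> 0" and eta: "\<eta> > 0"
    and L: "\<And>\<alpha> \<beta>. -(pi/2) \<le> \<alpha> \<Longrightarrow> \<alpha> \<le> \<beta> \<Longrightarrow> \<beta> \<le> pi/2 \<Longrightarrow> \<bar>\<tau> * sin \<alpha> - m\<bar> \<le> \<eta> \<Longrightarrow>
              \<bar>\<tau> * sin \<beta> - m\<bar> \<le> \<eta> \<Longrightarrow> \<beta> - \<alpha> \<le> L" and L0: "L \<ge> 0"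
  shows "cmod (integral {a..b} (\<lambda>\<theta>. cis (- (m * \<theta> + \<tau> * cos \<theta>)))) \<le> L + 8 / \<eta>"
proof -
  define p where "p \<theta> = \<tau> * sin \<theta> - m" for \<theta>
  define f where "f \<theta> = cis (- (m * \<theta> + \<tau> * cos \<theta>))" for \<theta>
  have fi: "f integrable_on {x..y}" for x y
    unfolding f_def by (intro integrable_continuous_real continuous_intros)
  have cp: "continuous_on {a..b} p" unfolding p_def by (intro continuous_intros)
  have mp: "mono_on {a..b} p"
  proof (rule mono_onI)
    fix x y assume "x \<in> {a..b}" "y \<in> {a..b}" "x \<le> y"
    then have "sin x \<le> sin y" using sin_mono_le_eq[of x y] ab by auto
    then show "p x \<le> p y" unfolding p_def using tau by (simp add: mult_left_mono)
  qed
  have vdc: "cmod (integral {x..y} f) \<le> 4 / \<eta>"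
    if "a \<le> x" "x \<le> y" "y \<le> b" "x < y \<Longrightarrow> \<forall>z\<in>{x..y}. \<bar>p z\<bar> \<ge> \<eta>" for x y
  proof (cases "x = y")
    case True then show ?thesis using eta by simp
  next
    case False
    show ?thesis unfolding f_def
    proof (rule van_der_corput[where p = p and p' = "\<lambda>\<theta>. \<tau> * cos \<theta>"])
      fix z assume z: "z \<in> {x..y}"
      show "0 \<le> \<tau> * cos z" using z that ab tau by (intro mult_nonneg_nonneg cos_ge_zero) auto
      show "\<eta> \<le> \<bar>p z\<bar>" using that False z by auto
    qed (auto intro!: derivative_eq_intros simp: p_def[abs_def] eta that)
  qed
  obtain \<alpha> where \<alpha>: "\<alpha> \<in> {a..b}" "\<And>x. x \<in> {a..b} \<Longrightarrow> x < \<alpha> \<Longrightarrow> p x \<le> -\<eta>"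
    "\<And>x. x \<in> {a..b} \<Longrightarrow> \<alpha> < x \<Longrightarrow> -\<eta> \<le> p x" "a < \<alpha> \<Longrightarrow> p \<alpha> \<le> -\<eta>" "\<alpha> < b \<Longrightarrow> -\<eta> \<le> p \<alpha>"
    using increasing_level_split[OF ab(1) cp mp] by metis
  obtain \<beta> where \<beta>: "\<beta> \<in> {a..b}" "\<And>x. x \<in> {a..b} \<Longrightarrow> x < \<beta> \<Longrightarrow> p x \<le> \<eta>"
    "\<And>x. x \<in> {a..b} \<Longrightarrow> \<beta> < x \<Longrightarrow> \<eta> \<le> p x" "a < \<beta> \<Longrightarrow> p \<beta> \<le> \<eta>" "\<beta> < b \<Longrightarrow> \<eta> \<le> p \<beta>"
    using increasing_level_split[OF ab(1) cp mp] by metis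
  have \<alpha>\<beta>: "\<alpha> \<le> \<beta>"
  proof (rule ccontr)
    assume "\<not> \<alpha> \<le> \<beta>"
    then have "p ((\<alpha>+\<beta>)/2) \<le> -\<eta>" "p ((\<alpha>+\<beta>)/2) \<ge> \<eta>"
      using \<alpha>(2)[of "(\<alpha>+\<beta>)/2"] \<beta>(3)[of "(\<alpha>+\<beta>)/2"] \<alpha>(1) \<beta>(1) by auto
    then show False using eta by linarith
  qed
  have 1: "cmod (integral {a..\<alpha>} f) \<le> 4 / \<eta>"
  proof (rule vdc)
    show "\<forall>z\<in>{a..\<alpha>}. \<eta> \<le> \<bar>p z\<bar>" if "a < \<alpha>"
    proof
      fix z assume "z \<in> {a..\<alpha>}"
      then have "p z \<le> -\<eta>" using \<alpha>(1,4) \<alpha>(2)[of z] that by (cases "z = \<alpha>") auto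
      then show "\<eta> \<le> \<bar>p z\<bar>" by linarith
    qed
  qed (use \<alpha>(1) in auto)
  have 2: "cmod (integral {\<beta>..b} f) \<le> 4 / \<eta>"
  proof (rule vdc)
    show "\<forall>z\<in>{\<beta>..b}. \<eta> \<le> \<bar>p z\<bar>" if "\<beta> < b"
    proof
      fix z assume "z \<in> {\<beta>..b}"
      then have "p z \<ge> \<eta>" using \<beta>(1,5) \<beta>(3)[of z] that by (cases "z = \<beta>") auto
      then show "\<eta> \<le> \<bar>p z\<bar>" by linarith
    qed
  qed (use \<beta>(1) in auto)
  have len: "\<beta> - \<alpha> \<le> L"
  proof (cases "\<alpha> = \<beta>")
    case False
    then have lt: "\<alpha> < \<beta>" using \<alpha>\<beta> by simp
    then have "\<bar>p \<alpha>\<bar> \<le> \<eta>" "\<bar>p \<beta>\<bar> \<le> \<eta>"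
      using \<alpha>(1,5) \<beta>(1,4) \<alpha>(3)[of \<beta>] \<beta>(2)[of \<alpha>] eta by auto
    then show ?thesis using L[of \<alpha> \<beta>] \<alpha>\<beta> \<alpha>(1) \<beta>(1) ab by (auto simp: p_def)
  qed (use L0 in auto)
  have 3: "cmod (integral {\<alpha>..\<beta>} f) \<le> \<beta> - \<alpha>"
  proof -
    have "cmod (integral {\<alpha>..\<beta>} f) \<le> integral {\<alpha>..\<beta>} (\<lambda>x. 1)"
      by (rule integral_norm_bound_integral[OF fi]) (auto simp: f_def)
    then show ?thesis using \<alpha>\<beta> by simp
  qed
  have "integral {a..b} f = integral {a..\<alpha>} f + integral {\<alpha>..\<beta>} f + integral {\<beta>..b} f"
    using \<alpha>(1) \<beta>(1) \<alpha>\<beta>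
    by (metis Henstock_Kurzweil_Integration.integral_combine atLeastAtMost_iff fi order_trans)
  then have "cmod (integral {a..b} f) \<le> cmod (integral {a..\<alpha>} f) + cmod (integral {\<alpha>..\<beta>} f) + cmod (integral {\<beta>..b} f)"
    by (metis norm_triangle_ineq add_right_mono order_trans)
  then have "cmod (integral {a..b} f) \<le> L + 8 / \<eta>" using 1 2 3 len by simp
  then show ?thesis unfolding f_def[abs_def] .
qed


text \<open>Both factors of \<open>sin \<beta> - sin \<alpha> = 2 sin h cos ((\<alpha> + \<beta>) / 2)\<close>,
  \<open>h = (\<beta> - \<alpha>) / 2\<close>, are at least \<open>sin h \<ge> h / 2\<close>. This quadratic lower
  bound is sharp in order at the turning point \<open>\<pi> / 2\<close>.\<close>

lemma sin_diff_ge_square: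
  assumes "-(pi/2) \<le> \<alpha>" "\<alpha> \<le> \<beta>" "\<beta> \<le> pi/2"
  shows "(\<beta> - \<alpha>)\<^sup>2 / 8 \<le> sin \<beta> - sin \<alpha>"
proof -
  define h where "h = (\<beta> - \<alpha>) / 2"
  have h: "0 \<le> h" "h \<le> pi/2" using assms by (auto simp: h_def)
  have "\<bar>sin h - (\<Sum>m<3. sin_coeff m * h ^ m)\<bar> \<le> inverse (fact 3) * \<bar>h\<bar> ^ 3"
    by (rule Maclaurin_sin_bound)
  then have "\<bar>sin h - h\<bar> \<le> h ^ 3 / 6"
    using h by (simp add: eval_nat_numeral sin_coeff_def fact_numeral)
  moreover have "h ^ 3 / 6 \<le> h / 2"
  proof -
    have "h * h \<le> 1.6 * 1.6" using h pi_approx by (intro mult_mono) auto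
    then have "h * (h * h) \<le> h * 3" using h by (intro mult_left_mono) auto
    then show ?thesis by (simp add: power3_eq_cube)
  qed
  ultimately have sh: "h / 2 \<le> sin h" by linarith
  have "cos \<bar>(\<beta> + \<alpha>) / 2\<bar> \<ge> cos (pi/2 - h)"
  proof (subst cos_mono_le_eq)
    show "\<bar>(\<beta> + \<alpha>) / 2\<bar> \<le> pi/2 - h"
      using assms unfolding h_def by (simp add: abs_le_iff diff_divide_distrib add_divide_distrib)
    then show "\<bar>(\<beta> + \<alpha>) / 2\<bar> \<le> pi" using h by linarith
    show "pi/2 - h \<le> pi" "0 \<le> pi/2 - h" using h by linarith+
  qed auto
  then have "cos ((\<beta> + \<alpha>) / 2) \<ge> cos (pi/2 - h)" by (simp only: cos_abs_real)
  then have c: "cos ((\<beta> + \<alpha>) / 2) \<ge> sin h" by (simp add: cos_diff)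
  have "(\<beta> - \<alpha>)\<^sup>2 / 8 = 2 * ((h/2) * (h/2))" by (simp add: h_def power2_eq_square field_simps)
  also have "\<dots> \<le> 2 * (sin h * cos ((\<beta> + \<alpha>) / 2))"
    using sh c h by (intro mult_left_mono mult_mono) auto
  also have "\<dots> = sin \<beta> - sin \<alpha>" by (simp add: sin_diff_sin h_def)
  finally show ?thesis .
qed

text \<open>The sublevel bound is used with two thresholds. Close to the turning point \<open>m = \<tau>\<close> the
  set where the derivative is at most \<open>\<eta>\<close> has length of order \<open>(\<eta> /
  \<tau>)\<^bsup>1/2\<^esup>\<close>, and \<open>\<eta> = s = \<tau>\<^bsup>1/3\<^esup>\<close> balances it with
  \<open>1 / \<eta>\<close>. At distance \<open>\<delta> = |\<tau> - m|\<close> from it, the cosine is at least of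
  order \<open>(\<delta> / \<tau>)\<^bsup>1/2\<^esup>\<close> on that set, so its length is of order \<open>\<eta> /
  (\<tau> \<delta>)\<^bsup>1/2\<^esup>\<close>, and \<open>\<eta> = (\<tau> \<delta>)\<^bsup>1/4\<^esup>\<close> is
  the balanced choice.\<close>

lemma oscillatory_integral_bound:
  fixes \<tau> m s :: real
  assumes ab: "a \<le> b" "-(pi/2) \<le> a" "b \<le> pi/2" and s: "s > 0" "\<tau> = s ^ 3" and m: "m \<ge> 0"
  shows "cmod (integral {a..b} (\<lambda>\<theta>. cis (- (m * \<theta> + \<tau> * cos \<theta>)))) ^ 4 \<le> 82944 / (\<tau> * (s + \<bar>\<tau> - m\<bar>))"
    (is "cmod ?I ^ 4 \<le> _")
proof -
  define \<delta> where "\<delta> = \<bar>\<tau> - m\<bar>"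
  have \<tau>: "\<tau> > 0" using s by simp
  have \<delta>0: "\<delta> \<ge> 0" by (simp add: \<delta>_def)
  show ?thesis
  proof (cases "\<delta> < 3 * s")
    case True
    have "cmod ?I \<le> 4 / s + 8 / s"
    proof (rule oscillatory_integral_sublevel[OF ab])
      fix \<alpha> \<beta> assume 1: "-(pi/2) \<le> \<alpha>" "\<alpha> \<le> \<beta>" "\<beta> \<le> pi/2" "\<bar>\<tau> * sin \<alpha> - m\<bar> \<le> s" "\<bar>\<tau> * sin \<beta> - m\<bar> \<le> s"
      have "\<tau> * ((\<beta> - \<alpha>)\<^sup>2 / 8) \<le> \<tau> * (sin \<beta> - sin \<alpha>)"
        using sin_diff_ge_square[OF 1(1-3)] \<tau> by (intro mult_left_mono) auto
      also have "\<dots> \<le> 2 * s" using 1(4,5) by (simp add: algebra_simps abs_le_iff)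
      finally have "s ^ 3 * (\<beta> - \<alpha>)\<^sup>2 \<le> 16 * s" using s by simp
      then have "s * (s * (\<beta> - \<alpha>))\<^sup>2 \<le> s * 4\<^sup>2" by (simp add: power_mult_distrib power3_eq_cube power2_eq_square mult_ac)
      then have "(s * (\<beta> - \<alpha>))\<^sup>2 \<le> 4\<^sup>2" using s by simp
      then have "s * (\<beta> - \<alpha>) \<le> 4" by (rule power2_le_imp_le) simp
      then show "\<beta> - \<alpha> \<le> 4 / s" using s by (simp add: field_simps)
    qed (use s \<tau> in auto)
    then have "cmod ?I ^ 4 \<le> (12 / s) ^ 4" by (intro power_mono) auto
    also have "\<dots> = 20736 / (\<tau> * s)" using s by (simp add: power_divide eval_nat_numeral)
    also have "\<dots> = 82944 / (\<tau> * (4 * s))" by simp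
    also have "\<dots> \<le> 82944 / (\<tau> * (s + \<delta>))"
      using True s \<tau> \<delta>0 by (intro divide_left_mono mult_left_mono mult_pos_pos) auto
    finally show ?thesis by (simp add: \<delta>_def)
  next
    case False
    define q where "q = sqrt (sqrt (\<tau> * \<delta>))"
    have \<delta>: "\<delta> > 0" using False s by simp
    have q: "q > 0" "q ^ 4 = \<tau> * \<delta>"
    proof -
      have "q ^ 4 = (q\<^sup>2)\<^sup>2" by simp
      also have "\<dots> = \<tau> * \<delta>" unfolding q_def using \<tau> \<delta> by (simp del: power2_eq_square)
      finally show "q ^ 4 = \<tau> * \<delta>" .
    qed (use \<tau> \<delta> in \<open>auto simp: q_def\<close>)
    have q\<delta>: "q \<le> \<delta> / 2"
    proof -
      have "27 * s ^ 3 \<le> \<delta> ^ 3" using power_mono[of "3 * s" \<delta> 3] False s by (simp add: power_mult_distrib)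
      then have "\<tau> * 16 \<le> \<delta> ^ 3" using \<tau> unfolding s(2) by linarith
      then have "\<tau> * 16 * \<delta> \<le> \<delta> ^ 3 * \<delta>" using \<delta> by (intro mult_right_mono) auto
      moreover have "(\<delta> / 2) ^ 4 = \<delta> ^ 3 * \<delta> / 16" by (simp add: power_divide eval_nat_numeral)
      ultimately have "q ^ 4 \<le> (\<delta> / 2) ^ 4" unfolding q(2) by linarith
      then show ?thesis by (rule power_le_imp_le_base[of q 3, simplified]) (use \<delta> in auto)
    qed
    have "cmod ?I \<le> 4 / q + 8 / q"
    proof (rule oscillatory_integral_sublevel[OF ab])
      fix \<alpha> \<beta> assume 1: "-(pi/2) \<le> \<alpha>" "\<alpha> \<le> \<beta>" "\<beta> \<le> pi/2" "\<bar>\<tau> * sin \<alpha> - m\<bar> \<le> q" "\<bar>\<tau> * sin \<beta> - m\<bar> \<le> q"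
      have "\<tau> * sin \<beta> \<le> \<tau> * 1" using \<tau> by (intro mult_left_mono) auto
      then have mt: "m < \<tau>" using 1(5) q\<delta> \<delta> by (auto simp: \<delta>_def abs_if split: if_splits)
      show "\<beta> - \<alpha> \<le> 4 / q"
      proof (cases "\<alpha> = \<beta>")
        case False
        then have "\<alpha> < \<beta>" using 1 by simp
        then obtain z where z: "\<alpha> < z" "z < \<beta>" "sin \<beta> - sin \<alpha> = (\<beta> - \<alpha>) * cos z"
          using MVT2[of \<alpha> \<beta> sin cos] by auto
        have sz: "sin \<alpha> \<le> sin z" "sin z \<le> sin \<beta>"
          using z 1 by (auto simp: sin_mono_le_eq)
        have d1: "\<delta> = \<tau> - m" using mt by (simp add: \<delta>_def)
        have "\<tau> * sin z \<le> \<tau> * sin \<beta>" "\<tau> * sin z \<ge> \<tau> * sin \<alpha>" using sz \<tau> by auto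
        then have "\<tau> * (1 - sin z) \<ge> \<delta> / 2" "\<tau> * (1 + sin z) \<ge> \<tau> / 2"
          using 1(4,5) q\<delta> d1 m by (auto simp: algebra_simps abs_le_iff)
        then have "\<tau> * (1 - sin z) * (\<tau> * (1 + sin z)) \<ge> \<delta> / 2 * (\<tau> / 2)"
          using \<tau> \<delta> by (intro mult_mono) auto
        moreover have "(cos z)\<^sup>2 = (1 - sin z) * (1 + sin z)" by (simp add: cos_squared_eq algebra_simps power2_eq_square)
        ultimately have c: "(\<tau> * cos z)\<^sup>2 \<ge> \<delta> * \<tau> / 4" by (simp add: power_mult_distrib power2_eq_square mult_ac)
        have "\<tau> * (sin \<beta> - sin \<alpha>) \<le> 2 * q" using 1(4,5) by (simp add: algebra_simps abs_le_iff)
        then have "(\<beta> - \<alpha>) * (\<tau> * cos z) \<le> 2 * q" unfolding z(3) by (simp add: mult_ac)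
        moreover have "(\<beta> - \<alpha>) * (\<tau> * cos z) \<ge> 0"
          using 1 z \<tau> by (intro mult_nonneg_nonneg cos_ge_zero) auto
        ultimately have "((\<beta> - \<alpha>) * (\<tau> * cos z))\<^sup>2 \<le> (2 * q)\<^sup>2" by (intro power_mono)
        then have "(\<beta> - \<alpha>)\<^sup>2 * (\<tau> * cos z)\<^sup>2 \<le> 4 * q\<^sup>2" by (simp add: power_mult_distrib)
        moreover have "(\<beta> - \<alpha>)\<^sup>2 * (\<delta> * \<tau> / 4) \<le> (\<beta> - \<alpha>)\<^sup>2 * (\<tau> * cos z)\<^sup>2"
          using c by (intro mult_left_mono) auto
        ultimately have "(\<beta> - \<alpha>)\<^sup>2 * (\<tau> * \<delta>) \<le> 16 * q\<^sup>2" by (simp add: mult_ac)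
        then have "(\<beta> - \<alpha>)\<^sup>2 * q ^ 4 \<le> 16 * q\<^sup>2" by (simp add: q(2))
        then have "q\<^sup>2 * (q * (\<beta> - \<alpha>))\<^sup>2 \<le> q\<^sup>2 * 4\<^sup>2"
          by (simp add: power_mult_distrib eval_nat_numeral mult_ac)
        then have "(q * (\<beta> - \<alpha>))\<^sup>2 \<le> 4\<^sup>2" using q by simp
        then have "q * (\<beta> - \<alpha>) \<le> 4" by (rule power2_le_imp_le) simp
        then show ?thesis using q by (simp add: field_simps)
      qed (use q in auto)
    qed (use q \<tau> in auto)
    then have "cmod ?I ^ 4 \<le> (12 / q) ^ 4" by (intro power_mono) auto
    also have "\<dots> = 20736 / (\<tau> * \<delta>)" by (simp add: power_divide q)
    also have "\<dots> = 82944 / (\<tau> * (4 * \<delta>))" by simp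
    also have "\<dots> \<le> 82944 / (\<tau> * (s + \<delta>))"
      using False s \<tau> \<delta> by (intro divide_left_mono mult_left_mono mult_pos_pos) auto
    finally show ?thesis by (simp add: \<delta>_def)
  qed
qed

lemma full_oscillatory_integral_bound_nonneg:
  fixes \<tau> m s :: real
  assumes s: "s > 0" "\<tau> = s ^ 3" and m: "m \<ge> 0"
  shows "cmod (integral {-pi..pi} (\<lambda>\<theta>. cis (- (m * \<theta> + \<tau> * cos \<theta>)))) ^ 4 \<le> 3 ^ 4 * 82944 / (\<tau> * (s + \<bar>\<tau> - m\<bar>))"
proof -
  define f where "f \<theta> = cis (- (m * \<theta> + \<tau> * cos \<theta>))" for \<theta>
  have cf: "continuous_on A f" for A unfolding f_def by (intro continuous_intros)
  have fi: "f integrable_on {x..y}" for x y by (intro integrable_continuous_real cf)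
  \<comment> \<open>The bound for one half period or less, to be used for three pieces.\<close>
  define M where "M = root 4 (82944 / (\<tau> * (s + \<bar>\<tau> - m\<bar>)))"
  have pos: "0 \<le> 82944 / (\<tau> * (s + \<bar>\<tau> - m\<bar>))" using s by auto
  have bd: "cmod (integral {a..b} f) \<le> M" if "a \<le> b" "-(pi/2) \<le> a" "b \<le> pi/2" for a b
  proof -
    have "cmod (integral {a..b} f) ^ 4 \<le> 82944 / (\<tau> * (s + \<bar>\<tau> - m\<bar>))"
      using oscillatory_integral_bound[OF that s m] by (simp add: f_def[abs_def])
    then show ?thesis unfolding M_def by (metis norm_ge_zero real_root_le_iff real_root_power_cancel zero_less_numeral)
  qed
  \<comment> \<open>The outer quarters are reflected into the inner half period, where the phase changes sign.\<close>
  have refl: "cmod (integral {c - b..c - a} f) = cmod (integral {a..b} f)"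
    if ab: "a \<le> b" and c: "c = pi \<or> c = -pi" for a b c
  proof -
    have "((\<lambda>x. f ((-1) *\<^sub>R x + c)) has_integral (1 / (\<bar>-1\<bar> ^ DIM(real))) *\<^sub>R integral (cbox (c-b) (c-a)) f) 
       ((\<lambda>x. (1 / (-1)) *\<^sub>R x + -((1 / (-1)) *\<^sub>R c)) ` cbox (c-b) (c-a))"
      by (rule has_integral_affinity) (use fi in \<open>auto intro!: integrable_integral\<close>)
    moreover have "((\<lambda>x. (1 / (-1)) *\<^sub>R x + -((1 / (-1)) *\<^sub>R c)) ` cbox (c-b) (c-a)) = {a..b}"
      using ab by (auto simp: image_iff intro!: bexI[of _ "c - _"])
    moreover have "cos (- pi - y) = - cos y" for y
      using cos_minus[of "pi + y"] by simp
    then have "f ((-1) *\<^sub>R x + c) = cis (- (m * c)) * cnj (f x)" for x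
      using c by (auto simp: f_def cis_cnj cis_mult algebra_simps)
    ultimately have "((\<lambda>x. cis (- (m * c)) * cnj (f x)) has_integral integral {c-b..c-a} f) {a..b}" by simp
    moreover have "((\<lambda>x. cis (- (m * c)) * cnj (f x)) has_integral cis (- (m * c)) * cnj (integral {a..b} f)) {a..b}"
    proof (rule has_integral_mult_right)
      have "(f has_integral integral {a..b} f) {a..b}" using fi by (rule integrable_integral)
      then show "((\<lambda>x. cnj (f x)) has_integral cnj (integral {a..b} f)) {a..b}"
        using has_integral_cnj[of f "integral {a..b} f" "{a..b}"] by (simp add: comp_def)
    qed
    ultimately have "integral {c-b..c-a} f = cis (- (m * c)) * cnj (integral {a..b} f)"
      by (rule has_integral_unique)
    then show ?thesis by (simp add: norm_mult)
  qed
  have 1: "cmod (integral {-pi..-(pi/2)} f) \<le> M"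
    using refl[of "-(pi/2)" 0 "-pi"] bd[of "-(pi/2)" 0] by simp
  have 2: "cmod (integral {pi/2..pi} f) \<le> M"
    using refl[of 0 "pi/2" pi] bd[of 0 "pi/2"] by simp
  have 3: "cmod (integral {-(pi/2)..pi/2} f) \<le> M" using bd[of "-(pi/2)" "pi/2"] by simp
  have A: "integral {-pi..pi} f = integral {-pi..-(pi/2)} f + integral {-(pi/2)..pi} f"
    using Henstock_Kurzweil_Integration.integral_combine[of "-pi" "-(pi/2)" pi f] fi pi_gt_zero by simp
  have B: "integral {-(pi/2)..pi} f = integral {-(pi/2)..pi/2} f + integral {pi/2..pi} f"
    using Henstock_Kurzweil_Integration.integral_combine[of "-(pi/2)" "pi/2" pi f] fi by simp
  have "integral {-pi..pi} f = integral {-pi..-(pi/2)} f + integral {-(pi/2)..pi/2} f + integral {pi/2..pi} f"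
    unfolding A B by (rule add.assoc[symmetric])
  then have "cmod (integral {-pi..pi} f) \<le> 3 * M"
    using 1 2 3 norm_triangle_ineq[of "integral {-pi..-(pi/2)} f + integral {-(pi/2)..pi/2} f" "integral {pi/2..pi} f"]
      norm_triangle_ineq[of "integral {-pi..-(pi/2)} f" "integral {-(pi/2)..pi/2} f"] by simp
  then have "cmod (integral {-pi..pi} f) ^ 4 \<le> (3 * M) ^ 4" by (intro power_mono) auto
  also have "\<dots> = 3 ^ 4 * 82944 / (\<tau> * (s + \<bar>\<tau> - m\<bar>))"
    using pos by (simp add: power_mult_distrib M_def)
  finally show ?thesis unfolding f_def[abs_def] .
qed

lemma full_oscillatory_integral_bound:
  fixes \<tau> m s :: real
  assumes s: "s > 0" "\<tau> = s ^ 3"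
  shows "cmod (integral {-pi..pi} (\<lambda>\<theta>. cis (- (m * \<theta> + \<tau> * cos \<theta>)))) ^ 4 \<le> 3 ^ 4 * 82944 / (\<tau> * (s + \<bar>\<tau> - \<bar>m\<bar>\<bar>))"
proof (cases "m \<ge> 0")
  case True then show ?thesis using full_oscillatory_integral_bound_nonneg[OF s True] by simp
next
  case False
  define f where "f \<theta> = cis (- (m * \<theta> + \<tau> * cos \<theta>))" for \<theta>
  have "integral {-pi..pi} f = integral {-pi..pi} (\<lambda>\<theta>. f (- \<theta>))"
    using Henstock_Kurzweil_Integration.integral_reflect_real[of pi "-pi" f] by simp
  then have "integral {-pi..pi} (\<lambda>\<theta>. cis (- (m * \<theta> + \<tau> * cos \<theta>))) =
        integral {-pi..pi} (\<lambda>\<theta>. cis (- ((-m) * \<theta> + \<tau> * cos \<theta>)))"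
    by (simp add: f_def[abs_def])
  then show ?thesis using full_oscillatory_integral_bound_nonneg[OF s, of "-m"] False by simp
qed

text \<open>For integral \<open>m\<close> this is, up to a unimodular factor, the Bessel function value \<open>J\<^sub>m (2 t)\<close>.\<close>

definition propagator_kernel_1d :: "real \<Rightarrow> real \<Rightarrow> complex" where
  "propagator_kernel_1d m t = integral {-1/2..1/2} (\<lambda>x. cis (2 * pi * m * x - 4 * t * (sin (pi * x))\<^sup>2))"

text \<open>The substitution \<open>\<theta> = 2 \<pi> x\<close> and \<open>2 sin\<^sup>2 = 1 - cos\<close> of the
  double angle turn the integral into an integral with phase \<open>m \<theta> + 2 t cos \<theta>\<close>, up to a
  unimodular factor. The bound is uniform in \<open>m\<close>.\<close>

lemma propagator_kernel_1d_bound: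
  assumes s: "s > 0" "s ^ 3 = 2 * \<bar>t\<bar>"
  shows "cmod (propagator_kernel_1d m t) ^ 4 \<le> 82944 / (\<bar>t\<bar> * (s + \<bar>2 * \<bar>t\<bar> - \<bar>m\<bar>\<bar>))"
proof -
  define g where "g \<theta> = cis (m * \<theta> + 2 * t * cos \<theta>)" for \<theta>
  have gi: "g integrable_on {-pi..pi}"
    unfolding g_def by (intro integrable_continuous_real continuous_intros)
  have "((\<lambda>x. g ((2 * pi) *\<^sub>R x + 0)) has_integral (integral (cbox (-pi) pi) g /\<^sub>R (2 * pi) ^ DIM(real)))
           (cbox ((-pi - 0) /\<^sub>R (2 * pi)) ((pi - 0) /\<^sub>R (2 * pi)))"
    by (rule has_integral_affinity') (use gi in \<open>auto intro!: integrable_integral\<close>)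
  then have "((\<lambda>x. g (2 * pi * x)) has_integral (integral {-pi..pi} g /\<^sub>R (2 * pi))) {-1/2..1/2}"
    by (simp add: field_simps)
  then have I: "integral {-1/2..1/2} (\<lambda>x. g (2 * pi * x)) = integral {-pi..pi} g /\<^sub>R (2 * pi)"
    by (rule integral_unique)
  have "cis (2 * pi * m * x - 4 * t * (sin (pi * x))\<^sup>2) = cis (- 2 * t) * g (2 * pi * x)" for x
  proof -
    have c: "cos (2 * pi * x) = 1 - 2 * (sin (pi * x))\<^sup>2"
      using cos_double_sin[of "pi * x"] by (simp add: mult.assoc)
    show ?thesis unfolding g_def cis_mult c by (simp add: algebra_simps)
  qed
  then have "propagator_kernel_1d m t = integral {-1/2..1/2} (\<lambda>x. cis (- 2 * t) * g (2 * pi * x))"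
    unfolding propagator_kernel_1d_def by (simp only:)
  also have "\<dots> = cis (- 2 * t) * integral {-1/2..1/2} (\<lambda>x. g (2 * pi * x))"
    by (rule integral_mult_right)
  finally have "propagator_kernel_1d m t = cis (- 2 * t) * (integral {-pi..pi} g /\<^sub>R (2 * pi))"
    by (simp only: I)
  then have "cmod (propagator_kernel_1d m t) = cmod (cis (- 2 * t)) * (\<bar>inverse (2 * pi)\<bar> * cmod (integral {-pi..pi} g))"
    by (simp only: norm_mult norm_scaleR)
  also have "\<dots> = cmod (integral {-pi..pi} g) / (2 * pi)"
    using pi_gt_zero unfolding norm_cis by (simp add: field_simps)
  also have "\<dots> \<le> cmod (integral {-pi..pi} g) / 3"
    using pi_gt3 by (intro divide_left_mono) auto
  finally have 1: "cmod (propagator_kernel_1d m t) \<le> cmod (integral {-pi..pi} g) / 3" .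
  have 2: "cmod (integral {-pi..pi} g) ^ 4 \<le> 3 ^ 4 * 82944 / (s ^ 3 * (s + \<bar>s ^ 3 - \<bar>m\<bar>\<bar>))"
  proof (cases "t \<ge> 0")
    case True
    have "integral {-pi..pi} g = cnj (integral {-pi..pi} (\<lambda>\<theta>. cis (- (m * \<theta> + s ^ 3 * cos \<theta>))))"
      unfolding integral_cnj using True by (simp add: g_def[abs_def] cis_cnj s add.commute)
    then show ?thesis using full_oscillatory_integral_bound[OF s(1) refl, of m] by simp
  next
    case False
    have "integral {-pi..pi} g = integral {-pi..pi} (\<lambda>\<theta>. cis (- ((-m) * \<theta> + s ^ 3 * cos \<theta>)))"
      using False by (simp add: g_def[abs_def] s add.commute)
    then show ?thesis using full_oscillatory_integral_bound[OF s(1) refl, of "-m"] by simp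
  qed
  have "cmod (propagator_kernel_1d m t) ^ 4 \<le> (cmod (integral {-pi..pi} g) / 3) ^ 4"
    using 1 by (intro power_mono) auto
  also have "\<dots> \<le> 82944 / (s ^ 3 * (s + \<bar>s ^ 3 - \<bar>m\<bar>\<bar>))"
    using 2 by (simp add: power_divide)
  also have "\<dots> \<le> 82944 / (\<bar>t\<bar> * (s + \<bar>2 * \<bar>t\<bar> - \<bar>m\<bar>\<bar>))"
  proof -
    have "\<bar>t\<bar> > 0" using s by (metis zero_less_power zero_less_mult_pos zero_less_numeral)
    then show ?thesis unfolding s(2) using s(1) by (intro divide_left_mono mult_right_mono mult_pos_pos) auto
  qed
  finally show ?thesis .
qed

section \<open>Moments in time of the one-dimensional kernel\<close>

text \<open>On each side of \<open>M\<close> the integer parts of the distances \<open>\<bar>f k - M\<bar>\<close> are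
  distinct, because the points \<open>f k\<close> are separated; so each side is dominated by the sum over the
  integers.\<close>

lemma sum_antimono_distance_le:
  fixes g :: "real \<Rightarrow> real" and f :: "'k \<Rightarrow> real" and M B :: real
  assumes anti: "\<And>x y. 0 \<le> x \<Longrightarrow> x \<le> y \<Longrightarrow> g y \<le> g x" and nn: "\<And>x. 0 \<le> x \<Longrightarrow> 0 \<le> g x"
    and B: "\<And>n. (\<Sum>j<n. g (real j)) \<le> B"
    and sep: "\<And>k l. k \<noteq> l \<Longrightarrow> 1 \<le> \<bar>f k - f l\<bar>" and S: "finite S"
  shows "(\<Sum>k\<in>S. g \<bar>f k - M\<bar>) \<le> 2 * B"
proof -
  define fl where "fl k = nat \<lfloor>\<bar>f k - M\<bar>\<rfloor>" for k
  have half: "(\<Sum>k\<in>T. g \<bar>f k - M\<bar>) \<le> B" if T: "finite T" and inj: "inj_on fl T" for T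
  proof -
    have "(\<Sum>k\<in>T. g \<bar>f k - M\<bar>) \<le> (\<Sum>k\<in>T. g (real (fl k)))"
      by (intro sum_mono anti) (auto simp: fl_def)
    also have "\<dots> = (\<Sum>j\<in>fl ` T. g (real j))" using sum.reindex[OF inj, of "\<lambda>j. g (real j)"] by simp
    also have "\<dots> \<le> (\<Sum>j<Suc (Max (insert 0 (fl ` T))). g (real j))"
      using T by (intro sum_mono2 nn) (auto simp: less_Suc_eq_le)
    also have "\<dots> \<le> B" by (rule B)
    finally show ?thesis .
  qed
  have i1: "inj_on fl {k\<in>S. M \<le> f k}"
  proof (rule inj_onI)
    fix k l assume kl: "k \<in> {k\<in>S. M \<le> f k}" "l \<in> {k\<in>S. M \<le> f k}" "fl k = fl l"
    then have "\<lfloor>f k - M\<rfloor> = \<lfloor>f l - M\<rfloor>" by (simp add: fl_def nat_eq_iff split: if_splits)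
    then have "\<bar>f k - f l\<bar> < 1" by linarith
    then show "k = l" using sep[of k l] by force
  qed
  have i2: "inj_on fl {k\<in>S. \<not> M \<le> f k}"
  proof (rule inj_onI)
    fix k l assume kl: "k \<in> {k\<in>S. \<not> M \<le> f k}" "l \<in> {k\<in>S. \<not> M \<le> f k}" "fl k = fl l"
    then have "\<bar>f k - M\<bar> = M - f k" "\<bar>f l - M\<bar> = M - f l" by auto
    then have "\<lfloor>M - f k\<rfloor> = \<lfloor>M - f l\<rfloor>" using kl by (simp add: fl_def nat_eq_iff split: if_splits)
    then have "\<bar>f k - f l\<bar> < 1" by linarith
    then show "k = l" using sep[of k l] by force
  qed
  have "(\<Sum>k\<in>S. g \<bar>f k - M\<bar>) =
      (\<Sum>k\<in>{k\<in>S. M \<le> f k}. g \<bar>f k - M\<bar>) + (\<Sum>k\<in>{k\<in>S. \<not> M \<le> f k}. g \<bar>f k - M\<bar>)"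
    by (subst sum.union_disjoint[symmetric]) (auto intro!: sum.cong S simp: S)
  then show ?thesis using half[OF _ i1] half[OF _ i2] S by simp
qed

lemma real_nat_separated:
  assumes "k \<noteq> l"
  shows "1 \<le> \<bar>2 * real k - 2 * real l\<bar>"
proof -
  have "1 \<le> \<bar>int k - int l\<bar>" using assms by linarith
  then have "real_of_int 1 \<le> real_of_int \<bar>int k - int l\<bar>" by (rule of_int_le_iff[THEN iffD2])
  then show ?thesis by simp
qed

lemma sum_powr_bounded:
  fixes a :: real
  assumes "a > 1"
  shows "\<exists>B\<ge>0. (\<forall>S. finite S \<longrightarrow> 0 \<notin> S \<longrightarrow> (\<Sum>k\<in>S. real k powr (-a)) \<le> B) \<and>
    (\<forall>n. (\<Sum>j<n. (1 + real j) powr (-a)) \<le> B)"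
proof -
  have sm: "summable (\<lambda>k. real k powr (-a))" using assms by (simp add: summable_real_powr_iff)
  define B where "B = (\<Sum>k. real k powr (-a))"
  have 1: "(\<Sum>k\<in>S. real k powr (-a)) \<le> B" if "finite S" for S
    unfolding B_def by (rule sum_le_suminf[OF sm that]) auto
  have 2: "(\<Sum>j<n. (1 + real j) powr (-a)) \<le> B" for n
  proof -
    have "(\<Sum>j<n. (1 + real j) powr (-a)) = (\<Sum>k\<in>Suc ` {..<n}. real k powr (-a))"
      by (subst sum.reindex) (auto simp: add.commute)
    then show ?thesis using 1[of "Suc ` {..<n}"] by simp
  qed
  show ?thesis using 1[of "{}"] 1 2 by (intro exI[of _ B]) auto
qed

text \<open>Telescoping, because \<open>x\<^bsup>-5/4\<^esup>\<close> is the derivative of \<open>-4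
  x\<^bsup>-1/4\<^esup>\<close>. The power of \<open>A\<close> on the right compensates the factor
  \<open>A\<^bsup>1/4\<^esup>\<close> that accompanies these sums at the endpoint exponent for \<open>d \<ge>
  5\<close>.\<close>

lemma sum_shifted_powr_le:
  fixes A :: real
  assumes A: "A \<ge> 1"
  shows "(\<Sum>j<n. (A + real j) powr (-5/4)) \<le> 5 * A powr (-1/4)"
proof -
  have "(\<Sum>j<Suc n. (A + real j) powr (-5/4)) \<le> 5 * A powr (-1/4) - 4 * (A + real n) powr (-1/4)" for n
  proof (induction n)
    case 0
    have "A powr (-5/4) \<le> A powr (-1/4)" using A by (intro powr_mono) auto
    then show ?case by simp
  next
    case (Suc n)
    define x where "x = A + real n"
    have x: "x \<ge> 1" using A by (simp add: x_def)
    obtain z where z: "x < z" "z < x + 1"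
      "(-4) * (x + 1) powr (-1/4) - (-4) * x powr (-1/4) = (x + 1 - x) * z powr (-5/4)"
    proof -
      have "((\<lambda>x. (-4) * x powr (-1/4)) has_real_derivative z powr (-5/4)) (at z)" if "x \<le> z" for z
        using DERIV_cmult[OF has_real_derivative_powr[of z "-1/4"], of "-4"] that x by simp
      then show ?thesis using MVT2[of x "x + 1" "\<lambda>x. (-4) * x powr (-1/4)" "\<lambda>z. z powr (-5/4)"] that by auto
    qed
    have "(x + 1) powr (-5/4) \<le> z powr (-5/4)" using z x by (intro powr_mono2') auto
    then have "(x + 1) powr (-5/4) \<le> 4 * x powr (-1/4) - 4 * (x + 1) powr (-1/4)" using z by simp
    then show ?case using Suc by (simp add: x_def algebra_simps)
  qed
  moreover have "0 \<le> (A + real n) powr (-5/4)" "0 \<le> (A + real n) powr (-1/4)" by simp_all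
  ultimately show ?thesis using sum.lessThan_Suc[of "\<lambda>j. (A + real j) powr (-5/4)" n] by (smt (verit))
qed

lemma kernel_pointwise:
  fixes k :: nat
  assumes "k \<ge> 1"
  shows "cmod (propagator_kernel_1d m (real k)) ^ 4 \<le> 82944 / (real k * (real k powr (1/3) + \<bar>2 * real k - \<bar>m\<bar>\<bar>))"
proof -
  define s where "s = (2 * real k) powr (1/3)"
  have s: "s > 0" "s ^ 3 = 2 * \<bar>real k\<bar>"
    using assms by (auto simp: s_def powr_power)
  have ss: "real k powr (1/3) \<le> s" unfolding s_def by (intro powr_mono2) auto
  have "cmod (propagator_kernel_1d m (real k)) ^ 4 \<le> 82944 / (\<bar>real k\<bar> * (s + \<bar>2 * \<bar>real k\<bar> - \<bar>m\<bar>\<bar>))"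
    by (rule propagator_kernel_1d_bound[OF s])
  also have "\<dots> \<le> 82944 / (real k * (real k powr (1/3) + \<bar>2 * real k - \<bar>m\<bar>\<bar>))"
    using ss assms s by (intro divide_left_mono mult_mono mult_pos_pos) (auto intro: add_pos_nonneg)
  finally show ?thesis .
qed

text \<open>With \<open>y = 1 + \<bar>2 k - \<bar>m\<bar>\<bar>\<close> the summand is at most a multiple of
  \<open>k\<^bsup>-e\<^esup> y\<^bsup>-1\<^esup>\<close>, where \<open>e = 1 - \<beta>\<close>. This product is at
  most the larger of \<open>k\<^bsup>-1-e\<^esup>\<close> and \<open>y\<^bsup>-1-e\<^esup>\<close>, and both are
  summable uniformly in \<open>m\<close>. At \<open>\<beta> = 1\<close> the sum would diverge logarithmically.\<close>

lemma kernel_moment_dim4: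
  fixes \<beta> :: real
  assumes "\<beta> < 1"
  shows "\<exists>C. \<forall>m S. finite S \<longrightarrow> 0 \<notin> S \<longrightarrow>
    (\<Sum>k\<in>S. real k powr \<beta> * cmod (propagator_kernel_1d m (real k)) ^ 4) \<le> C"
proof -
  define e where "e = 1 - \<beta>"
  have e: "1 + e > 1" using assms by (simp add: e_def)
  obtain B where B0: "B \<ge> 0" "\<forall>S. finite S \<longrightarrow> 0 \<notin> S \<longrightarrow> (\<Sum>k\<in>S. real k powr (-(1+e))) \<le> B"
    "\<forall>n. (\<Sum>j<n. (1 + real j) powr (-(1+e))) \<le> B"
    using sum_powr_bounded[OF e] by blast
  note B = B0(1) B0(2)[rule_format] B0(3)[rule_format]
  show ?thesis
  proof (intro exI[of _ "82944 * (B + 2 * B)"] allI impI)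
    fix m :: real and S :: "nat set" assume S: "finite S" "0 \<notin> S"
    have "real k powr \<beta> * cmod (propagator_kernel_1d m (real k)) ^ 4
          \<le> 82944 * (real k powr (-(1+e)) + (1 + \<bar>2 * real k - \<bar>m\<bar>\<bar>) powr (-(1+e)))" if "k \<in> S" for k
    proof -
      have k: "k \<ge> 1" using that S by (metis One_nat_def Suc_leI gr0I)
      define y where "y = 1 + \<bar>2 * real k - \<bar>m\<bar>\<bar>"
      have y: "y \<ge> 1" by (simp add: y_def)
      have "cmod (propagator_kernel_1d m (real k)) ^ 4 \<le> 82944 / (real k * (real k powr (1/3) + \<bar>2 * real k - \<bar>m\<bar>\<bar>))"
        by (rule kernel_pointwise[OF k])
      also have "\<dots> \<le> 82944 / (real k * y)"
        using k by (intro divide_left_mono mult_left_mono mult_pos_pos) (auto simp: y_def ge_one_powr_ge_zero intro: add_pos_nonneg)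
      finally have "real k powr \<beta> * cmod (propagator_kernel_1d m (real k)) ^ 4 \<le> real k powr \<beta> * (82944 / (real k * y))"
        by (intro mult_left_mono) auto
      also have "\<dots> = 82944 * (real k powr (-e) * y powr (-1))"
        using k y by (simp add: e_def powr_diff powr_minus_divide field_simps)
      also have "real k powr (-e) * y powr (-1) \<le> real k powr (-(1+e)) + y powr (-(1+e))"
      proof (cases "real k \<le> y")
        case True
        have "y powr (-1) \<le> real k powr (-1)" using True k by (intro powr_mono2') auto
        then have "real k powr (-e) * y powr (-1) \<le> real k powr (-e) * real k powr (-1)"
          by (intro mult_left_mono) auto
        also have "\<dots> = real k powr (-(1+e))" unfolding powr_add[symmetric] by (simp add: algebra_simps)
        finally show ?thesis using powr_ge_zero[of y "-(1+e)"] by linarith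
      next
        case False
        have "real k powr (-e) \<le> y powr (-e)" using False y e by (intro powr_mono2') auto
        then have "real k powr (-e) * y powr (-1) \<le> y powr (-e) * y powr (-1)"
          by (intro mult_right_mono) auto
        also have "\<dots> = y powr (-(1+e))" unfolding powr_add[symmetric] by (simp add: algebra_simps)
        finally show ?thesis using powr_ge_zero[of "real k" "-(1+e)"] by linarith
      qed
      finally show ?thesis by (simp add: y_def)
    qed
    then have "(\<Sum>k\<in>S. real k powr \<beta> * cmod (propagator_kernel_1d m (real k)) ^ 4) \<le>
       (\<Sum>k\<in>S. 82944 * (real k powr (-(1+e)) + (1 + \<bar>2 * real k - \<bar>m\<bar>\<bar>) powr (-(1+e))))"
      by (rule sum_mono)
    also have "\<dots> = 82944 * ((\<Sum>k\<in>S. real k powr (-(1+e))) + (\<Sum>k\<in>S. (1 + \<bar>2 * real k - \<bar>m\<bar>\<bar>) powr (-(1+e))))"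
      by (simp add: sum_distrib_left sum.distrib)
    also have "\<dots> \<le> 82944 * (B + 2 * B)"
    proof (intro mult_left_mono add_mono B S)
      show "(\<Sum>k\<in>S. (1 + \<bar>2 * real k - \<bar>m\<bar>\<bar>) powr (-(1+e))) \<le> 2 * B"
        by (rule sum_antimono_distance_le[where f = "\<lambda>k. 2 * real k" and g = "\<lambda>x. (1 + x) powr (-(1+e))"])
           (use e in \<open>simp_all add: powr_mono2' B(3) S(1) real_nat_separated del: minus_add_distrib\<close>)
    qed auto
    finally show "(\<Sum>k\<in>S. real k powr \<beta> * cmod (propagator_kernel_1d m (real k)) ^ 4) \<le> 82944 * (B + 2 * B)" .
  qed
qed

text \<open>The exponent is the critical one: near the turning point \<open>2 k = \<bar>m\<bar>\<close> the summand
  has size \<open>k\<^bsup>(d-1)/3\<^esup> k\<^bsup>-d/3\<^esup>\<close> on a window of length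
  \<open>k\<^bsup>1/3\<^esup>\<close>. With \<open>s = k\<^bsup>1/3\<^esup>\<close> and \<open>y = s +
  \<delta>\<close> the summand is at most a multiple of \<open>(s / y)\<^bsup>(d-4)/4\<^esup> y\<^bsup>-1\<^esup>
  \<le> s\<^bsup>1/4\<^esup> y\<^bsup>-5/4\<^esup>\<close>. Far from the turning point, \<open>y\<close> is at least
  \<open>k / 2\<close> and the summand is \<open>O(k\<^bsup>-7/6\<^esup>)\<close>; close to it, \<open>s\<close> is
  comparable to the constant \<open>A\<close>.\<close>

lemma kernel_moment_dim_ge5:
  fixes d :: nat
  assumes d: "d \<ge> 5"
  shows "\<exists>C. \<forall>m S. finite S \<longrightarrow> 0 \<notin> S \<longrightarrow>
    (\<Sum>k\<in>S. real k powr ((real d - 1) / 3) * cmod (propagator_kernel_1d m (real k)) ^ d) \<le> C"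
proof -
  have e: "7/6 > (1::real)" by simp
  obtain B where B0: "B \<ge> 0" "\<forall>S. finite S \<longrightarrow> 0 \<notin> S \<longrightarrow> (\<Sum>k\<in>S. real k powr (-(7/6))) \<le> B"
    "\<forall>n. (\<Sum>j<n. (1 + real j) powr (-(7/6))) \<le> B"
    using sum_powr_bounded[OF e] by blast
  note B = B0(1) B0(2)[rule_format] B0(3)[rule_format]
  define K where "K = (82944::real) powr (real d / 4)"
  define c where "c = (2::real) powr (5/4)"
  have K0: "K \<ge> 0" by (simp add: K_def)
  have c0: "c \<ge> 0" by (simp add: c_def)
  show ?thesis
  proof (intro exI[of _ "K * c * (B + 10)"] allI impI)
    fix m :: real and S :: "nat set" assume S: "finite S" "0 \<notin> S"
    define M where "M = \<bar>m\<bar>"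
    define A where "A = max 1 M powr (1/3)"
    have A: "A \<ge> 1" unfolding A_def by (rule ge_one_powr_ge_zero) auto
    define \<delta> where "\<delta> k = \<bar>2 * real k - M\<bar>" for k
    have pt: "real k powr ((real d - 1) / 3) * cmod (propagator_kernel_1d m (real k)) ^ d
          \<le> K * c * (real k powr (-(7/6)) + A powr (1/4) * (A + \<delta> k) powr (-5/4))" if "k \<in> S" for k
    proof -
      have k: "k \<ge> 1" using that S by (metis One_nat_def Suc_leI gr0I)
      define b where "b = cmod (propagator_kernel_1d m (real k))"
      define s where "s = real k powr (1/3)"
      define y where "y = s + \<delta> k"
      have s: "s \<ge> 1" using k by (simp add: s_def ge_one_powr_ge_zero)
      have sy: "s \<le> y" by (simp add: y_def \<delta>_def)
      have s3: "s powr x = real k powr (x / 3)" for x by (simp add: s_def powr_powr)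
      have b4: "b ^ 4 \<le> 82944 / (real k * y)"
        using kernel_pointwise[OF k, of m] by (simp add: b_def y_def s_def \<delta>_def M_def)
      have "b ^ d \<le> (82944 / (real k * y)) powr (real d / 4)"
      proof -
        have "b ^ d = (b ^ 4) powr (real d / 4)"
        proof (cases "b = 0")
          case False
          then have "b > 0" by (simp add: b_def)
          then have "(b ^ 4) powr (real d / 4) = (b powr real 4) powr (real d / 4)" "b ^ d = b powr real d"
            using powr_realpow[of b 4] powr_realpow[of b d] by simp_all
          then show ?thesis by (simp add: powr_powr)
        qed (use d in \<open>simp add: power_0_left\<close>)
        also have "\<dots> \<le> (82944 / (real k * y)) powr (real d / 4)"
          by (intro powr_mono2 b4) (auto simp: b_def)
        finally show ?thesis .
      qed
      also have "\<dots> = K / (real k powr (real d / 4) * y powr (real d / 4))"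
        using k s sy unfolding K_def by (subst powr_divide, simp, subst powr_mult) simp_all
      also have "\<dots> = K * (real k powr (-(real d / 4)) * y powr (-(real d / 4)))"
        unfolding powr_minus by (simp only: divide_inverse inverse_mult_distrib)
      finally have "real k powr ((real d - 1) / 3) * b ^ d
         \<le> real k powr ((real d - 1) / 3) * (K * (real k powr (-(real d / 4)) * y powr (-(real d / 4))))"
        by (intro mult_left_mono) auto
      also have "\<dots> = K * ((real k powr ((real d - 1) / 3) * real k powr (-(real d / 4))) * y powr (-(real d / 4)))"
        by (simp add: mult_ac)
      also have "real k powr ((real d - 1) / 3) * real k powr (-(real d / 4)) = s powr ((real d - 4) / 4)"
        unfolding s3 powr_add[symmetric] by (simp add: field_simps)
      also have "s powr ((real d - 4) / 4) * y powr (-(real d / 4)) \<le> s powr (1/4) * y powr (-5/4)"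
      proof -
        have "s powr ((real d - 4) / 4) = s powr (1/4) * s powr ((real d - 5) / 4)"
          unfolding powr_add[symmetric] by (simp add: field_simps)
        also have "\<dots> \<le> s powr (1/4) * y powr ((real d - 5) / 4)"
          using d s sy by (intro mult_left_mono powr_mono2) auto
        finally have "s powr ((real d - 4) / 4) * y powr (-(real d / 4)) \<le> s powr (1/4) * y powr ((real d - 5) / 4) * y powr (-(real d / 4))"
          by (intro mult_right_mono) auto
        also have "\<dots> = s powr (1/4) * y powr (-5/4)"
          unfolding mult.assoc powr_add[symmetric] by (simp add: field_simps)
        finally show ?thesis .
      qed
      also have "s powr (1/4) * y powr (-5/4) \<le> c * (real k powr (-(7/6)) + A powr (1/4) * (A + \<delta> k) powr (-5/4))"
      proof (cases "\<delta> k \<ge> real k / 2")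
        case True
        have "y \<ge> real k / 2" using True s by (simp add: y_def)
        then have "y powr (-5/4) \<le> (real k / 2) powr (-5/4)" using k by (intro powr_mono2') auto
        also have "\<dots> = c * real k powr (-5/4)" using k by (simp add: c_def powr_divide powr_minus_divide)
        finally have "s powr (1/4) * y powr (-5/4) \<le> s powr (1/4) * (c * real k powr (-5/4))"
          by (intro mult_left_mono) auto
        also have "\<dots> = c * (real k powr (1/12) * real k powr (-5/4))" by (simp add: s3)
        also have "\<dots> = c * real k powr (-(7/6))" unfolding powr_add[symmetric] by simp
        also have "\<dots> \<le> c * (real k powr (-(7/6)) + A powr (1/4) * (A + \<delta> k) powr (-5/4))"
          using c0 by (intro mult_left_mono) auto
        finally show ?thesis .
      next
        \<comment> \<open>Here \<open>\<bar>2 k - M\<bar> < k / 2\<close>, so \<open>k\<close> is comparable to \<open>M\<close>; the factor 8 is generous and has an exact cube root.\<close>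
        case False
        have "1 \<le> real k" using k by simp
        then have kM: "real k \<le> M" "M \<le> 8 * real k" "1 \<le> M" using False unfolding \<delta>_def by linarith+
        then have AM: "A = M powr (1/3)" by (simp add: A_def max_def)
        have sA: "s \<le> A" unfolding s_def AM using kM by (intro powr_mono2) auto
        have "A \<le> (8 * real k) powr (1/3)" unfolding AM using kM by (intro powr_mono2) auto
        also have "\<dots> = 8 powr (1/3) * s" unfolding s_def by (subst powr_mult) auto
        also have "(8::real) powr (1/3) = 2" using powr_powr[of "2::real" 3 "1/3"] by simp
        finally have "(A + \<delta> k) / 2 \<le> y" by (simp add: y_def \<delta>_def field_simps)
        then have "y powr (-5/4) \<le> ((A + \<delta> k) / 2) powr (-5/4)"
          using A by (intro powr_mono2') (auto simp: \<delta>_def intro: add_pos_nonneg)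
        also have "\<dots> = c * (A + \<delta> k) powr (-5/4)"
          using A by (simp add: c_def powr_divide powr_minus_divide \<delta>_def)
        finally have "s powr (1/4) * y powr (-5/4) \<le> A powr (1/4) * (c * (A + \<delta> k) powr (-5/4))"
          using s sA by (intro mult_mono powr_mono2) auto
        also have "\<dots> \<le> c * (real k powr (-(7/6)) + A powr (1/4) * (A + \<delta> k) powr (-5/4))"
          using c0 by (simp add: algebra_simps)
        finally show ?thesis .
      qed
      finally show ?thesis using K0 by (simp add: b_def mult_left_mono mult.assoc)
    qed
    have "(\<Sum>k\<in>S. real k powr ((real d - 1) / 3) * cmod (propagator_kernel_1d m (real k)) ^ d)
      \<le> (\<Sum>k\<in>S. K * c * (real k powr (-(7/6)) + A powr (1/4) * (A + \<delta> k) powr (-5/4)))"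
      by (rule sum_mono[OF pt])
    also have "\<dots> = K * c * ((\<Sum>k\<in>S. real k powr (-(7/6))) + A powr (1/4) * (\<Sum>k\<in>S. (A + \<delta> k) powr (-5/4)))"
      by (simp add: sum_distrib_left sum.distrib algebra_simps)
    also have "\<dots> \<le> K * c * (B + 10)"
    proof (intro mult_left_mono add_mono B S)
      have "(\<Sum>k\<in>S. (A + \<delta> k) powr (-5/4)) \<le> 2 * (5 * A powr (-1/4))"
        unfolding \<delta>_def
        by (rule sum_antimono_distance_le[where f = "\<lambda>k. 2 * real k" and g = "\<lambda>x. (A + x) powr (-5/4)"])
           (use A sum_shifted_powr_le[OF A] in \<open>simp_all add: powr_mono2' S(1) real_nat_separated\<close>)
      then have "A powr (1/4) * (\<Sum>k\<in>S. (A + \<delta> k) powr (-5/4)) \<le> A powr (1/4) * (2 * (5 * A powr (-1/4)))"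
        by (intro mult_left_mono) auto
      also have "\<dots> = 10 * (A powr (1/4) * A powr (-1/4))" by simp
      also have "\<dots> = 10" unfolding powr_add[symmetric] using A by simp
      finally show "A powr (1/4) * (\<Sum>k\<in>S. (A + \<delta> k) powr (-5/4)) \<le> 10" .
    qed (use K0 c0 in auto)
    finally show "(\<Sum>k\<in>S. real k powr ((real d - 1) / 3) * cmod (propagator_kernel_1d m (real k)) ^ d) \<le> K * c * (B + 10)" .
  qed
qed

section \<open>Plane waves on the torus\<close>

lemma torus_borel [measurable]: "torus \<in> sets borel"
proof -
  have "torus = (\<Inter>j\<in>UNIV. {\<xi> :: real ^ 'd. - 1 / 2 < \<xi> $ j \<and> \<xi> $ j \<le> 1 / 2})" by (auto simp: torus_def)
  also have "\<dots> \<in> sets borel" by measurable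
  finally show ?thesis .
qed

lemma torus_lmeasurable: "torus \<in> lmeasurable"
proof (rule bounded_set_imp_lmeasurable)
  show "bounded (torus :: (real ^ 'd) set)"
  proof (rule bounded_subset[OF bounded_cbox])
    show "torus \<subseteq> cbox (\<chi> j. - (1 / 2)) (\<chi> j. 1 / 2)"
      by (auto simp: torus_def mem_box_cart less_imp_le)
  qed
qed simp

lemma finite_measure_torus: "finite_measure (lebesgue_on torus)"
  by (rule finite_measure_lebesgue_on[OF torus_lmeasurable])

lemma borel_measurable_torus:
  "f \<in> borel_measurable borel \<Longrightarrow> f \<in> borel_measurable (lebesgue_on torus)"
  by (simp add: measurable_completion measurable_restrict_space1)

lemma lebesgue_integral_half_open_unit:
  fixes g :: "real \<Rightarrow> complex"
  assumes "continuous_on UNIV g"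
  shows "integrable lborel (\<lambda>x. indicator {-1/2<..1/2} x *\<^sub>R g x)"
    and "(LINT x|lborel. indicator {-1/2<..1/2} x *\<^sub>R g x) = integral {-1/2..1/2} g"
proof -
  have c: "continuous_on {-1/2..1/2} g" using assms continuous_on_subset by blast
  have i: "set_integrable lborel {-1/2..1/2} g"
    by (rule borel_integrable_atLeastAtMost') (rule c)
  have i': "set_integrable lborel {-1/2<..1/2} g"
    by (rule set_integrable_subset[OF i]) auto
  then show "integrable lborel (\<lambda>x. indicator {-1/2<..1/2} x *\<^sub>R g x)"
    by (simp add: set_integrable_def)
  have "(LINT x:{-1/2<..1/2}|lborel. g x) = integral {-1/2<..1/2} g"
    by (rule set_borel_integral_eq_integral(2)[OF i'])
  also have "\<dots> = integral {-1/2..1/2} g"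
    by (rule integral_spike_set; rule negligible_subset[of "{-1/2}"]) auto
  finally show "(LINT x|lborel. indicator {-1/2<..1/2} x *\<^sub>R g x) = integral {-1/2..1/2} g"
    by (simp add: set_lebesgue_integral_def)
qed

text \<open>Fubini's theorem, read off from Lebesgue measure being the image of the product measure indexed by the
  standard basis.\<close>

lemma torus_integral_prod:
  fixes g :: "'d::finite \<Rightarrow> real \<Rightarrow> complex"
  assumes g: "\<And>j. continuous_on UNIV (g j)"
  shows "(LINT \<xi>|lebesgue_on torus. (\<Prod>j\<in>UNIV. g j (\<xi> $ j))) = (\<Prod>j\<in>UNIV. integral {-1/2..1/2} (g j))"
proof -
  have gm: "g j \<in> borel_measurable borel" for j by (rule borel_measurable_continuous_onI[OF g])
  define h where "h j x = indicator {-1/2<..1/2::real} x *\<^sub>R g j x" for j x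
  have hm: "h j \<in> borel_measurable borel" for j unfolding h_def using gm[of j] by measurable
  have ind: "indicator torus \<xi> *\<^sub>R (\<Prod>j\<in>UNIV. g j (\<xi> $ j)) = (\<Prod>j\<in>UNIV. h j (\<xi> $ j))" for \<xi>
  proof (cases "\<xi> \<in> torus")
    case True
    then show ?thesis by (auto simp: h_def torus_def indicator_def intro!: prod.cong)
  next
    case False
    then obtain j where "\<not> (- 1 / 2 < \<xi> $ j \<and> \<xi> $ j \<le> 1 / 2)" by (auto simp: torus_def)
    then have "h j (\<xi> $ j) = 0" by (auto simp: h_def indicator_def)
    then have "(\<Prod>j\<in>UNIV. h j (\<xi> $ j)) = 0" by (auto simp: prod_zero_iff)
    then show ?thesis using False by simp
  qed
  have hm': "(\<lambda>\<xi>. \<Prod>j\<in>UNIV. h j (\<xi> $ j)) \<in> borel_measurable (borel :: (real ^ 'd) measure)"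
    using hm by (intro borel_measurable_prod measurable_compose[OF _ hm]) measurable
  interpret product_sigma_finite "\<lambda>_ :: real ^ 'd. lborel :: real measure" by standard
  have "(LINT \<xi>|lebesgue_on torus. (\<Prod>j\<in>UNIV. g j (\<xi> $ j))) = (LINT \<xi>|lebesgue. (\<Prod>j\<in>UNIV. h j (\<xi> $ j)))"
    by (subst integral_restrict_space) (simp_all add: ind)
  also have "\<dots> = (LINT \<xi>|lborel. (\<Prod>j\<in>UNIV. h j (\<xi> $ j)))"
    using hm' by (intro integral_completion) simp
  also have "\<dots> = (LINT x|(\<Pi>\<^sub>M b\<in>(Basis :: (real ^ 'd) set). lborel). (\<Prod>j\<in>UNIV. h j ((\<Sum>b\<in>Basis. x b *\<^sub>R b) $ j)))"
    by (subst lborel_eq, subst integral_distr) (use hm' in \<open>auto\<close>)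
  also have "\<dots> = (LINT x|(\<Pi>\<^sub>M b\<in>(Basis :: (real ^ 'd) set). lborel). (\<Prod>b\<in>Basis. h (axis_index b) (x b)))"
  proof (intro Bochner_Integration.integral_cong refl)
    fix x :: "real ^ 'd \<Rightarrow> real"
    have B: "(Basis :: (real ^ 'd) set) = (\<lambda>j. axis j 1) ` UNIV" by (auto simp: Basis_vec_def)
    have inj: "inj (\<lambda>j :: 'd. axis j (1::real))" by (auto simp: inj_on_def axis_eq_axis)
    have co: "(\<Sum>b\<in>Basis. x b *\<^sub>R b) $ j = x (axis j 1)" for j
      unfolding B by (subst sum.reindex[OF inj]) (simp add: axis_def if_distrib sum.delta cong: if_cong)
    have "(\<Prod>b\<in>Basis. h (axis_index b) (x b)) = (\<Prod>j\<in>UNIV. h j (x (axis j 1)))"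
      unfolding B by (subst prod.reindex[OF inj]) simp
    then show "(\<Prod>j\<in>UNIV. h j ((\<Sum>b\<in>Basis. x b *\<^sub>R b) $ j)) = (\<Prod>b\<in>Basis. h (axis_index b) (x b))"
      by (simp only: co)
  qed
  also have "\<dots> = (\<Prod>b\<in>(Basis :: (real ^ 'd) set). LINT t|lborel. h (axis_index b) t)"
    using product_integral_prod[of Basis "\<lambda>b. h (axis_index b)"] lebesgue_integral_half_open_unit(1)[OF g]
    by (simp add: h_def[abs_def])
  also have "\<dots> = (\<Prod>j\<in>UNIV. LINT t|lborel. h j t)"
  proof -
    have B: "(Basis :: (real ^ 'd) set) = (\<lambda>j. axis j 1) ` UNIV" by (auto simp: Basis_vec_def)
    have inj: "inj (\<lambda>j :: 'd. axis j (1::real))" by (auto simp: inj_on_def axis_eq_axis)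
    show ?thesis unfolding B by (subst prod.reindex[OF inj]) simp
  qed
  also have "\<dots> = (\<Prod>j\<in>UNIV. integral {-1/2..1/2} (g j))"
    unfolding h_def using lebesgue_integral_half_open_unit(2)[OF g] by simp
  finally show ?thesis .
qed

text \<open>The conjugate of the Fourier transform of the unit mass at \<open>n\<close>, evolved backwards to time
  \<open>- t\<close>. The sign of \<open>t\<close> is such that pairing the transform of \<open>f\<close> with
  \<open>wave t n\<close>, without conjugation, gives \<open>propagator t f n\<close>.\<close>

definition wave :: "real \<Rightarrow> int ^ 'd::finite \<Rightarrow> real ^ 'd \<Rightarrow> complex" where
  "wave t n \<xi> = cis (2 * pi * phase n \<xi> - t * laplacian_symbol \<xi>)"

lemma norm_wave [simp]: "cmod (wave t n \<xi>) = 1"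
  by (simp add: wave_def)

lemma continuous_on_wave: "continuous_on A (wave t n)"
  unfolding wave_def phase_def laplacian_symbol_def by (intro continuous_intros)

lemma wave_measurable [measurable]: "wave t n \<in> borel_measurable (lebesgue_on torus)"
  by (intro borel_measurable_torus borel_measurable_continuous_onI continuous_on_wave)

lemma wave_gram:
  "(LINT \<xi>|lebesgue_on torus. wave t n \<xi> * cnj (wave s m \<xi>))
     = (\<Prod>j\<in>UNIV. propagator_kernel_1d (of_int (n $ j - m $ j)) (t - s))"
proof -
  have cp: "cis (\<Sum>j\<in>J. a j) = (\<Prod>j\<in>J. cis (a j))" if "finite J" for J :: "'d set" and a
    using that by induction (auto simp: cis_mult[symmetric])
  define g where "g j x = cis (2 * pi * of_int (n $ j - m $ j) * x - 4 * (t - s) * (sin (pi * x))\<^sup>2)" for j x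
  have "wave t n \<xi> * cnj (wave s m \<xi>) = (\<Prod>j\<in>UNIV. g j (\<xi> $ j))" for \<xi>
  proof -
    have "(2 * pi * phase n \<xi> - t * laplacian_symbol \<xi>) + - (2 * pi * phase m \<xi> - s * laplacian_symbol \<xi>)
       = (\<Sum>j\<in>UNIV. 2 * pi * of_int (n $ j - m $ j) * \<xi> $ j - 4 * (t - s) * (sin (pi * \<xi> $ j))\<^sup>2)"
      unfolding phase_def laplacian_symbol_def
      by (simp add: sum_subtractf sum.distrib sum_distrib_left algebra_simps)
    then show ?thesis unfolding wave_def cis_cnj cis_mult g_def by (simp only: cp[OF finite])
  qed
  then have "(LINT \<xi>|lebesgue_on torus. wave t n \<xi> * cnj (wave s m \<xi>)) = (LINT \<xi>|lebesgue_on torus. (\<Prod>j\<in>UNIV. g j (\<xi> $ j)))"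
    by simp
  also have "\<dots> = (\<Prod>j\<in>UNIV. integral {-1/2..1/2} (g j))"
    by (rule torus_integral_prod) (auto simp: g_def intro!: continuous_intros)
  finally show ?thesis by (simp add: g_def[abs_def] propagator_kernel_1d_def)
qed

lemma propagator_kernel_1d_time_zero:
  "propagator_kernel_1d (of_int m) 0 = (if m = 0 then 1 else 0)"
proof (cases "m = 0")
  case False
  define f where "f x = of_real (1 / (2 * pi * m)) * (- \<i> * cis (2 * pi * m * x))" for x :: real
  have "((\<lambda>x. cis (2 * pi * m * x)) has_integral f (1/2) - f (-1/2)) {-1/2..1/2}"
  proof (rule fundamental_theorem_of_calculus)
    fix x :: real
    have "((\<lambda>x. cis (2 * pi * m * x)) has_vector_derivative (2 * pi * m) *\<^sub>R (\<i> * cis (2 * pi * m * x))) (at x within {-1/2..1/2})"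
      unfolding has_vector_derivative_def
      by (rule has_derivative_eq_rhs, rule has_derivative_cis, rule has_derivative_mult_right, rule has_derivative_ident)
         (auto simp: fun_eq_iff)
    then have "(f has_vector_derivative of_real (1 / (2 * pi * m)) * (- \<i> * ((2 * pi * m) *\<^sub>R (\<i> * cis (2 * pi * m * x))))) (at x within {-1/2..1/2})"
      unfolding f_def by (intro has_vector_derivative_mult_right)
    moreover have "of_real (1 / (2 * pi * m)) * (- \<i> * ((2 * pi * m) *\<^sub>R (\<i> * cis (2 * pi * m * x)))) = cis (2 * pi * m * x)"
      using False by (simp add: scaleR_conv_of_real field_simps)
    ultimately show "(f has_vector_derivative cis (2 * pi * m * x)) (at x within {-1/2..1/2})" by simp
  qed simp
  moreover have "f (1/2) = f (-1/2)"
  proof -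
    have "cis (2 * pi * m * (1/2)) = cis (2 * pi * m) * cis (2 * pi * m * (-1/2))"
      unfolding cis_mult by (simp add: field_simps)
    also have "cis (2 * pi * m) = 1" using cis_multiple_2pi[of "of_int m"] by simp
    finally show ?thesis by (simp add: f_def)
  qed
  ultimately show ?thesis using False by (simp add: propagator_kernel_1d_def integral_unique)
qed (simp add: propagator_kernel_1d_def)

lemma propagator_kernel_1d_uminus: "cmod (propagator_kernel_1d m (- t)) = cmod (propagator_kernel_1d (- m) t)"
proof -
  have "propagator_kernel_1d m (- t) = cnj (propagator_kernel_1d (- m) t)"
    unfolding propagator_kernel_1d_def Henstock_Kurzweil_Integration.integral_cnj by (simp add: cis_cnj algebra_simps)
  then show ?thesis by simp
qed

lemma wave_orthonormal:
  "(LINT \<xi>|lebesgue_on torus. wave t n \<xi> * cnj (wave t m \<xi>)) = (if n = m then 1 else 0)"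
proof -
  have "(\<Prod>j\<in>UNIV. if n $ j - m $ j = 0 then 1 else 0 :: complex) = (if n = m then 1 else 0)"
  proof (cases "n = m")
    case False
    then obtain j where "n $ j - m $ j \<noteq> 0" by (auto simp: vec_eq_iff)
    then show ?thesis using False by (auto simp: prod_zero_iff)
  qed simp
  then show ?thesis unfolding wave_gram by (simp add: propagator_kernel_1d_time_zero del: of_int_diff)
qed

text \<open>A crude form of the inequality of arithmetic and geometric means, which replaces Hoelder's inequality in
  the time variable.\<close>

lemma prod_le_sum_power:
  fixes a :: "'d::finite \<Rightarrow> real"
  assumes "\<And>j. 0 \<le> a j"
  shows "(\<Prod>j\<in>UNIV. a j) \<le> (\<Sum>j\<in>UNIV. a j ^ CARD('d))"
proof -
  obtain i where i: "\<And>j. a j \<le> a i"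
    using Max_in[of "range a"] Max_ge[of "range a"] by (metis UNIV_not_empty finite finite_imageI image_is_empty imageE rangeI)
  have "(\<Prod>j\<in>UNIV. a j) \<le> (\<Prod>j\<in>(UNIV::'d set). a i)" by (intro prod_mono) (auto simp: assms i)
  also have "\<dots> = a i ^ CARD('d)" by simp
  also have "\<dots> \<le> (\<Sum>j\<in>UNIV. a j ^ CARD('d))" by (rule member_le_sum) (auto simp: assms)
  finally show ?thesis .
qed

text \<open>The Gram matrix factors over the coordinates. Bounding the product by a sum of \<open>d\<close>-th powers
  reduces the claim to the one-dimensional moment, and the weight \<open>\<bar>k - l\<bar>\<^bsup>\<beta>\<^esup>
  \<ge> X\<^bsup>\<beta>\<^esup>\<close> yields the power of \<open>X\<close>. Positive and negative time differences
  are treated separately, hence the factor 2.\<close>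

lemma wave_decay:
  fixes \<beta> B :: real
  assumes \<beta>: "\<beta> > 0"
    and B: "\<And>m S. finite S \<Longrightarrow> 0 \<notin> S \<Longrightarrow>
      (\<Sum>k\<in>S. real k powr \<beta> * cmod (propagator_kernel_1d m (real k)) ^ CARD('d)) \<le> B"
    and X: "X > 0" and K: "finite K" "\<And>l. l \<in> K \<Longrightarrow> int X \<le> \<bar>k - l\<bar>"
  shows "(\<Sum>l\<in>K. cmod (LINT \<xi>|lebesgue_on torus. wave (of_int k) n \<xi> * cnj (wave (of_int l) (m :: int ^ 'd::finite) \<xi>)))
     \<le> (2 * real CARD('d) * B) * real X powr (- \<beta>)"
proof -
  define b where "b j t = cmod (propagator_kernel_1d (of_int (n $ j - m $ j)) t) ^ CARD('d)" for j t
  have side: "(\<Sum>l\<in>L. real_of_int \<bar>k - l\<bar> powr \<beta> * b j (of_int k - of_int l)) \<le> B"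
    if L: "L \<subseteq> K" and s: "(\<forall>l\<in>L. l < k) \<or> (\<forall>l\<in>L. k < l)" for j L
  proof -
    define M :: real where "M = (if \<forall>l\<in>L. l < k then of_int (n $ j - m $ j) else - of_int (n $ j - m $ j))"
    have inj: "inj_on (\<lambda>l. nat \<bar>k - l\<bar>) L"
    proof (rule inj_onI)
      fix x y assume xy: "x \<in> L" "y \<in> L" "nat \<bar>k - x\<bar> = nat \<bar>k - y\<bar>"
      then have "x < k \<and> y < k \<or> k < x \<and> k < y" using s by blast
      then show "x = y" using xy(3) by linarith
    qed
    have t: "b j (of_int k - of_int l) = cmod (propagator_kernel_1d M (real (nat \<bar>k - l\<bar>))) ^ CARD('d)" if "l \<in> L" for l
    proof (cases "\<forall>l\<in>L. l < k")
      case True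
      then have "real (nat \<bar>k - l\<bar>) = of_int k - of_int l" using that by auto
      then show ?thesis using True by (simp add: b_def M_def)
    next
      case False
      then have "\<forall>l\<in>L. k < l" using s by blast
      then have kl: "real (nat \<bar>k - l\<bar>) = of_int l - of_int k" using that by auto
      have M: "M = - of_int (n $ j - m $ j)" unfolding M_def by (rule if_not_P[OF False])
      show ?thesis unfolding b_def kl M
        using propagator_kernel_1d_uminus[of "of_int (n $ j - m $ j)" "of_int l - of_int k"] by simp
    qed
    have "(\<Sum>l\<in>L. real_of_int \<bar>k - l\<bar> powr \<beta> * b j (of_int k - of_int l))
       = (\<Sum>l\<in>L. real (nat \<bar>k - l\<bar>) powr \<beta> * cmod (propagator_kernel_1d M (real (nat \<bar>k - l\<bar>))) ^ CARD('d))"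
      by (intro sum.cong refl) (simp add: t)
    also have "\<dots> = (\<Sum>q\<in>(\<lambda>l. nat \<bar>k - l\<bar>) ` L. real q powr \<beta> * cmod (propagator_kernel_1d M (real q)) ^ CARD('d))"
      by (subst sum.reindex[OF inj]) simp
    also have "\<dots> \<le> B"
    proof (rule B)
      show "finite ((\<lambda>l. nat \<bar>k - l\<bar>) ` L)" using L K(1) finite_subset by blast
      show "0 \<notin> (\<lambda>l. nat \<bar>k - l\<bar>) ` L" using s by auto
    qed
    finally show ?thesis .
  qed
  have all: "(\<Sum>l\<in>K. real_of_int \<bar>k - l\<bar> powr \<beta> * b j (of_int k - of_int l)) \<le> 2 * B" for j
  proof -
    have Keq: "{l\<in>K. l < k} \<union> {l\<in>K. k < l} = K" using K X by force
    have "(\<Sum>l\<in>K. real_of_int \<bar>k - l\<bar> powr \<beta> * b j (of_int k - of_int l)) =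
       (\<Sum>l\<in>{l\<in>K. l < k}. real_of_int \<bar>k - l\<bar> powr \<beta> * b j (of_int k - of_int l)) +
       (\<Sum>l\<in>{l\<in>K. k < l}. real_of_int \<bar>k - l\<bar> powr \<beta> * b j (of_int k - of_int l))"
      by (rule sum.union_disjoint[of "{l\<in>K. l < k}" "{l\<in>K. k < l}", unfolded Keq]) (use K(1) in auto)
    also have "\<dots> \<le> B + B" by (intro add_mono side) auto
    finally show ?thesis by simp
  qed
  have X': "1 \<le> real X powr (-\<beta>) * real_of_int \<bar>k - l\<bar> powr \<beta>" if "l \<in> K" for l
  proof -
    have "real X \<le> real_of_int \<bar>k - l\<bar>" using K(2)[OF that] by linarith
    then have "real X powr \<beta> \<le> real_of_int \<bar>k - l\<bar> powr \<beta>" using \<beta> by (intro powr_mono2) auto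
    then have "real X powr (-\<beta>) * real X powr \<beta> \<le> real X powr (-\<beta>) * real_of_int \<bar>k - l\<bar> powr \<beta>"
      by (rule mult_left_mono) simp
    moreover have "real X powr (-\<beta>) * real X powr \<beta> = 1" unfolding powr_add[symmetric] using X by simp
    ultimately show ?thesis by simp
  qed
  have "(\<Sum>l\<in>K. cmod (LINT \<xi>|lebesgue_on torus. wave (of_int k) n \<xi> * cnj (wave (of_int l) m \<xi>)))
    \<le> (\<Sum>l\<in>K. real X powr (-\<beta>) * (\<Sum>j\<in>UNIV. real_of_int \<bar>k - l\<bar> powr \<beta> * b j (of_int k - of_int l)))"
  proof (rule sum_mono)
    fix l assume l: "l \<in> K"
    have "cmod (LINT \<xi>|lebesgue_on torus. wave (of_int k) n \<xi> * cnj (wave (of_int l) m \<xi>)) \<le> (\<Sum>j\<in>UNIV. b j (of_int k - of_int l))"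
      unfolding wave_gram b_def prod_norm[symmetric] by (rule prod_le_sum_power) simp
    also have "\<dots> = 1 * (\<Sum>j\<in>UNIV. b j (of_int k - of_int l))" by simp
    also have "\<dots> \<le> (real X powr (-\<beta>) * real_of_int \<bar>k - l\<bar> powr \<beta>) * (\<Sum>j\<in>UNIV. b j (of_int k - of_int l))"
      by (intro mult_right_mono X' l sum_nonneg) (simp add: b_def)
    finally show "cmod (LINT \<xi>|lebesgue_on torus. wave (of_int k) n \<xi> * cnj (wave (of_int l) m \<xi>))
       \<le> real X powr (-\<beta>) * (\<Sum>j\<in>UNIV. real_of_int \<bar>k - l\<bar> powr \<beta> * b j (of_int k - of_int l))"
      by (simp add: sum_distrib_left mult.assoc)
  qed
  also have "\<dots> = real X powr (-\<beta>) * (\<Sum>j\<in>UNIV. \<Sum>l\<in>K. real_of_int \<bar>k - l\<bar> powr \<beta> * b j (of_int k - of_int l))"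
    by (rule trans[OF sum_distrib_left[symmetric]], rule arg_cong[OF sum.swap])
  also have "\<dots> \<le> real X powr (-\<beta>) * (\<Sum>j\<in>(UNIV::'d set). 2 * B)"
    by (intro mult_left_mono sum_mono all) auto
  finally show ?thesis by (simp add: mult_ac)
qed

section \<open>Almost orthogonality of wave packets\<close>

lemma schur_test:
  fixes A :: "'i \<Rightarrow> 'j \<Rightarrow> real"
  assumes fin: "finite I" "finite J" and nn: "\<And>i j. i \<in> I \<Longrightarrow> j \<in> J \<Longrightarrow> 0 \<le> A i j"
    and row: "\<And>i. i \<in> I \<Longrightarrow> (\<Sum>j\<in>J. A i j) \<le> R" and col: "\<And>j. j \<in> J \<Longrightarrow> (\<Sum>i\<in>I. A i j) \<le> Q"
  shows "(\<Sum>i\<in>I. \<Sum>j\<in>J. A i j * (x i * y j)) \<le> sqrt (R * Q) * (sqrt (\<Sum>i\<in>I. (x i)\<^sup>2) * sqrt (\<Sum>j\<in>J. (y j)\<^sup>2))"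
proof (cases "I = {} \<or> J = {}")
  case True
  then show ?thesis by (elim disjE) simp_all
next
  case False
  then obtain i j where "i \<in> I" "j \<in> J" by auto
  then have RQ: "0 \<le> R" "0 \<le> Q"
    using row[of i] col[of j] sum_nonneg[of J "A i"] sum_nonneg[of I "\<lambda>i. A i j"] nn by force+
  let ?P = "I \<times> J"
  have sq: "a * (u * v) = (sqrt a * u) * (sqrt a * v)" if "0 \<le> a" for a u v :: real
  proof -
    have "(sqrt a * u) * (sqrt a * v) = (sqrt a * sqrt a) * (u * v)" by (simp only: mult_ac)
    then show ?thesis using that by simp
  qed
  have "(\<Sum>i\<in>I. \<Sum>j\<in>J. A i j * (x i * y j))
      = (\<Sum>p\<in>?P. (sqrt (A (fst p) (snd p)) * x (fst p)) * (sqrt (A (fst p) (snd p)) * y (snd p)))"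
    unfolding sum.cartesian_product case_prod_beta
    by (intro sum.cong refl sq) (auto simp: nn)
  then have "(\<Sum>i\<in>I. \<Sum>j\<in>J. A i j * (x i * y j))\<^sup>2
      \<le> (\<Sum>p\<in>?P. (sqrt (A (fst p) (snd p)) * x (fst p))\<^sup>2) * (\<Sum>p\<in>?P. (sqrt (A (fst p) (snd p)) * y (snd p))\<^sup>2)"
    using Cauchy_Schwarz_ineq_sum[of "\<lambda>p. sqrt (A (fst p) (snd p)) * x (fst p)" "\<lambda>p. sqrt (A (fst p) (snd p)) * y (snd p)" ?P]
    by simp
  also have "(\<Sum>p\<in>?P. (sqrt (A (fst p) (snd p)) * x (fst p))\<^sup>2) = (\<Sum>i\<in>I. (\<Sum>j\<in>J. A i j) * (x i)\<^sup>2)"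
    unfolding sum_distrib_right sum.cartesian_product case_prod_beta
    by (intro sum.cong refl) (auto simp: nn power_mult_distrib)
  also have "(\<Sum>p\<in>?P. (sqrt (A (fst p) (snd p)) * y (snd p))\<^sup>2) = (\<Sum>i\<in>I. \<Sum>j\<in>J. A i j * (y j)\<^sup>2)"
    unfolding sum.cartesian_product case_prod_beta
    by (intro sum.cong refl) (auto simp: nn power_mult_distrib)
  also have "\<dots> = (\<Sum>j\<in>J. (\<Sum>i\<in>I. A i j) * (y j)\<^sup>2)"
    unfolding sum_distrib_right by (rule sum.swap)
  also have "(\<Sum>i\<in>I. (\<Sum>j\<in>J. A i j) * (x i)\<^sup>2) * (\<Sum>j\<in>J. (\<Sum>i\<in>I. A i j) * (y j)\<^sup>2)
      \<le> (\<Sum>i\<in>I. R * (x i)\<^sup>2) * (\<Sum>j\<in>J. Q * (y j)\<^sup>2)"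
    by (intro mult_mono sum_mono mult_right_mono row col sum_nonneg mult_nonneg_nonneg RQ nn) auto
  also have "\<dots> = (sqrt (R * Q) * (sqrt (\<Sum>i\<in>I. (x i)\<^sup>2) * sqrt (\<Sum>j\<in>J. (y j)\<^sup>2)))\<^sup>2"
    using RQ by (simp add: power_mult_distrib sum_distrib_left[symmetric] sum_nonneg mult_ac)
  finally show ?thesis by (rule power2_le_imp_le) (use RQ in \<open>auto intro!: mult_nonneg_nonneg sum_nonneg\<close>)
qed

lemma borel_measurable_cnj [measurable (raw)]:
  "f \<in> borel_measurable M \<Longrightarrow> (\<lambda>x. cnj (f x)) \<in> borel_measurable M"
  by (erule measurable_compose) (intro borel_measurable_continuous_onI continuous_intros)

lemma integral_Cauchy_Schwarz:
  fixes f g :: "'a \<Rightarrow> complex"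
  assumes [measurable]: "f \<in> borel_measurable M" "g \<in> borel_measurable M"
    and f: "integrable M (\<lambda>x. (cmod (f x))\<^sup>2)" and g: "integrable M (\<lambda>x. (cmod (g x))\<^sup>2)"
  shows "integrable M (\<lambda>x. f x * g x)"
    and "cmod (LINT x|M. f x * g x) \<le> sqrt (LINT x|M. (cmod (f x))\<^sup>2) * sqrt (LINT x|M. (cmod (g x))\<^sup>2)"
proof -
  have am: "2 * (a * b) \<le> a\<^sup>2 + b\<^sup>2" for a b :: real using sum_squares_bound[of a b] by (simp add: mult.assoc)
  show i: "integrable M (\<lambda>x. f x * g x)"
  proof (rule Bochner_Integration.integrable_bound[OF Bochner_Integration.integrable_add[OF f g]])
    show "AE x in M. norm (f x * g x) \<le> norm ((cmod (f x))\<^sup>2 + (cmod (g x))\<^sup>2)"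
    proof (intro AE_I2)
      fix x
      have "0 \<le> cmod (f x) * cmod (g x)" by simp
      then show "norm (f x * g x) \<le> norm ((cmod (f x))\<^sup>2 + (cmod (g x))\<^sup>2)"
        using am[of "cmod (f x)" "cmod (g x)"] unfolding norm_mult real_norm_def by linarith
    qed
  qed measurable
  define A where "A = (LINT x|M. (cmod (f x))\<^sup>2)"
  define B where "B = (LINT x|M. (cmod (g x))\<^sup>2)"
  define P where "P = (LINT x|M. cmod (f x * g x))"
  have ip: "integrable M (\<lambda>x. cmod (f x * g x))" using i by simp
  have AB: "0 \<le> A" "0 \<le> B" "0 \<le> P" by (simp_all add: A_def B_def P_def)
  have q: "0 \<le> A - 2 * t * P + t\<^sup>2 * B" for t
  proof -
    have "A - 2 * t * P + t\<^sup>2 * B = (LINT x|M. (cmod (f x))\<^sup>2 - 2 * t * cmod (f x * g x) + t\<^sup>2 * (cmod (g x))\<^sup>2)"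
      using f g ip by (simp add: A_def B_def P_def)
    also have "\<dots> = (LINT x|M. (cmod (f x) - t * cmod (g x))\<^sup>2)"
      by (intro Bochner_Integration.integral_cong refl) (simp add: power2_eq_square algebra_simps norm_mult)
    also have "\<dots> \<ge> 0" by simp
    finally show ?thesis .
  qed
  have "P\<^sup>2 \<le> A * B"
  proof (cases "B = 0")
    case True
    have "P = 0"
    proof (rule ccontr)
      assume "P \<noteq> 0"
      \<comment> \<open>A value of \<open>t\<close> for which the quadratic below would be negative.\<close>
      then have "P > 0" using AB by simp
      then show False using q[of "(A + 1) / (2 * P)"] True by simp
    qed
    then show ?thesis using True by simp
  next
    case False
    then have "B > 0" using AB by simp
    then show ?thesis using q[of "P / B"] by (simp add: power2_eq_square field_simps)
  qed
  then have "P \<le> sqrt (A * B)" by (rule real_le_rsqrt)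
  moreover have "cmod (LINT x|M. f x * g x) \<le> P" unfolding P_def by (rule integral_norm_bound)
  ultimately show "cmod (LINT x|M. f x * g x) \<le> sqrt (LINT x|M. (cmod (f x))\<^sup>2) * sqrt (LINT x|M. (cmod (g x))\<^sup>2)"
    by (simp add: A_def B_def real_sqrt_mult)
qed

text \<open>The two properties of the plane waves at integer times on which the smoothing estimate rests:
  orthonormality at each fixed time, and decay, uniform in the two sites, of the part of the Gram matrix with time
  difference at least \<open>X\<close>. The first index of \<open>e\<close> is the time, the second the site.\<close>

locale dispersive_system = finite_measure M for M :: "'a measure" +
  fixes e :: "int \<Rightarrow> 'n \<Rightarrow> 'a \<Rightarrow> complex" and D \<beta> :: real
  assumes e_measurable [measurable]: "\<And>k n. e k n \<in> borel_measurable M"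
    and e_bound: "\<And>k n x. cmod (e k n x) \<le> 1"
    and orthonormal: "\<And>k n m. (LINT x|M. e k n x * cnj (e k m x)) = (if n = m then 1 else 0)"
    and decay: "\<And>X K k n m. X > 0 \<Longrightarrow> finite K \<Longrightarrow> (\<And>l. l \<in> K \<Longrightarrow> int X \<le> \<bar>k - l\<bar>) \<Longrightarrow>
       (\<Sum>l\<in>K. cmod (LINT x|M. e k n x * cnj (e l m x))) \<le> D * real X powr (-\<beta>)"
    and \<beta>_pos: "\<beta> > 0"
begin

definition gram :: "int \<times> 'n \<Rightarrow> int \<times> 'n \<Rightarrow> complex" where
  "gram p q = (LINT x|M. e (fst p) (snd p) x * cnj (e (fst q) (snd q) x))"

definition packet :: "(int \<times> 'n) set \<Rightarrow> (int \<times> 'n \<Rightarrow> complex) \<Rightarrow> 'a \<Rightarrow> complex" where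
  "packet S c x = (\<Sum>p\<in>S. c p * e (fst p) (snd p) x)"

definition energy :: "(int \<times> 'n) set \<Rightarrow> (int \<times> 'n \<Rightarrow> complex) \<Rightarrow> real" where
  "energy S c = (LINT x|M. (cmod (packet S c x))\<^sup>2)"

definition pairing :: "(int \<times> 'n) set \<Rightarrow> (int \<times> 'n \<Rightarrow> complex) \<Rightarrow> (int \<times> 'n) set \<Rightarrow> (int \<times> 'n \<Rightarrow> complex) \<Rightarrow> complex" where
  "pairing S c T d = (LINT x|M. packet S c x * cnj (packet T d x))"

abbreviation mass :: "(int \<times> 'n) set \<Rightarrow> (int \<times> 'n \<Rightarrow> complex) \<Rightarrow> real" where
  "mass S c \<equiv> (\<Sum>p\<in>S. (cmod (c p))\<^sup>2)"

lemma D_nonneg: "0 \<le> D"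
  using decay[of 1 "{}"] by simp

lemma packet_measurable [measurable]: "packet S c \<in> borel_measurable M"
  unfolding packet_def by measurable

lemma packet_bounded: "cmod (packet S c x) \<le> (\<Sum>p\<in>S. cmod (c p))"
  unfolding packet_def
  by (rule order_trans[OF norm_sum sum_mono]) (simp add: norm_mult mult_left_le e_bound)

lemma integrable_packet_square: "integrable M (\<lambda>x. (cmod (packet S c x))\<^sup>2)"
  by (rule integrable_const_bound[where B = "(\<Sum>p\<in>S. cmod (c p))\<^sup>2"])
     (auto intro!: power_mono packet_bounded)

lemma pairing_Cauchy_Schwarz: "cmod (pairing S c T d) \<le> sqrt (energy S c) * sqrt (energy T d)"
  unfolding pairing_def energy_def
  using integral_Cauchy_Schwarz(2)[of "packet S c" M "\<lambda>x. cnj (packet T d x)"] integrable_packet_square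
  by simp

lemma energy_eq_pairing: "complex_of_real (energy S c) = pairing S c S c"
  unfolding energy_def pairing_def
  by (subst integral_complex_of_real[symmetric]) (simp add: complex_norm_square[symmetric] del: of_real_power)

lemma cmod_gram_commute: "cmod (gram p q) = cmod (gram q p)"
proof -
  have "gram p q = cnj (gram q p)"
    unfolding gram_def by (simp flip: Bochner_Integration.integral_cnj add: mult.commute)
  then show ?thesis by simp
qed

lemma cmod_pairing_commute: "cmod (pairing S c T d) = cmod (pairing T d S c)"
proof -
  have "pairing S c T d = cnj (pairing T d S c)"
    unfolding pairing_def by (simp flip: Bochner_Integration.integral_cnj add: mult.commute)
  then show ?thesis by simp
qed

lemma pairing_expand: "pairing S c T d = (\<Sum>p\<in>S. \<Sum>q\<in>T. c p * cnj (d q) * gram p q)"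
proof -
  have i: "integrable M (\<lambda>x. e (fst p) (snd p) x * cnj (e (fst q) (snd q) x))" for p q
    by (rule integrable_const_bound[where B = 1]) (auto intro!: mult_le_one e_bound simp: norm_mult)
  have "pairing S c T d = (LINT x|M. (\<Sum>p\<in>S. \<Sum>q\<in>T. c p * cnj (d q) * (e (fst p) (snd p) x * cnj (e (fst q) (snd q) x))))"
    unfolding pairing_def packet_def by (simp add: sum_product mult_ac)
  also have "\<dots> = (\<Sum>p\<in>S. \<Sum>q\<in>T. c p * cnj (d q) * gram p q)"
    using i by (simp add: gram_def Bochner_Integration.integral_sum)
  finally show ?thesis .
qed

lemma pairing_partition:
  assumes "finite S" "finite T" "finite A" "finite B" "f ` S \<subseteq> A" "g ` T \<subseteq> B"
  shows "pairing S c T d = (\<Sum>a\<in>A. \<Sum>b\<in>B. pairing {p\<in>S. f p = a} c {q\<in>T. g q = b} d)"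
proof -
  have "(\<Sum>a\<in>A. \<Sum>b\<in>B. pairing {p\<in>S. f p = a} c {q\<in>T. g q = b} d)
     = (\<Sum>a\<in>A. \<Sum>p\<in>{p\<in>S. f p = a}. \<Sum>b\<in>B. \<Sum>q\<in>{q\<in>T. g q = b}. c p * cnj (d q) * gram p q)"
    unfolding pairing_expand by (intro sum.cong refl sum.swap)
  also have "\<dots> = pairing S c T d"
    unfolding pairing_expand
    by (subst sum.group[OF assms(1,3,5)], intro sum.cong refl sum.group[OF assms(2,4,6)])
  finally show ?thesis ..
qed

lemma energy_single_time:
  assumes "finite S" "\<And>p. p \<in> S \<Longrightarrow> fst p = k"
  shows "energy S c = mass S c"
proof -
  have "complex_of_real (energy S c) = (\<Sum>p\<in>S. \<Sum>q\<in>S. c p * cnj (c q) * (if p = q then 1 else 0))"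
    unfolding energy_eq_pairing pairing_expand
    by (intro sum.cong refl) (use assms(2) in \<open>auto simp: gram_def orthonormal prod_eq_iff\<close>)
  also have "\<dots> = (\<Sum>p\<in>S. c p * cnj (c p))" using assms(1) by (simp add: if_distrib sum.delta cong: if_cong)
  also have "\<dots> = complex_of_real (mass S c)" by (simp only: complex_norm_square[symmetric] of_real_sum)
  finally show ?thesis using of_real_eq_iff by blast
qed

text \<open>Over a set of \<open>card J\<close> times, orthonormality at each time and the Cauchy-Schwarz inequality
  in time are all that is used; the loss is the number of times.\<close>

lemma energy_short_time:
  assumes S: "finite S" and J: "finite J" "fst ` S \<subseteq> J"
  shows "energy S c \<le> card J * mass S c"
proof -
  define S' where "S' k = {p\<in>S. fst p = k}" for k
  have pk: "packet S c x = (\<Sum>k\<in>J. packet (S' k) c x)" for x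
    unfolding packet_def S'_def by (rule sum.group[OF S J, symmetric])
  have "energy S c \<le> (LINT x|M. real (card J) * (\<Sum>k\<in>J. (cmod (packet (S' k) c x))\<^sup>2))"
    unfolding energy_def
  proof (intro integral_mono integrable_packet_square Bochner_Integration.integrable_mult_right Bochner_Integration.integrable_sum)
    fix x
    have "(cmod (packet S c x))\<^sup>2 \<le> (\<Sum>k\<in>J. 1 * cmod (packet (S' k) c x))\<^sup>2"
      unfolding pk by (intro power_mono) (auto intro: norm_sum)
    also have "\<dots> \<le> (\<Sum>k\<in>J. 1\<^sup>2) * (\<Sum>k\<in>J. (cmod (packet (S' k) c x))\<^sup>2)"
      by (rule Cauchy_Schwarz_ineq_sum)
    finally show "(cmod (packet S c x))\<^sup>2 \<le> real (card J) * (\<Sum>k\<in>J. (cmod (packet (S' k) c x))\<^sup>2)" by simp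
  qed
  also have "\<dots> = card J * (\<Sum>k\<in>J. energy (S' k) c)"
    by (simp add: energy_def integrable_packet_square)
  also have "(\<Sum>k\<in>J. energy (S' k) c) = (\<Sum>k\<in>J. mass (S' k) c)"
    by (intro sum.cong refl energy_single_time) (auto simp: S'_def S)
  also have "\<dots> = mass S c" unfolding S'_def by (rule sum.group[OF S J])
  finally show ?thesis .
qed

lemma gram_far_row_sum:
  assumes "X > 0" "finite T" "finite E" "snd ` T \<subseteq> E" "\<And>q. q \<in> T \<Longrightarrow> int X \<le> \<bar>fst p - fst q\<bar>"
  shows "(\<Sum>q\<in>T. cmod (gram p q)) \<le> card E * (D * real X powr (-\<beta>))"
proof -
  have "(\<Sum>q\<in>T. cmod (gram p q)) = (\<Sum>m\<in>E. \<Sum>q\<in>{q\<in>T. snd q = m}. cmod (gram p q))"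
    by (rule sum.group[OF assms(2-4), symmetric])
  also have "\<dots> \<le> (\<Sum>m\<in>E. D * real X powr (-\<beta>))"
  proof (rule sum_mono)
    fix m
    let ?T = "{q\<in>T. snd q = m}"
    have inj: "inj_on fst ?T" by (auto simp: inj_on_def prod_eq_iff)
    have "(\<Sum>q\<in>?T. cmod (gram p q)) = (\<Sum>l\<in>fst ` ?T. cmod (LINT x|M. e (fst p) (snd p) x * cnj (e l m x)))"
      by (subst sum.reindex[OF inj]) (auto simp: gram_def)
    also have "\<dots> \<le> D * real X powr (-\<beta>)"
      using assms by (intro decay) auto
    finally show "(\<Sum>q\<in>?T. cmod (gram p q)) \<le> D * real X powr (-\<beta>)" .
  qed
  finally show ?thesis by simp
qed

text \<open>Time is cut into blocks of length \<open>X\<close>. Pairs of equal or neighbouring blocks contribute a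
  factor of at most \<open>(\<Lambda> X)\<^bsup>1/2\<^esup>\<close> by the Cauchy-Schwarz inequality, where
  \<open>\<Lambda>\<close> controls the first packet on one block and \<open>X\<close>, by
  \<open>energy_short_time\<close>, the second one; a block has three such partners. In all other pairs the times
  differ by at least \<open>X\<close>, and Schur's test applies to the decaying Gram matrix. Sharp blocks are used
  instead of a cutoff in the time difference because the near part then is a sum of full pairings.\<close>

lemma pairing_bound:
  assumes X: "X > 0" and S: "finite S" "finite E" "snd ` S \<subseteq> E" and T: "finite T" "finite F" "snd ` T \<subseteq> F"
    and \<Lambda>: "\<Lambda> \<ge> 0" "\<And>a. energy {p\<in>S. fst p div int X = a} c \<le> \<Lambda> * mass {p\<in>S. fst p div int X = a} c"
  shows "cmod (pairing S c T d) \<le> (3 * sqrt (\<Lambda> * X) + D * real X powr (-\<beta>) * sqrt (card E * card F)) * (sqrt (mass S c) * sqrt (mass T d))"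
proof -
  define blk where "blk p = fst p div int X" for p :: "int \<times> 'n"
  define S' where "S' a = {p\<in>S. blk p = a}" for a
  define T' where "T' a = {p\<in>T. blk p = a}" for a
  define A where "A = blk ` S"
  define B where "B = blk ` T"
  have fin: "finite A" "finite B" using S T by (auto simp: A_def B_def)
  define near where "near a b \<longleftrightarrow> \<bar>a - b\<bar> \<le> 1" for a b :: int
  have part: "pairing S c T d = (\<Sum>a\<in>A. \<Sum>b\<in>B. pairing (S' a) c (T' b) d)"
    unfolding S'_def T'_def by (rule pairing_partition) (auto simp: S T fin A_def B_def)
  have Tblk: "energy (T' b) d \<le> X * mass (T' b) d" for b
  proof -
    have "k \<in> {b * int X..<b * int X + int X}" if "k div int X = b" for k
    proof -
      have "0 \<le> k mod int X" "k mod int X < int X" using X by auto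
      then show ?thesis using div_mult_mod_eq[of k "int X"] that by auto
    qed
    then have "energy (T' b) d \<le> card {b * int X..<b * int X + int X} * mass (T' b) d"
      by (intro energy_short_time) (auto simp: T'_def T blk_def)
    then show ?thesis by simp
  qed
  have nr: "(\<Sum>a\<in>A. \<Sum>b\<in>B. (if near a b then 1 else 0) * cmod (pairing (S' a) c (T' b) d)) \<le> 3 * sqrt (\<Lambda> * X) * (sqrt (mass S c) * sqrt (mass T d))"
  proof -
    have c3: "(\<Sum>b\<in>U. (if near a b then 1 else 0)) \<le> (3::real)" if "finite U" for U a
    proof -
      have "(\<Sum>b\<in>U. (if near a b then 1 else 0)) = real (card {b\<in>U. near a b})"
        using that by (simp add: sum.If_cases Int_def)
      also have "card {b\<in>U. near a b} \<le> card {a-1..a+1}" by (intro card_mono) (auto simp: near_def)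
      finally show ?thesis by simp
    qed
    have sym: "near a b = near b a" for a b by (auto simp: near_def)
    have "(\<Sum>a\<in>A. \<Sum>b\<in>B. (if near a b then 1 else 0) * cmod (pairing (S' a) c (T' b) d))
       \<le> (\<Sum>a\<in>A. \<Sum>b\<in>B. (if near a b then 1 else 0) * (sqrt (\<Lambda> * mass (S' a) c) * sqrt (X * mass (T' b) d)))"
    proof (intro sum_mono mult_left_mono)
      fix a b
      have "cmod (pairing (S' a) c (T' b) d) \<le> sqrt (energy (S' a) c) * sqrt (energy (T' b) d)"
        by (rule pairing_Cauchy_Schwarz)
      also have "\<dots> \<le> sqrt (\<Lambda> * mass (S' a) c) * sqrt (X * mass (T' b) d)"
        using \<Lambda>(2)[of a] Tblk[of b]
          by (intro mult_mono real_sqrt_le_mono) (auto simp: S'_def blk_def energy_def intro!: mult_nonneg_nonneg sum_nonneg \<Lambda>(1))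
      finally show "cmod (pairing (S' a) c (T' b) d) \<le> \<dots>" .
    qed auto
    also have "\<dots> \<le> sqrt (3 * 3) * (sqrt (\<Sum>a\<in>A. (sqrt (\<Lambda> * mass (S' a) c))\<^sup>2) * sqrt (\<Sum>b\<in>B. (sqrt (X * mass (T' b) d))\<^sup>2))"
      by (rule schur_test) (use fin c3 sym in auto)
    also have "(\<Sum>a\<in>A. (sqrt (\<Lambda> * mass (S' a) c))\<^sup>2) = \<Lambda> * mass S c"
    proof -
      have "(\<Sum>a\<in>A. (sqrt (\<Lambda> * mass (S' a) c))\<^sup>2) = \<Lambda> * (\<Sum>a\<in>A. mass (S' a) c)"
        using \<Lambda>(1) by (simp add: sum_nonneg sum_distrib_left)
      also have "(\<Sum>a\<in>A. mass (S' a) c) = mass S c" unfolding S'_def A_def by (rule sum.group) (auto simp: S)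
      finally show ?thesis .
    qed
    also have "(\<Sum>b\<in>B. (sqrt (X * mass (T' b) d))\<^sup>2) = X * mass T d"
    proof -
      have "(\<Sum>b\<in>B. (sqrt (X * mass (T' b) d))\<^sup>2) = X * (\<Sum>b\<in>B. mass (T' b) d)"
        by (simp add: sum_nonneg sum_distrib_left)
      also have "(\<Sum>b\<in>B. mass (T' b) d) = mass T d" unfolding T'_def B_def by (rule sum.group) (auto simp: T)
      finally show ?thesis .
    qed
    finally show ?thesis by (simp add: real_sqrt_mult mult_ac)
  qed
  define far where "far p q = (if near (blk p) (blk q) then 0 else cmod (gram p q))" for p q
  have farX: "int X \<le> \<bar>fst p - fst q\<bar>" if "\<not> near (blk p) (blk q)" for p q
  proof -
    have *: "int X \<le> v - u" if "u div int X + 2 \<le> v div int X" for u v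
    proof -
      have "0 \<le> v mod int X" "u mod int X < int X" using X by auto
      moreover have "(u div int X + 2) * int X \<le> (v div int X) * int X" using that by (intro mult_right_mono) auto
      ultimately show ?thesis using div_mult_mod_eq[of u "int X"] div_mult_mod_eq[of v "int X"]
        unfolding distrib_right by linarith
    qed
    from that have "blk p + 2 \<le> blk q \<or> blk q + 2 \<le> blk p" by (auto simp: near_def)
    then show ?thesis using *[of "fst p" "fst q"] *[of "fst q" "fst p"] by (auto simp: blk_def)
  qed
  have fr: "(\<Sum>p\<in>S. \<Sum>q\<in>T. far p q * (cmod (c p) * cmod (d q))) \<le>
      D * real X powr (-\<beta>) * sqrt (card E * card F) * (sqrt (mass S c) * sqrt (mass T d))"
  proof -
    let ?D = "D * real X powr (-\<beta>)"
    have D0: "0 \<le> ?D" using D_nonneg by simp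
    have "(\<Sum>p\<in>S. \<Sum>q\<in>T. far p q * (cmod (c p) * cmod (d q))) \<le>
      sqrt (card F * ?D * (card E * ?D)) * (sqrt (mass S c) * sqrt (mass T d))"
    proof (rule schur_test)
      fix p
      have "(\<Sum>q\<in>T. far p q) = (\<Sum>q\<in>{q\<in>T. \<not> near (blk p) (blk q)}. cmod (gram p q))"
        by (rule sum.mono_neutral_cong_right) (auto simp: far_def T)
      also have "\<dots> \<le> card F * ?D"
        by (rule gram_far_row_sum[OF X]) (use T farX in auto)
      finally show "(\<Sum>q\<in>T. far p q) \<le> card F * ?D" .
    next
      fix q
      have "(\<Sum>p\<in>S. far p q) = (\<Sum>p\<in>{p\<in>S. \<not> near (blk p) (blk q)}. cmod (gram q p))"
        by (rule sum.mono_neutral_cong_right) (auto simp: far_def S cmod_gram_commute)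
      also have "\<dots> \<le> card E * ?D"
        by (rule gram_far_row_sum[OF X]) (use S farX in \<open>auto simp: abs_minus_commute\<close>)
      finally show "(\<Sum>p\<in>S. far p q) \<le> card E * ?D" .
    qed (auto simp: S T far_def)
    also have "sqrt (card F * ?D * (card E * ?D)) = ?D * sqrt (card E * card F)"
      using D0 D_nonneg by (simp add: real_sqrt_mult[symmetric] mult_ac) (simp add: real_sqrt_mult mult_ac)
    finally show ?thesis .
  qed
  have pw: "cmod (pairing (S' a) c (T' b) d) \<le> (if near a b then 1 else 0) * cmod (pairing (S' a) c (T' b) d)
      + (\<Sum>p\<in>S' a. \<Sum>q\<in>T' b. far p q * (cmod (c p) * cmod (d q)))" for a b
  proof (cases "near a b")
    case True
    then show ?thesis by (auto intro!: sum_nonneg simp: far_def)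
  next
    case False
    have "cmod (pairing (S' a) c (T' b) d) \<le> (\<Sum>p\<in>S' a. \<Sum>q\<in>T' b. cmod (c p * cnj (d q) * gram p q))"
      unfolding pairing_expand by (intro order_trans[OF norm_sum] sum_mono order_trans[OF norm_sum]) auto
    also have "\<dots> = (\<Sum>p\<in>S' a. \<Sum>q\<in>T' b. far p q * (cmod (c p) * cmod (d q)))"
      by (intro sum.cong refl) (use False in \<open>auto simp: far_def S'_def T'_def norm_mult\<close>)
    finally show ?thesis using False by simp
  qed
  have "cmod (pairing S c T d) \<le> (\<Sum>a\<in>A. \<Sum>b\<in>B. cmod (pairing (S' a) c (T' b) d))"
    unfolding part by (intro order_trans[OF norm_sum] sum_mono norm_sum)
  also have "\<dots> \<le> (\<Sum>a\<in>A. \<Sum>b\<in>B. (if near a b then 1 else 0) * cmod (pairing (S' a) c (T' b) d)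
      + (\<Sum>p\<in>S' a. \<Sum>q\<in>T' b. far p q * (cmod (c p) * cmod (d q))))"
    by (intro sum_mono pw)
  also have "\<dots> = (\<Sum>a\<in>A. \<Sum>b\<in>B. (if near a b then 1 else 0) * cmod (pairing (S' a) c (T' b) d))
      + (\<Sum>a\<in>A. \<Sum>b\<in>B. \<Sum>p\<in>S' a. \<Sum>q\<in>T' b. far p q * (cmod (c p) * cmod (d q)))"
    by (simp only: sum.distrib)
  also have "(\<Sum>a\<in>A. \<Sum>b\<in>B. \<Sum>p\<in>S' a. \<Sum>q\<in>T' b. far p q * (cmod (c p) * cmod (d q)))
     = (\<Sum>p\<in>S. \<Sum>q\<in>T. far p q * (cmod (c p) * cmod (d q)))"
  proof -
    have "(\<Sum>a\<in>A. \<Sum>b\<in>B. \<Sum>p\<in>S' a. \<Sum>q\<in>T' b. far p q * (cmod (c p) * cmod (d q)))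
      = (\<Sum>a\<in>A. \<Sum>p\<in>S' a. \<Sum>b\<in>B. \<Sum>q\<in>T' b. far p q * (cmod (c p) * cmod (d q)))"
      by (intro sum.cong refl sum.swap)
    also have "\<dots> = (\<Sum>p\<in>S. \<Sum>b\<in>B. \<Sum>q\<in>T' b. far p q * (cmod (c p) * cmod (d q)))"
      unfolding S'_def A_def by (rule sum.group) (auto simp: S)
    also have "\<dots> = (\<Sum>p\<in>S. \<Sum>q\<in>T. far p q * (cmod (c p) * cmod (d q)))"
      unfolding T'_def B_def by (intro sum.cong refl sum.group) (auto simp: T)
    finally show ?thesis .
  qed
  finally show ?thesis using nr fr by (simp add: algebra_simps)
qed

text \<open>The diagonal case of \<open>pairing_bound\<close>, with the trivial control \<open>\<Lambda> = X\<close>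
  on a block.\<close>

lemma energy_bound:
  assumes X: "X > 0" and S: "finite S" "finite E" "snd ` S \<subseteq> E"
  shows "energy S c \<le> (3 * real X + D * real X powr (-\<beta>) * card E) * mass S c"
proof -
  have blk: "energy {p\<in>S. fst p div int X = a} c \<le> real X * mass {p\<in>S. fst p div int X = a} c" for a
  proof -
    have "k \<in> {a * int X..<a * int X + int X}" if "k div int X = a" for k
    proof -
      have "0 \<le> k mod int X" "k mod int X < int X" using X by auto
      then show ?thesis using div_mult_mod_eq[of k "int X"] that by auto
    qed
    then have "energy {p\<in>S. fst p div int X = a} c \<le> card {a * int X..<a * int X + int X} * mass {p\<in>S. fst p div int X = a} c"
      by (intro energy_short_time) (auto simp: S)
    then show ?thesis by simp
  qed
  have "energy S c = cmod (pairing S c S c)"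
    unfolding energy_eq_pairing[symmetric] by (simp add: energy_def)
  also have "\<dots> \<le> (3 * sqrt (real X * X) + D * real X powr (-\<beta>) * sqrt (card E * card E)) * (sqrt (mass S c) * sqrt (mass S c))"
    by (rule pairing_bound[OF X S S _ blk]) auto
  finally show ?thesis by (simp add: sum_nonneg)
qed

end

section \<open>Smoothing in discrete time\<close>

context dispersive_system
begin

lemma energy_scale: "energy S (\<lambda>p. of_real a * c p) = a\<^sup>2 * energy S c"
proof -
  have "packet S (\<lambda>p. of_real a * c p) x = of_real a * packet S c x" for x
    by (simp add: packet_def sum_distrib_left mult.assoc)
  then show ?thesis by (simp add: energy_def norm_mult power_mult_distrib)
qed

definition almost_orthogonality_rate :: real where
  "almost_orthogonality_rate = min 1 \<beta> / (6 * (1 + \<beta>))"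

definition smoothing_constant :: real where
  "smoothing_constant = (3 * sqrt (12 + 4 * D) + 2 * D) * (2 / (1 - 2 powr (- almost_orthogonality_rate)))"

lemma almost_orthogonality_rate_pos: "almost_orthogonality_rate > 0"
  using \<beta>_pos by (simp add: almost_orthogonality_rate_def)

lemma smoothing_constant_pos: "smoothing_constant > 0"
proof -
  have "2 powr (- almost_orthogonality_rate) < 1"
    using almost_orthogonality_rate_pos powr_less_mono[of "- almost_orthogonality_rate" 0 2] by simp
  moreover have "sqrt (12 + 4 * D) > 0" using D_nonneg by simp
  ultimately show ?thesis unfolding smoothing_constant_def using D_nonneg
    by (intro mult_pos_pos add_pos_nonneg divide_pos_pos) auto
qed

lemma geometric_row_sum:
  assumes "finite I"
  shows "(\<Sum>l\<in>I. 2 powr (- almost_orthogonality_rate * \<bar>real l - real i\<bar>)) \<le> 2 / (1 - 2 powr (- almost_orthogonality_rate))"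
proof -
  define \<rho> where "\<rho> = 2 powr (- almost_orthogonality_rate)"
  have \<rho>: "0 < \<rho>" "\<rho> < 1"
    using almost_orthogonality_rate_pos powr_less_mono[of "- almost_orthogonality_rate" 0 2] by (simp_all add: \<rho>_def)
  have "(\<Sum>l\<in>I. 2 powr (- almost_orthogonality_rate * \<bar>real l - real i\<bar>)) \<le> 2 * (1 / (1 - \<rho>))"
  proof (rule sum_antimono_distance_le[where g = "\<lambda>x. 2 powr (- almost_orthogonality_rate * x)" and f = real])
    show "2 powr (- almost_orthogonality_rate * y) \<le> 2 powr (- almost_orthogonality_rate * x)" if "x \<le> y" for x y :: real
      using that almost_orthogonality_rate_pos by (intro powr_mono) auto
    show "(\<Sum>j<n. 2 powr (- almost_orthogonality_rate * real j)) \<le> 1 / (1 - \<rho>)" for n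
    proof -
      have "2 powr (- almost_orthogonality_rate * real j) = \<rho> ^ j" for j
        using \<rho>(1) powr_realpow[of \<rho> j] by (simp add: \<rho>_def powr_powr)
      then have "(\<Sum>j<n. 2 powr (- almost_orthogonality_rate * real j)) = (\<Sum>j<n. \<rho> ^ j)" by simp
      also have "\<dots> = (1 - \<rho> ^ n) / (1 - \<rho>)" using \<rho> by (simp add: sum_gp_strict)
      also have "\<dots> \<le> 1 / (1 - \<rho>)" using \<rho> by (intro divide_right_mono) auto
      finally show ?thesis .
    qed
    show "1 \<le> \<bar>real k - real l\<bar>" if "k \<noteq> l" for k l
      using real_nat_separated[OF that] that by linarith
  qed (use assms in auto)
  then show ?thesis by (simp add: \<rho>_def)
qed

text \<open>The sites are sorted into levels: on level \<open>i\<close> the value \<open>(w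
  n)\<^bsup>r\<^esup>\<close>, \<open>r = 2 (1 + \<beta>)\<close>, lies in \<open>[2\<^bsup>-i-1\<^esup>,
  2\<^bsup>-i\<^esup>]\<close>, so there are at most \<open>2\<^bsup>i+1\<^esup>\<close> sites and, with \<open>H i =
  2\<^bsup>2i/r\<^esup>\<close>, \<open>(w n)\<^sup>2 \<le> 1 / H i\<close>. Within one level,
  \<open>energy_bound\<close> with \<open>X\<close> of order \<open>H i\<close> loses a factor of order \<open>H
  i\<close>, which the weights compensate exactly. Across levels \<open>i \<le> l\<close>,
  \<open>pairing_bound\<close> with this information about level \<open>i\<close> and a block length between \<open>H
  i\<close> and \<open>H l\<close> gains a power of \<open>2\<^bsup>-(l-i)\<^esup>\<close>. The levels involve
  disjoint sets of coefficients, so Schur's test over the levels finishes the proof.\<close>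

lemma weighted_energy_normalized:
  fixes w :: "'n \<Rightarrow> real"
  assumes S: "finite S" and w: "\<And>n. w n \<ge> 0" and W: "(\<Sum>n\<in>snd ` S. w n powr (2 * (1 + \<beta>))) \<le> 1"
  shows "energy S (\<lambda>p. of_real (w (snd p)) * F p) \<le> smoothing_constant * mass S F"
proof -
  define r where "r = 2 * (1 + \<beta>)"
  define \<gamma> where "\<gamma> = 1 / (1 + \<beta>)"
  have \<gamma>: "0 < \<gamma>" "1 - \<gamma> * \<beta> = \<gamma>" "1 - \<gamma> = \<beta> * \<gamma>" "\<gamma> = 2 / r" "r > 0"
    using \<beta>_pos by (auto simp: \<gamma>_def r_def field_simps)
  define c where "c p = of_real (w (snd p)) * F p" for p :: "int \<times> 'n"
  define v where "v n = w n powr r" for n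
  define lev where "lev n = nat \<lfloor>- log 2 (v n)\<rfloor>" for n
  define S0 where "S0 = {p\<in>S. w (snd p) > 0}"
  define S' where "S' i = {p\<in>S0. lev (snd p) = i}" for i
  define E where "E i = snd ` S' i" for i
  define H where "H i = 2 powr (\<gamma> * real i)" for i :: nat
  have H: "H i \<ge> 1" for i unfolding H_def using \<gamma>(1) by (intro ge_one_powr_ge_zero) auto
  have finS: "finite S0" "\<And>i. finite (S' i)" "\<And>i. finite (E i)" using S by (auto simp: S0_def S'_def E_def)
  have lev: "2 powr (- (real i + 1)) \<le> v n" "v n \<le> 2 powr (- real i)" if "n \<in> E i" for n i
  proof -
    from that have "n \<in> snd ` S' i" by (simp add: E_def)
    then obtain p where "p \<in> S' i" "n = snd p" by blast
    then have p: "p \<in> S" "n = snd p" "w n > 0" "lev n = i" by (auto simp: S'_def S0_def)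
    have v0: "v n > 0" using p by (simp add: v_def)
    have "v n \<le> (\<Sum>n\<in>snd ` S. v n)" using S p by (intro member_le_sum) (auto simp: v_def)
    then have v1: "v n \<le> 1" using W by (simp add: v_def r_def)
    define y where "y = - log 2 (v n)"
    have y: "y \<ge> 0" "v n = 2 powr (- y)" using v0 v1 by (simp_all add: y_def)
    have "real i \<le> y" "y < real i + 1" using p(4) y(1) by (simp_all add: lev_def y_def[symmetric] nat_eq_iff) linarith+
    then show "2 powr (- (real i + 1)) \<le> v n" "v n \<le> 2 powr (- real i)"
      unfolding y(2) by (auto intro!: powr_mono)
  qed
  have w2: "(w n)\<^sup>2 \<le> 1 / H i" if "n \<in> E i" for n i
  proof -
    have "w n > 0" using that by (auto simp: E_def S'_def S0_def)
    then have "(w n)\<^sup>2 = v n powr \<gamma>" using \<gamma> by (simp add: v_def powr_powr powr_realpow[of "w n" 2, symmetric, simplified])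
    also have "\<dots> \<le> (2 powr (- real i)) powr \<gamma>" using lev[OF that] \<gamma>(1) by (intro powr_mono2) (auto simp: v_def)
    also have "\<dots> = 1 / H i" unfolding powr_powr by (simp add: H_def powr_minus_divide mult.commute)
    finally show ?thesis .
  qed
  have cE: "real (card (E i)) \<le> 2 * 2 powr real i" for i
  proof -
    have "real (card (E i)) * 2 powr (- (real i + 1)) \<le> (\<Sum>n\<in>E i. v n)"
      using sum_mono[of "E i" "\<lambda>n. 2 powr (- (real i + 1))" v] lev(1) by simp
    also have "\<dots> \<le> (\<Sum>n\<in>snd ` S. v n)"
      using S by (intro sum_mono2) (auto simp: E_def S'_def S0_def v_def)
    also have "\<dots> \<le> 1" using W by (simp add: v_def r_def)
    finally have "real (card (E i)) \<le> 2 powr (real i + 1)"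
      unfolding powr_minus by (simp add: divide_inverse[symmetric] divide_le_eq)
    then show ?thesis by (simp add: powr_add)
  qed
  have ceil: "0 < nat \<lceil>y\<rceil>" "y \<le> real (nat \<lceil>y\<rceil>)" "real (nat \<lceil>y\<rceil>) \<le> 2 * y" if "y \<ge> 1" for y :: real
    using that by linarith+
  define \<Lambda> where "\<Lambda> i = (6 + 2 * D) * H i" for i
  have diag: "energy T c \<le> \<Lambda> i * mass T c" if T: "T \<subseteq> S' i" for T i
  proof -
    define X where "X = nat \<lceil>H i\<rceil>"
    have X: "0 < X" "H i \<le> real X" "real X \<le> 2 * H i" unfolding X_def using ceil[OF H[of i]] by auto
    have "energy T c \<le> (3 * real X + D * real X powr (-\<beta>) * card (E i)) * mass T c"
      by (rule energy_bound) (use X T finS in \<open>auto simp: E_def intro: finite_subset\<close>)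
    also have "\<dots> \<le> \<Lambda> i * mass T c"
    proof (intro mult_right_mono sum_nonneg)
      have "real X powr (-\<beta>) * card (E i) \<le> H i powr (-\<beta>) * (2 * 2 powr real i)"
        using X H[of i] \<beta>_pos cE by (intro mult_mono powr_mono2') auto
      also have "\<dots> = 2 * 2 powr (\<gamma> * real i * (-\<beta>) + real i)" by (simp only: H_def powr_powr powr_add mult_ac)
      also have "\<gamma> * real i * (-\<beta>) + real i = (1 - \<gamma> * \<beta>) * real i" by (simp add: algebra_simps)
      also have "\<dots> = \<gamma> * real i" by (simp only: \<gamma>(2))
      finally have "real X powr (-\<beta>) * card (E i) \<le> 2 * H i" by (simp add: H_def)
      then have "D * (real X powr (-\<beta>) * card (E i)) \<le> D * (2 * H i)" using D_nonneg by (rule mult_left_mono)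
      then show "3 * real X + D * real X powr (-\<beta>) * card (E i) \<le> \<Lambda> i"
        using X by (simp add: \<Lambda>_def algebra_simps)
    qed auto
    finally show ?thesis .
  qed
  define f where "f i = sqrt (mass (S' i) F)" for i
  define K where "K = 3 * sqrt (12 + 4 * D) + 2 * D"
  define g where "g x = 2 powr (- almost_orthogonality_rate * x)" for x
  have K0: "K \<ge> 0" using D_nonneg by (simp add: K_def)
  have mc: "sqrt (mass (S' i) c) \<le> f i / 2 powr (\<gamma> * real i / 2)" for i
  proof -
    have "mass (S' i) c \<le> (\<Sum>p\<in>S' i. 1 / H i * (cmod (F p))\<^sup>2)"
    proof (rule sum_mono)
      fix p assume "p \<in> S' i"
      then have "(w (snd p))\<^sup>2 \<le> 1 / H i" by (intro w2) (auto simp: E_def)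
      then have "(w (snd p))\<^sup>2 * (cmod (F p))\<^sup>2 \<le> 1 / H i * (cmod (F p))\<^sup>2" by (rule mult_right_mono) auto
      then show "(cmod (c p))\<^sup>2 \<le> 1 / H i * (cmod (F p))\<^sup>2" by (simp add: c_def norm_mult power_mult_distrib)
    qed
    then have "mass (S' i) c \<le> mass (S' i) F / H i" by (simp add: sum_divide_distrib)
    then have "sqrt (mass (S' i) c) \<le> sqrt (mass (S' i) F / H i)" by (rule real_sqrt_le_mono)
    also have "\<dots> = f i / sqrt (H i)" by (simp add: f_def real_sqrt_divide)
    also have "sqrt (H i) = 2 powr (\<gamma> * real i / 2)" by (simp add: H_def powr_half_sqrt[symmetric] powr_powr)
    finally show ?thesis .
  qed
  have f0: "f i \<ge> 0" for i by (simp add: f_def sum_nonneg)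
  have off: "cmod (pairing (S' i) c (S' l) c) \<le> K * g \<bar>real l - real i\<bar> * (f i * f l)" if il: "i \<le> l" for i l
  proof -
    define s where "s = real l - real i"
    have s: "s \<ge> 0" using il by (simp add: s_def)
    \<comment> \<open>A weighted geometric mean of \<open>H i\<close> and \<open>H l\<close> at which the near and the far part both gain a power of \<open>2\<^bsup>-(l-i)\<^esup>\<close>.\<close>
    define Y where "Y = 2 powr (\<gamma> * (2 * real l + real i) / 3)"
    have Y: "Y \<ge> 1" unfolding Y_def using \<gamma>(1) by (intro ge_one_powr_ge_zero) auto
    define X where "X = nat \<lceil>Y\<rceil>"
    have X: "0 < X" "Y \<le> real X" "real X \<le> 2 * Y" unfolding X_def using ceil[OF Y] by auto
    define P where "P = 2 powr (\<gamma> * real i / 2) * 2 powr (\<gamma> * real l / 2)"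
    have P0: "P > 0" by (simp add: P_def)
    have rate: "almost_orthogonality_rate = \<gamma> * min 1 \<beta> / 6"
      using \<beta>_pos by (simp add: almost_orthogonality_rate_def \<gamma>_def)
    have near: "3 * sqrt (\<Lambda> i * X) \<le> 3 * sqrt (12 + 4 * D) * g s * P"
    proof -
      have "\<Lambda> i * X \<le> \<Lambda> i * (2 * Y)" using X D_nonneg H[of i] by (intro mult_left_mono) (auto simp: \<Lambda>_def)
      also have "\<dots> = (12 + 4 * D) * (H i * Y)" by (simp add: \<Lambda>_def algebra_simps)
      finally have "sqrt (\<Lambda> i * X) \<le> sqrt (12 + 4 * D) * sqrt (H i * Y)"
        by (simp add: real_sqrt_mult[symmetric])
      also have "sqrt (H i * Y) = 2 powr ((\<gamma> * real i + \<gamma> * (2 * real l + real i) / 3) / 2)"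
        by (simp add: H_def Y_def powr_add[symmetric] powr_half_sqrt[symmetric] powr_powr)
      also have "\<dots> \<le> 2 powr (- almost_orthogonality_rate * s + (\<gamma> * real i / 2 + \<gamma> * real l / 2))"
      proof (rule powr_mono)
        have "min 1 \<beta> * (\<gamma> * s) \<le> 1 * (\<gamma> * s)" using s \<gamma>(1) by (intro mult_right_mono) auto
        then have 1: "almost_orthogonality_rate * s \<le> \<gamma> * s / 6" unfolding rate by (simp add: algebra_simps)
        have 2: "(\<gamma> * real i + \<gamma> * (2 * real l + real i) / 3) / 2 = \<gamma> * real i / 2 + \<gamma> * real l / 2 - \<gamma> * s / 6"
          by (simp add: s_def field_simps)
        show "(\<gamma> * real i + \<gamma> * (2 * real l + real i) / 3) / 2
            \<le> - almost_orthogonality_rate * s + (\<gamma> * real i / 2 + \<gamma> * real l / 2)"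
          using 1 2 by linarith
      qed simp
      also have "\<dots> = g s * P" by (simp only: g_def P_def powr_add)
      finally show ?thesis using D_nonneg by (simp add: mult.assoc mult_left_mono)
    qed
    have far: "D * real X powr (-\<beta>) * sqrt (card (E i) * card (E l)) \<le> 2 * D * g s * P"
    proof -
      have "real (card (E i) * card (E l)) \<le> (2 * 2 powr real i) * (2 * 2 powr real l)"
        unfolding of_nat_mult by (intro mult_mono cE) auto
      then have "sqrt (card (E i) * card (E l)) \<le> sqrt ((2 * 2 powr real i) * (2 * 2 powr real l))"
        by (rule real_sqrt_le_mono)
      also have "\<dots> = sqrt (2\<^sup>2 * 2 powr (real i + real l))" by (simp add: powr_add)
      also have "\<dots> = 2 * 2 powr ((real i + real l) / 2)"
        unfolding real_sqrt_mult by (simp add: powr_half_sqrt[symmetric] powr_powr)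
      finally have "real X powr (-\<beta>) * sqrt (card (E i) * card (E l)) \<le> Y powr (-\<beta>) * (2 * 2 powr ((real i + real l) / 2))"
        using X Y \<beta>_pos by (intro mult_mono powr_mono2') auto
      also have "\<dots> = 2 * 2 powr (\<gamma> * (2 * real l + real i) / 3 * (-\<beta>) + (real i + real l) / 2)"
        by (simp only: Y_def powr_powr powr_add mult_ac)
      also have "\<dots> \<le> 2 * 2 powr (- almost_orthogonality_rate * s + (\<gamma> * real i / 2 + \<gamma> * real l / 2))"
      proof (intro mult_left_mono powr_mono)
        have "min 1 \<beta> * (\<gamma> * s) \<le> \<beta> * (\<gamma> * s)" using s \<gamma>(1) by (intro mult_right_mono) auto
        then have 1: "almost_orthogonality_rate * s \<le> \<beta> * \<gamma> * s / 6" unfolding rate by (simp add: algebra_simps)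
        have 2: "(real i + real l) / 2 - (\<gamma> * real i / 2 + \<gamma> * real l / 2) = \<beta> * \<gamma> * (real i + real l) / 2"
          unfolding \<gamma>(3)[symmetric] by (simp add: algebra_simps add_divide_distrib diff_divide_distrib)
        have 3: "\<gamma> * (2 * real l + real i) / 3 * (-\<beta>) + \<beta> * \<gamma> * (real i + real l) / 2 = - (\<beta> * \<gamma> * s / 6)"
          by (simp add: s_def field_simps)
        show "\<gamma> * (2 * real l + real i) / 3 * (-\<beta>) + (real i + real l) / 2
            \<le> - almost_orthogonality_rate * s + (\<gamma> * real i / 2 + \<gamma> * real l / 2)"
          using 1 2 3 by linarith
      qed auto
      also have "\<dots> = 2 * (g s * P)" by (simp only: g_def P_def powr_add)
      finally have "D * (real X powr (-\<beta>) * sqrt (card (E i) * card (E l))) \<le> D * (2 * (g s * P))"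
        using D_nonneg by (rule mult_left_mono)
      then show ?thesis by (simp add: mult_ac)
    qed
    have g0: "g s \<ge> 0" by (simp add: g_def)
    have "cmod (pairing (S' i) c (S' l) c) \<le>
        (3 * sqrt (\<Lambda> i * X) + D * real X powr (-\<beta>) * sqrt (card (E i) * card (E l))) * (sqrt (mass (S' i) c) * sqrt (mass (S' l) c))"
    proof (rule pairing_bound[OF X(1)])
      show "0 \<le> \<Lambda> i" using D_nonneg H[of i] by (simp add: \<Lambda>_def)
      show "energy {p \<in> S' i. fst p div int X = a} c \<le> \<Lambda> i * mass {p \<in> S' i. fst p div int X = a} c" for a
        by (rule diag) auto
    qed (auto simp: finS E_def)
    also have "\<dots> \<le> (3 * sqrt (12 + 4 * D) * g s * P + 2 * D * g s * P) * (f i / 2 powr (\<gamma> * real i / 2) * (f l / 2 powr (\<gamma> * real l / 2)))"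
      using D_nonneg g0 P0 f0 by (intro mult_mono add_mono near far mc) (auto simp: sum_nonneg)
    also have "\<dots> = K * g s * (f i * f l)"
      by (simp add: K_def P_def field_simps)
    finally show ?thesis using s by (simp add: s_def)
  qed
  have pair: "cmod (pairing (S' i) c (S' l) c) \<le> K * g \<bar>real l - real i\<bar> * (f i * f l)" for i l
  proof (cases "i \<le> l")
    case False
    then have "cmod (pairing (S' l) c (S' i) c) \<le> K * g \<bar>real i - real l\<bar> * (f l * f i)" by (intro off) simp
    then show ?thesis
      by (simp only: cmod_pairing_commute[of "S' i" c "S' l"] abs_minus_commute[of "real l"] mult.commute[of "f i"])
  qed (rule off)
  define I where "I = (lev \<circ> snd) ` S0"
  have finI: "finite I" using finS by (simp add: I_def)
  define R where "R = 2 / (1 - 2 powr (- almost_orthogonality_rate))"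
  have row: "(\<Sum>l\<in>I. K * g \<bar>real l - real i\<bar>) \<le> K * R" for i
    unfolding sum_distrib_left[symmetric] g_def R_def by (intro mult_left_mono geometric_row_sum finI K0)
  have "packet S c x = packet S0 c x" for x
    unfolding packet_def
  proof (rule sum.mono_neutral_right[OF S])
    show "\<forall>p\<in>S - S0. c p * e (fst p) (snd p) x = 0"
    proof
      fix p assume "p \<in> S - S0"
      then have "w (snd p) = 0" using w[of "snd p"] by (auto simp: S0_def)
      then show "c p * e (fst p) (snd p) x = 0" by (simp add: c_def)
    qed
  qed (auto simp: S0_def)
  then have "energy S c = energy S0 c" by (simp add: energy_def)
  also have "\<dots> = cmod (pairing S0 c S0 c)"
    unfolding energy_eq_pairing[symmetric] by (simp add: energy_def)
  also have "pairing S0 c S0 c = (\<Sum>i\<in>I. \<Sum>l\<in>I. pairing (S' i) c (S' l) c)"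
    using pairing_partition[OF finS(1) finS(1) finI finI, of "lev \<circ> snd" "lev \<circ> snd" c c]
    by (simp add: I_def S'_def)
  also have "cmod \<dots> \<le> (\<Sum>i\<in>I. \<Sum>l\<in>I. cmod (pairing (S' i) c (S' l) c))"
    by (intro order_trans[OF norm_sum] sum_mono norm_sum)
  also have "\<dots> \<le> (\<Sum>i\<in>I. \<Sum>l\<in>I. K * g \<bar>real l - real i\<bar> * (f i * f l))"
    by (intro sum_mono pair)
  also have "\<dots> \<le> sqrt ((K * R) * (K * R)) * (sqrt (\<Sum>i\<in>I. (f i)\<^sup>2) * sqrt (\<Sum>l\<in>I. (f l)\<^sup>2))"
    by (rule schur_test) (use finI K0 row in \<open>auto simp: g_def abs_minus_commute\<close>)
  also have "\<dots> = \<bar>K * R\<bar> * (\<Sum>i\<in>I. (f i)\<^sup>2)" by (simp add: sum_nonneg)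
  also have "(\<Sum>i\<in>I. (f i)\<^sup>2) = (\<Sum>i\<in>I. mass (S' i) F)" by (simp add: f_def sum_nonneg)
  also have "\<dots> = mass S0 F"
    unfolding S'_def using sum.group[OF finS(1) finI, of "lev \<circ> snd" "\<lambda>p. (cmod (F p))\<^sup>2"] by (simp add: I_def)
  also have "K * R = smoothing_constant" by (simp add: K_def R_def smoothing_constant_def)
  also have "\<bar>smoothing_constant\<bar> * mass S0 F \<le> smoothing_constant * mass S F"
    using smoothing_constant_pos S by (auto intro!: mult_left_mono sum_mono2 simp: S0_def)
  finally show ?thesis by (simp add: c_def[abs_def])
qed

lemma weighted_energy:
  fixes w :: "'n \<Rightarrow> real"
  assumes S: "finite S" and w: "\<And>n. w n \<ge> 0" and A: "A > 0" "(\<Sum>n\<in>snd ` S. w n powr (2 * (1 + \<beta>))) \<le> A"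
  shows "energy S (\<lambda>p. of_real (w (snd p)) * F p) \<le> smoothing_constant * A powr (1 / (1 + \<beta>)) * mass S F"
proof -
  define r where "r = 2 * (1 + \<beta>)"
  have r: "r > 0" using \<beta>_pos by (simp add: r_def)
  define a where "a = A powr (1 / r)"
  have a: "a > 0" "a powr r = A" "a\<^sup>2 = A powr (1 / (1 + \<beta>))"
  proof -
    show "a > 0" "a powr r = A" using A r by (simp_all add: a_def powr_powr)
    have "a\<^sup>2 = A powr (1 / r + 1 / r)" unfolding powr_add by (simp add: a_def power2_eq_square)
    also have "1 / r + 1 / r = 1 / (1 + \<beta>)" using \<beta>_pos by (simp add: r_def field_simps)
    finally show "a\<^sup>2 = A powr (1 / (1 + \<beta>))" .
  qed
  have "energy S (\<lambda>p. of_real (w (snd p) / a) * F p) \<le> smoothing_constant * mass S F"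
  proof (rule weighted_energy_normalized[OF S])
    have "(\<Sum>n\<in>snd ` S. (w n / a) powr r) = (\<Sum>n\<in>snd ` S. w n powr r) / A"
      using a w by (simp add: powr_divide sum_divide_distrib)
    also have "\<dots> \<le> 1" using A by (simp add: r_def)
    finally show "(\<Sum>n\<in>snd ` S. (w n / a) powr (2 * (1 + \<beta>))) \<le> 1" by (simp add: r_def)
  qed (use w a in auto)
  then have "a\<^sup>2 * energy S (\<lambda>p. of_real (w (snd p) / a) * F p) \<le> a\<^sup>2 * (smoothing_constant * mass S F)"
    by (rule mult_left_mono) auto
  also have "a\<^sup>2 * energy S (\<lambda>p. of_real (w (snd p) / a) * F p) = energy S (\<lambda>p. of_real (w (snd p)) * F p)"
    using a(1) by (subst energy_scale[symmetric]) simp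
  finally show ?thesis by (simp add: a(3) mult_ac)
qed

text \<open>The coefficients that realise the norm are \<open>c p = (w p)\<^sup>2 * cnj (u p)\<close>, with \<open>u
  p\<close> the pairing of \<open>\<phi>\<close> with the wave: pairing \<open>\<phi>\<close> with their packet gives
  the left-hand side \<open>s\<close>, and the energy of the packet is at most \<open>C * s\<close>. Thus
  \<open>s\<^sup>2 \<le> N * C * s\<close>, where \<open>N\<close> is the integral on the right-hand side.\<close>

lemma duality:
  fixes w :: "int \<times> 'n \<Rightarrow> real"
  assumes S: "finite S" and C: "C \<ge> 0" and en: "\<And>F. energy S (\<lambda>p. of_real (w p) * F p) \<le> C * mass S F"
    and \<phi>: "\<phi> \<in> borel_measurable M" "integrable M (\<lambda>x. (cmod (\<phi> x))\<^sup>2)"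
  shows "(\<Sum>p\<in>S. (w p)\<^sup>2 * (cmod (LINT x|M. \<phi> x * e (fst p) (snd p) x))\<^sup>2) \<le> C * (LINT x|M. (cmod (\<phi> x))\<^sup>2)"
proof -
  define u where "u p = (LINT x|M. \<phi> x * e (fst p) (snd p) x)" for p
  define F where "F p = of_real (w p) * cnj (u p)" for p
  define c where "c p = of_real (w p) * F p" for p
  define s where "s = (\<Sum>p\<in>S. (w p)\<^sup>2 * (cmod (u p))\<^sup>2)"
  define N where "N = (LINT x|M. (cmod (\<phi> x))\<^sup>2)"
  have s0: "s \<ge> 0" by (simp add: s_def sum_nonneg)
  have N0: "N \<ge> 0" by (simp add: N_def)
  have sm: "s = mass S F" by (simp add: s_def F_def norm_mult power_mult_distrib)
  have i: "integrable M (\<lambda>x. \<phi> x * e (fst p) (snd p) x)" for p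
    by (rule integral_Cauchy_Schwarz(1)[OF \<phi>(1) e_measurable \<phi>(2)])
       (rule integrable_const_bound[where B = 1], auto intro!: power_le_one e_bound)
  have "(LINT x|M. \<phi> x * packet S c x) = (LINT x|M. (\<Sum>p\<in>S. c p * (\<phi> x * e (fst p) (snd p) x)))"
    unfolding packet_def by (simp add: sum_distrib_left mult_ac)
  also have "\<dots> = (\<Sum>p\<in>S. c p * u p)" using i by (simp add: u_def)
  also have "\<dots> = of_real s"
    unfolding s_def of_real_sum
  proof (intro sum.cong refl)
    fix p
    have "c p * u p = of_real ((w p)\<^sup>2) * (u p * cnj (u p))"
      by (simp add: c_def F_def power2_eq_square mult_ac)
    also have "\<dots> = of_real ((w p)\<^sup>2 * (cmod (u p))\<^sup>2)"
      by (simp only: complex_norm_square[symmetric] of_real_mult)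
    finally show "c p * u p = of_real ((w p)\<^sup>2 * (cmod (u p))\<^sup>2)" .
  qed
  finally have "cmod (of_real s) = cmod (LINT x|M. \<phi> x * packet S c x)" by simp
  also have "\<dots> \<le> sqrt N * sqrt (energy S c)"
    unfolding N_def energy_def
    by (rule integral_Cauchy_Schwarz(2)) (use \<phi> integrable_packet_square in auto)
  also have "\<dots> \<le> sqrt N * sqrt (C * s)"
    using en[of F] N0 unfolding sm by (intro mult_left_mono real_sqrt_le_mono) (auto simp: c_def[abs_def])
  finally have "s \<le> sqrt (C * N * s)" using s0 by (simp add: real_sqrt_mult mult_ac)
  then have "s\<^sup>2 \<le> C * N * s" using s0 C N0 by (metis real_le_rsqrt real_sqrt_le_iff real_sqrt_unique)
  then have "s \<le> C * N" using s0 C N0 by (cases "s = 0") (auto simp: power2_eq_square)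
  then show ?thesis by (simp add: s_def u_def N_def)
qed

theorem discrete_time_smoothing:
  fixes w :: "'n \<Rightarrow> real"
  assumes S: "finite S" and w: "\<And>n. w n \<ge> 0" and A: "A > 0" "(\<Sum>n\<in>snd ` S. w n powr (2 * (1 + \<beta>))) \<le> A"
    and \<phi>: "\<phi> \<in> borel_measurable M" "integrable M (\<lambda>x. (cmod (\<phi> x))\<^sup>2)"
  shows "(\<Sum>p\<in>S. (w (snd p))\<^sup>2 * (cmod (LINT x|M. \<phi> x * e (fst p) (snd p) x))\<^sup>2)
    \<le> smoothing_constant * A powr (1 / (1 + \<beta>)) * (LINT x|M. (cmod (\<phi> x))\<^sup>2)"
  by (rule duality[OF S _ weighted_energy[OF S w A] \<phi>]) (use smoothing_constant_pos in auto)

text \<open>Duality at a single time, where the energy of a packet equals its mass.\<close>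

lemma bessel_inequality:
  assumes E: "finite E" and \<phi>: "\<phi> \<in> borel_measurable M" "integrable M (\<lambda>x. (cmod (\<phi> x))\<^sup>2)"
  shows "(\<Sum>n\<in>E. (cmod (LINT x|M. \<phi> x * e k n x))\<^sup>2) \<le> (LINT x|M. (cmod (\<phi> x))\<^sup>2)"
proof -
  have "energy ({k} \<times> E) F = mass ({k} \<times> E) F" for F
    by (rule energy_single_time[of _ k]) (use E in auto)
  then have en: "energy ({k} \<times> E) (\<lambda>p. of_real 1 * F p) \<le> 1 * mass ({k} \<times> E) F" for F by simp
  have "(\<Sum>p\<in>{k} \<times> E. 1\<^sup>2 * (cmod (LINT x|M. \<phi> x * e (fst p) (snd p) x))\<^sup>2) \<le> 1 * (LINT x|M. (cmod (\<phi> x))\<^sup>2)"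
    by (rule duality[OF _ _ en \<phi>]) (use E in auto)
  moreover have "{k} \<times> E = Pair k ` E" by auto
  ultimately show ?thesis by (simp add: sum.reindex inj_on_def)
qed

end

section \<open>Existence of the Fourier transform\<close>

lemma norm_square_le_two: "(cmod x)\<^sup>2 \<le> 2 * (cmod (x - y))\<^sup>2 + 2 * (cmod y)\<^sup>2"
proof -
  have "cmod x \<le> cmod (x - y) + cmod y" using norm_triangle_ineq[of "x - y" y] by simp
  then have "(cmod x)\<^sup>2 \<le> (cmod (x - y) + cmod y)\<^sup>2" by (rule power_mono) simp
  also have "\<dots> \<le> 2 * (cmod (x - y))\<^sup>2 + 2 * (cmod y)\<^sup>2"
    using sum_squares_bound[of "cmod (x - y)" "cmod y"] by (simp add: power2_sum)
  finally show ?thesis .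
qed

definition trig_poly :: "(int ^ 'd::finite \<Rightarrow> complex) \<Rightarrow> (int ^ 'd) set \<Rightarrow> real ^ 'd \<Rightarrow> complex" where
  "trig_poly f S \<xi> = (\<Sum>n\<in>S. f n * exp (- 2 * pi * \<i> * phase n \<xi>))"

lemma exp_phase_eq_wave: "exp (- 2 * pi * \<i> * phase n \<xi>) = cnj (wave 0 n \<xi>)"
  unfolding wave_def cis_cnj unfolding cis_conv_exp by (simp add: mult_ac)

lemma trig_poly_measurable [measurable]: "trig_poly f S \<in> borel_measurable (lebesgue_on torus)"
  unfolding trig_poly_def exp_phase_eq_wave by measurable

lemma trig_poly_bounded: "cmod (trig_poly f S \<xi>) \<le> (\<Sum>n\<in>S. cmod (f n))"
  unfolding trig_poly_def exp_phase_eq_wave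
  by (rule order_trans[OF norm_sum]) (simp add: norm_mult)

lemma integrable_trig_poly_square: "integrable (lebesgue_on torus) (\<lambda>\<xi>. (cmod (trig_poly f S \<xi>))\<^sup>2)"
proof -
  interpret finite_measure "lebesgue_on torus" by (rule finite_measure_torus)
  show ?thesis
    by (rule integrable_const_bound[where B = "(\<Sum>n\<in>S. cmod (f n))\<^sup>2"])
       (auto intro!: power_mono trig_poly_bounded)
qed

lemma trig_poly_norm:
  assumes "finite S"
  shows "(LINT \<xi>|lebesgue_on torus. (cmod (trig_poly f S \<xi>))\<^sup>2) = (\<Sum>n\<in>S. (cmod (f n))\<^sup>2)"
proof -
  interpret finite_measure "lebesgue_on torus" by (rule finite_measure_torus)
  have i: "integrable (lebesgue_on torus) (\<lambda>\<xi>. wave 0 m \<xi> * cnj (wave 0 n \<xi>))" for n m :: "int ^ 'a"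
    by (rule integrable_const_bound[where B = 1]) (auto simp: norm_mult)
  have "complex_of_real (LINT \<xi>|lebesgue_on torus. (cmod (trig_poly f S \<xi>))\<^sup>2)
      = (LINT \<xi>|lebesgue_on torus. (\<Sum>n\<in>S. \<Sum>m\<in>S. (f n * cnj (f m)) * (wave 0 m \<xi> * cnj (wave 0 n \<xi>))))"
    unfolding integral_complex_of_real[symmetric] complex_norm_square trig_poly_def exp_phase_eq_wave
    by (intro Bochner_Integration.integral_cong refl) (simp add: sum_product mult_ac)
  also have "\<dots> = (\<Sum>n\<in>S. \<Sum>m\<in>S. (f n * cnj (f m)) * (if m = n then 1 else 0))"
    using i by (simp add: wave_orthonormal)
  also have "\<dots> = (\<Sum>n\<in>S. f n * cnj (f n))"
    using assms by (simp add: if_distrib sum.delta cong: if_cong)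
  also have "\<dots> = complex_of_real (\<Sum>n\<in>S. (cmod (f n))\<^sup>2)"
    by (simp only: complex_norm_square[symmetric] of_real_sum)
  finally show ?thesis using of_real_eq_iff by blast
qed

lemma trig_poly_diff_norm:
  assumes "finite S" "finite T"
  shows "(LINT \<xi>|lebesgue_on torus. (cmod (trig_poly f S \<xi> - trig_poly f T \<xi>))\<^sup>2) = (\<Sum>n\<in>(S - T) \<union> (T - S). (cmod (f n))\<^sup>2)"
    and "integrable (lebesgue_on torus) (\<lambda>\<xi>. (cmod (trig_poly f S \<xi> - trig_poly f T \<xi>))\<^sup>2)"
proof -
  define g where "g n = (if n \<in> S then f n else - f n)" for n
  have eq: "trig_poly f S \<xi> - trig_poly f T \<xi> = trig_poly g ((S - T) \<union> (T - S)) \<xi>" for \<xi>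
  proof -
    let ?e = "\<lambda>n. exp (- 2 * pi * \<i> * phase n \<xi>)"
    have "(\<Sum>n\<in>(S - T) \<union> (T - S). g n * ?e n) = (\<Sum>n\<in>S - T. g n * ?e n) + (\<Sum>n\<in>T - S. g n * ?e n)"
      using assms by (intro sum.union_disjoint) auto
    also have "(\<Sum>n\<in>S - T. g n * ?e n) = (\<Sum>n\<in>S - T. f n * ?e n)" by (intro sum.cong) (auto simp: g_def)
    also have "(\<Sum>n\<in>T - S. g n * ?e n) = - (\<Sum>n\<in>T - S. f n * ?e n)"
      unfolding sum_negf[symmetric] by (intro sum.cong) (auto simp: g_def)
    finally show ?thesis
      unfolding trig_poly_def using assms sum.Int_Diff[of S "\<lambda>n. f n * ?e n" T] sum.Int_Diff[of T "\<lambda>n. f n * ?e n" S]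
      by (simp add: Int_commute)
  qed
  have "(\<Sum>n\<in>(S - T) \<union> (T - S). (cmod (g n))\<^sup>2) = (\<Sum>n\<in>(S - T) \<union> (T - S). (cmod (f n))\<^sup>2)"
    by (intro sum.cong) (auto simp: g_def)
  then show "(LINT \<xi>|lebesgue_on torus. (cmod (trig_poly f S \<xi> - trig_poly f T \<xi>))\<^sup>2) = (\<Sum>n\<in>(S - T) \<union> (T - S). (cmod (f n))\<^sup>2)"
    unfolding eq using assms by (simp add: trig_poly_norm)
  show "integrable (lebesgue_on torus) (\<lambda>\<xi>. (cmod (trig_poly f S \<xi> - trig_poly f T \<xi>))\<^sup>2)"
    unfolding eq by (rule integrable_trig_poly_square)
qed

lemma summable_tail:
  fixes a :: "'i \<Rightarrow> real"
  assumes "a summable_on UNIV" "\<And>n. a n \<ge> 0" "\<epsilon> > 0"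
  obtains S where "finite S" "\<And>T. finite T \<Longrightarrow> T \<inter> S = {} \<Longrightarrow> sum a T \<le> \<epsilon>"
proof -
  have "(sum a \<longlongrightarrow> infsum a UNIV) (finite_subsets_at_top UNIV)"
    using has_sum_infsum[OF assms(1)] by (simp add: has_sum_def)
  then have "eventually (\<lambda>S. dist (sum a S) (infsum a UNIV) < \<epsilon>) (finite_subsets_at_top UNIV)"
    using assms(3) by (rule tendstoD)
  then obtain S where S: "finite S" "\<And>T. finite T \<Longrightarrow> S \<subseteq> T \<Longrightarrow> dist (sum a T) (infsum a UNIV) < \<epsilon>"
    unfolding eventually_finite_subsets_at_top by auto
  have "sum a T \<le> \<epsilon>" if T: "finite T" "T \<inter> S = {}" for T
  proof -
    have "sum a (T \<union> S) = sum a T + sum a S" using T S by (intro sum.union_disjoint) auto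
    moreover have "sum a (T \<union> S) \<le> infsum a UNIV"
      by (rule finite_sum_le_infsum) (use assms T S in auto)
    moreover have "\<bar>sum a S - infsum a UNIV\<bar> < \<epsilon>" using S(2)[OF S(1)] by (simp add: dist_real_def)
    ultimately show ?thesis by linarith
  qed
  then show ?thesis using that S(1) by blast
qed

text \<open>Riesz-Fischer. Along finite sets \<open>S k\<close> with tails below \<open>4\<^bsup>-k\<^esup>\<close>
  the increments of the partial sums have \<open>L\<^sup>2\<close> norm at most \<open>2\<^bsup>-k\<^esup>\<close>,
  hence summable \<open>L\<^sup>1\<close> norms, because the torus has finite measure. So the partial sums converge
  almost everywhere, and Fatou's lemma identifies the limit in \<open>L\<^sup>2\<close>.\<close>

lemma fourier_transform_exists:
  fixes f :: "int ^ 'd::finite \<Rightarrow> complex"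
  assumes f: "(\<lambda>n. (cmod (f n))\<^sup>2) summable_on UNIV"
  shows "\<exists>F. is_fourier_transform f F"
proof -
  interpret finite_measure "lebesgue_on (torus :: (real ^ 'd) set)" by (rule finite_measure_torus)
  let ?M = "lebesgue_on (torus :: (real ^ 'd) set)"
  define a where "a n = (cmod (f n))\<^sup>2" for n
  have "\<exists>S. finite S \<and> (\<forall>T. finite T \<longrightarrow> T \<inter> S = {} \<longrightarrow> sum a T \<le> (1/4) ^ k)" for k
    by (rule summable_tail[of a "(1/4) ^ k"]) (use f in \<open>auto simp: a_def[abs_def]\<close>)
  then obtain R where R: "\<And>k. finite (R k)" "\<And>k T. finite T \<Longrightarrow> T \<inter> R k = {} \<Longrightarrow> sum a T \<le> (1/4) ^ k"
    by metis
  \<comment> \<open>Unions make the exhausting sets increase.\<close>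
  define S where "S k = (\<Union>i\<le>k. R i)" for k
  have S: "finite (S k)" "R k \<subseteq> S k" "j \<le> k \<Longrightarrow> S j \<subseteq> S k" for j k
  proof -
    show "finite (S k)" "R k \<subseteq> S k" using R(1) by (auto simp: S_def)
    show "S j \<subseteq> S k" if "j \<le> k" unfolding S_def by (rule UN_mono) (use that in auto)
  qed
  define P where "P k = trig_poly f (S k)" for k
  have Pm [measurable]: "P k \<in> borel_measurable ?M" for k unfolding P_def by measurable
  define N where "N = (LINT \<xi>|?M. (cmod 1)\<^sup>2)"
  have step: "(LINT \<xi>|?M. cmod (P (Suc k) \<xi> - P k \<xi>)) \<le> sqrt N * (1/2) ^ k"
    "integrable ?M (\<lambda>\<xi>. cmod (P (Suc k) \<xi> - P k \<xi>))" for k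
  proof -
    have e: "(LINT \<xi>|?M. (cmod (P (Suc k) \<xi> - P k \<xi>))\<^sup>2) \<le> (1/4) ^ k"
      unfolding P_def trig_poly_diff_norm(1)[OF S(1) S(1)] a_def[symmetric]
      by (rule R(2)) (use S(1) S(2)[of k] S(3)[of k "Suc k"] in auto)
    define h where "h \<xi> = complex_of_real (cmod (P (Suc k) \<xi> - P k \<xi>))" for \<xi>
    have [measurable]: "h \<in> borel_measurable ?M" unfolding h_def by measurable
    have h: "integrable ?M (\<lambda>\<xi>. (cmod (h \<xi>))\<^sup>2)"
      unfolding h_def P_def using trig_poly_diff_norm(2)[OF S(1) S(1)] by simp
    note cs = integral_Cauchy_Schwarz[of "\<lambda>_. 1" ?M h, OF _ _ _ h]
    have "integrable ?M (\<lambda>\<xi>. 1 * h \<xi>)" by (rule cs(1)) auto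
    then show i: "integrable ?M (\<lambda>\<xi>. cmod (P (Suc k) \<xi> - P k \<xi>))"
      unfolding h_def by (simp add: complex_of_real_integrable_eq)
    have "sqrt (LINT \<xi>|?M. (cmod (h \<xi>))\<^sup>2) \<le> sqrt ((1/4) ^ k)"
      using e by (intro real_sqrt_le_mono) (simp add: h_def)
    also have "sqrt ((1/4) ^ k) = (1/2) ^ k"
    proof -
      have "((1/2 :: real) ^ k)\<^sup>2 = ((1/2)\<^sup>2) ^ k" by (simp only: power_mult[symmetric] mult.commute)
      then have "(1/4 :: real) ^ k = ((1/2) ^ k)\<^sup>2" by (simp add: power2_eq_square)
      then show ?thesis by simp
    qed
    finally have sq: "sqrt (LINT \<xi>|?M. (cmod (h \<xi>))\<^sup>2) \<le> (1/2) ^ k" .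
    have "(LINT \<xi>|?M. cmod (P (Suc k) \<xi> - P k \<xi>)) = cmod (LINT \<xi>|?M. 1 * h \<xi>)"
      unfolding h_def by (simp add: integral_complex_of_real)
    also have "\<dots> \<le> sqrt N * sqrt (LINT \<xi>|?M. (cmod (h \<xi>))\<^sup>2)"
      unfolding N_def by (rule cs(2)) auto
    also have "\<dots> \<le> sqrt N * (1/2) ^ k"
      by (rule mult_left_mono[OF sq]) (simp add: N_def)
    finally show "(LINT \<xi>|?M. cmod (P (Suc k) \<xi> - P k \<xi>)) \<le> sqrt N * (1/2) ^ k" .
  qed
  have AEc: "AE \<xi> in ?M. convergent (\<lambda>k. P k \<xi>)"
  proof -
    have "(\<integral>\<^sup>+\<xi>. (\<Sum>k. ennreal (cmod (P (Suc k) \<xi> - P k \<xi>))) \<partial>?M) = (\<Sum>k. \<integral>\<^sup>+\<xi>. ennreal (cmod (P (Suc k) \<xi> - P k \<xi>)) \<partial>?M)"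
      by (rule nn_integral_suminf) measurable
    also have "\<dots> \<le> (\<Sum>k. ennreal (sqrt N * (1/2) ^ k))"
    proof (intro suminf_le)
      fix k
      have "(\<integral>\<^sup>+\<xi>. ennreal (cmod (P (Suc k) \<xi> - P k \<xi>)) \<partial>?M) = ennreal (LINT \<xi>|?M. cmod (P (Suc k) \<xi> - P k \<xi>))"
        by (rule nn_integral_eq_integral[OF step(2)]) simp
      then show "(\<integral>\<^sup>+\<xi>. ennreal (cmod (P (Suc k) \<xi> - P k \<xi>)) \<partial>?M) \<le> ennreal (sqrt N * (1/2) ^ k)"
        using step(1)[of k] by (simp add: ennreal_leI)
    qed auto
    also have "\<dots> = ennreal (\<Sum>k. sqrt N * (1/2) ^ k)"
      by (rule suminf_ennreal2) (auto simp: N_def intro!: summable_mult summable_geometric)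
    also have "\<dots> < \<infinity>" by simp
    finally have "AE \<xi> in ?M. (\<Sum>k. ennreal (cmod (P (Suc k) \<xi> - P k \<xi>))) \<noteq> \<infinity>"
      by (intro nn_integral_noteq_infinite) (auto simp: less_top)
    then show ?thesis
    proof eventually_elim
      case (elim \<xi>)
      then have "summable (\<lambda>k. cmod (P (Suc k) \<xi> - P k \<xi>))" by (intro summable_suminf_not_top) auto
      then have "summable (\<lambda>k. P (Suc k) \<xi> - P k \<xi>)" by (rule summable_norm_cancel)
      then have "convergent (\<lambda>n. \<Sum>k<n. P (Suc k) \<xi> - P k \<xi>)" by (simp add: summable_iff_convergent)
      then have "convergent (\<lambda>n. P n \<xi> - P 0 \<xi>)" by (simp add: sum_lessThan_telescope[of "\<lambda>k. P k \<xi>"])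
      then have "convergent (\<lambda>n. (P n \<xi> - P 0 \<xi>) + P 0 \<xi>)"
        by (intro convergent_add convergent_const)
      then show ?case by simp
    qed
  qed
  define F where "F \<xi> = lim (\<lambda>k. P k \<xi>)" for \<xi>
  have Fm [measurable]: "F \<in> borel_measurable ?M" unfolding F_def by measurable
  have lim: "AE \<xi> in ?M. (\<lambda>k. P k \<xi>) \<longlonglongrightarrow> F \<xi>"
    using AEc by eventually_elim (simp add: F_def convergent_LIMSEQ_iff)
  have main: "integrable ?M (\<lambda>\<xi>. (cmod (F \<xi> - trig_poly f T \<xi>))\<^sup>2)"
    "(LINT \<xi>|?M. (cmod (F \<xi> - trig_poly f T \<xi>))\<^sup>2) \<le> (1/4) ^ k" if T: "finite T" "S k \<subseteq> T" for T k
  proof -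
    have "(\<integral>\<^sup>+\<xi>. ennreal ((cmod (F \<xi> - trig_poly f T \<xi>))\<^sup>2) \<partial>?M)
       = (\<integral>\<^sup>+\<xi>. liminf (\<lambda>j. ennreal ((cmod (P j \<xi> - trig_poly f T \<xi>))\<^sup>2)) \<partial>?M)"
    proof (rule nn_integral_cong_AE)
      show "AE \<xi> in ?M. ennreal ((cmod (F \<xi> - trig_poly f T \<xi>))\<^sup>2) = liminf (\<lambda>j. ennreal ((cmod (P j \<xi> - trig_poly f T \<xi>))\<^sup>2))"
        using lim
      proof eventually_elim
        case (elim \<xi>)
        then have "(\<lambda>j. ennreal ((cmod (P j \<xi> - trig_poly f T \<xi>))\<^sup>2)) \<longlonglongrightarrow> ennreal ((cmod (F \<xi> - trig_poly f T \<xi>))\<^sup>2)"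
          by (intro tendsto_ennrealI tendsto_intros)
        then show ?case using lim_imp_Liminf[OF sequentially_bot] by metis
      qed
    qed
    also have "\<dots> \<le> liminf (\<lambda>j. \<integral>\<^sup>+\<xi>. ennreal ((cmod (P j \<xi> - trig_poly f T \<xi>))\<^sup>2) \<partial>?M)"
      by (rule nn_integral_liminf) measurable
    also have "\<dots> \<le> liminf (\<lambda>j. ennreal ((1/4) ^ k))"
    proof (rule Liminf_mono)
      show "\<forall>\<^sub>F j in sequentially. (\<integral>\<^sup>+\<xi>. ennreal ((cmod (P j \<xi> - trig_poly f T \<xi>))\<^sup>2) \<partial>?M) \<le> ennreal ((1/4) ^ k)"
      proof (rule eventually_sequentiallyI[of k])
        fix j assume j: "k \<le> j"
        have "(\<integral>\<^sup>+\<xi>. ennreal ((cmod (P j \<xi> - trig_poly f T \<xi>))\<^sup>2) \<partial>?M)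
          = ennreal (LINT \<xi>|?M. (cmod (P j \<xi> - trig_poly f T \<xi>))\<^sup>2)"
          unfolding P_def by (rule nn_integral_eq_integral[OF trig_poly_diff_norm(2)[OF S(1) T(1)]]) simp
        also have "(LINT \<xi>|?M. (cmod (P j \<xi> - trig_poly f T \<xi>))\<^sup>2) \<le> (1/4) ^ k"
          unfolding P_def trig_poly_diff_norm(1)[OF S(1) T(1)] a_def[symmetric]
          by (rule R(2)) (use S(1)[of j] S(2)[of k] S(3)[OF j] T in auto)
        finally show "(\<integral>\<^sup>+\<xi>. ennreal ((cmod (P j \<xi> - trig_poly f T \<xi>))\<^sup>2) \<partial>?M) \<le> ennreal ((1/4) ^ k)"
          by (simp add: ennreal_leI)
      qed
    qed
    also have "\<dots> = ennreal ((1/4) ^ k)" by (simp add: Liminf_const)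
    finally have le: "(\<integral>\<^sup>+\<xi>. ennreal ((cmod (F \<xi> - trig_poly f T \<xi>))\<^sup>2) \<partial>?M) \<le> ennreal ((1/4) ^ k)" .
    show i: "integrable ?M (\<lambda>\<xi>. (cmod (F \<xi> - trig_poly f T \<xi>))\<^sup>2)"
      by (rule integrableI_bounded) (use le in \<open>auto intro: le_less_trans\<close>)
    show "(LINT \<xi>|?M. (cmod (F \<xi> - trig_poly f T \<xi>))\<^sup>2) \<le> (1/4) ^ k"
      using le unfolding nn_integral_eq_integral[OF i AE_I2[OF zero_le_power2]] by (simp add: ennreal_le_iff)
  qed
  have FL2: "F \<in> L2_torus"
  proof -
    have "integrable ?M (\<lambda>\<xi>. (cmod (F \<xi>))\<^sup>2)"
    proof (rule Bochner_Integration.integrable_bound)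
      show "integrable ?M (\<lambda>\<xi>. 2 * (cmod (F \<xi> - trig_poly f (S 0) \<xi>))\<^sup>2 + 2 * (cmod (trig_poly f (S 0) \<xi>))\<^sup>2)"
        by (intro Bochner_Integration.integrable_add Bochner_Integration.integrable_mult_right
            main(1)[OF S(1) order_refl] integrable_trig_poly_square)
      show "AE \<xi> in ?M. norm ((cmod (F \<xi>))\<^sup>2) \<le> norm (2 * (cmod (F \<xi> - trig_poly f (S 0) \<xi>))\<^sup>2 + 2 * (cmod (trig_poly f (S 0) \<xi>))\<^sup>2)"
        using norm_square_le_two by (intro AE_I2) auto
    qed measurable
    then show ?thesis by (simp add: L2_torus_def)
  qed
  moreover have "((\<lambda>T. LINT \<xi>|?M. (cmod (F \<xi> - trig_poly f T \<xi>))\<^sup>2) \<longlongrightarrow> 0) (finite_subsets_at_top UNIV)"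
  proof (rule tendstoI)
    fix \<epsilon> :: real assume "\<epsilon> > 0"
    then obtain k where k: "(1/4 :: real) ^ k < \<epsilon>" using real_arch_pow_inv[of \<epsilon> "1/4"] by auto
    show "\<forall>\<^sub>F T in finite_subsets_at_top UNIV. dist (LINT \<xi>|?M. (cmod (F \<xi> - trig_poly f T \<xi>))\<^sup>2) 0 < \<epsilon>"
      unfolding eventually_finite_subsets_at_top
    proof (intro exI[of _ "S k"] conjI allI impI)
      fix T assume T: "finite T \<and> S k \<subseteq> T \<and> T \<subseteq> UNIV"
      then have "(LINT \<xi>|?M. (cmod (F \<xi> - trig_poly f T \<xi>))\<^sup>2) \<le> (1/4) ^ k" by (intro main(2)) auto
      moreover have "0 \<le> (LINT \<xi>|?M. (cmod (F \<xi> - trig_poly f T \<xi>))\<^sup>2)" by simp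
      ultimately show "dist (LINT \<xi>|?M. (cmod (F \<xi> - trig_poly f T \<xi>))\<^sup>2) 0 < \<epsilon>"
        using k by (simp add: dist_real_def)
    qed (use S in auto)
  qed
  ultimately show ?thesis unfolding is_fourier_transform_def trig_poly_def by blast
qed

text \<open>Half of Plancherel's theorem up to the factor 2, which is harmless here and lets the triangle inequality
  replace a passage to the limit in the norms.\<close>

lemma fourier_transform_norm:
  fixes f :: "int ^ 'd::finite \<Rightarrow> complex"
  assumes f: "(\<lambda>n. (cmod (f n))\<^sup>2) summable_on UNIV" and F: "is_fourier_transform f F"
  shows "(LINT \<xi>|lebesgue_on torus. (cmod (F \<xi>))\<^sup>2) \<le> 2 * (\<Sum>\<^sub>\<infinity>n. (cmod (f n))\<^sup>2)"
proof -
  interpret finite_measure "lebesgue_on (torus :: (real ^ 'd) set)" by (rule finite_measure_torus)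
  let ?M = "lebesgue_on (torus :: (real ^ 'd) set)"
  have Fm [measurable]: "F \<in> borel_measurable ?M" and Fi: "integrable ?M (\<lambda>\<xi>. (cmod (F \<xi>))\<^sup>2)"
    and lim: "((\<lambda>S. LINT \<xi>|?M. (cmod (F \<xi> - trig_poly f S \<xi>))\<^sup>2) \<longlongrightarrow> 0) (finite_subsets_at_top UNIV)"
    using F by (auto simp: is_fourier_transform_def L2_torus_def trig_poly_def)
  define I where "I S = (LINT \<xi>|?M. (cmod (F \<xi> - trig_poly f S \<xi>))\<^sup>2)" for S
  define Q where "Q = (\<Sum>\<^sub>\<infinity>n. (cmod (f n))\<^sup>2)"
  have "((\<lambda>S. 2 * I S + 2 * Q) \<longlongrightarrow> 2 * 0 + 2 * Q) (finite_subsets_at_top UNIV)"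
    unfolding I_def by (intro tendsto_intros lim)
  moreover have "\<forall>\<^sub>F S in finite_subsets_at_top UNIV. (LINT \<xi>|?M. (cmod (F \<xi>))\<^sup>2) \<le> 2 * I S + 2 * Q"
  proof (rule eventually_finite_subsets_at_top_weakI)
    fix S :: "(int ^ 'd) set" assume S: "finite S"
    have two: "(cmod (x - y))\<^sup>2 \<le> 2 * (cmod x)\<^sup>2 + 2 * (cmod y)\<^sup>2" for x y
      using norm_square_le_two[of "x - y" "- y"] by simp
    have d: "integrable ?M (\<lambda>\<xi>. (cmod (F \<xi> - trig_poly f S \<xi>))\<^sup>2)"
    proof (rule Bochner_Integration.integrable_bound)
      show "integrable ?M (\<lambda>\<xi>. 2 * (cmod (F \<xi>))\<^sup>2 + 2 * (cmod (trig_poly f S \<xi>))\<^sup>2)"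
        by (intro Bochner_Integration.integrable_add Bochner_Integration.integrable_mult_right Fi integrable_trig_poly_square)
      show "AE \<xi> in ?M. norm ((cmod (F \<xi> - trig_poly f S \<xi>))\<^sup>2) \<le> norm (2 * (cmod (F \<xi>))\<^sup>2 + 2 * (cmod (trig_poly f S \<xi>))\<^sup>2)"
        using two by (intro AE_I2) auto
    qed measurable
    have "(LINT \<xi>|?M. (cmod (F \<xi>))\<^sup>2) \<le> (LINT \<xi>|?M. 2 * (cmod (F \<xi> - trig_poly f S \<xi>))\<^sup>2 + 2 * (cmod (trig_poly f S \<xi>))\<^sup>2)"
      by (intro integral_mono norm_square_le_two Bochner_Integration.integrable_add
          Bochner_Integration.integrable_mult_right Fi d integrable_trig_poly_square)
    also have "\<dots> = (LINT \<xi>|?M. 2 * (cmod (F \<xi> - trig_poly f S \<xi>))\<^sup>2) + (LINT \<xi>|?M. 2 * (cmod (trig_poly f S \<xi>))\<^sup>2)"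
      by (intro Bochner_Integration.integral_add Bochner_Integration.integrable_mult_right d integrable_trig_poly_square)
    also have "\<dots> = 2 * I S + 2 * (\<Sum>n\<in>S. (cmod (f n))\<^sup>2)"
      by (simp add: I_def trig_poly_norm S)
    also have "(\<Sum>n\<in>S. (cmod (f n))\<^sup>2) \<le> Q"
      unfolding Q_def by (rule finite_sum_le_infsum) (use f S in auto)
    finally show "(LINT \<xi>|?M. (cmod (F \<xi>))\<^sup>2) \<le> 2 * I S + 2 * Q" by simp
  qed
  ultimately show ?thesis
    using tendsto_lowerbound[of "\<lambda>S. 2 * I S + 2 * Q" "2 * 0 + 2 * Q" "finite_subsets_at_top UNIV"] by (simp add: Q_def)
qed

section \<open>From discrete to continuous time\<close>

text \<open>The real line is tiled by integer translates of \<open>[0, 1)\<close>. Truncating the series and the line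
  simultaneously leaves finite sums only, and monotone convergence removes the truncation.\<close>

lemma nn_integral_le_of_unit_shifts:
  fixes g :: "nat \<Rightarrow> real \<Rightarrow> ennreal"
  assumes [measurable]: "\<And>i. g i \<in> borel_measurable borel"
    and K: "\<And>s N. 0 \<le> s \<Longrightarrow> s < 1 \<Longrightarrow> (\<Sum>k\<in>{- int N..<int N}. \<Sum>i<N. g i (s + of_int k)) \<le> K"
  shows "(\<integral>\<^sup>+t. (\<Sum>i. g i t) \<partial>lborel) \<le> K"
proof -
  define H where "H N t = (\<Sum>i<N. g i t) * indicator {- real N..<real N} t" for N t
  have Hm: "H N \<in> borel_measurable lborel" for N unfolding H_def by measurable
  have inc: "incseq H"
  proof (intro incseq_SucI le_funI)
    fix N t
    have "(\<Sum>i<N. g i t) \<le> (\<Sum>i<Suc N. g i t)" by simp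
    moreover have "indicator {- real N..<real N} t \<le> (indicator {- real (Suc N)..<real (Suc N)} t :: ennreal)"
      by (auto simp: indicator_def)
    ultimately show "H N t \<le> H (Suc N) t" unfolding H_def by (rule mult_mono) auto
  qed
  have "(\<lambda>N. H N t) \<longlonglongrightarrow> (\<Sum>i. g i t)" for t
  proof (rule Lim_transform_eventually)
    show "(\<lambda>N. \<Sum>i<N. g i t) \<longlonglongrightarrow> (\<Sum>i. g i t)" by (rule summable_LIMSEQ) auto
    obtain n0 :: nat where "\<bar>t\<bar> < real n0" using reals_Archimedean2 by blast
    then show "\<forall>\<^sub>F N in sequentially. (\<Sum>i<N. g i t) = H N t"
      by (intro eventually_sequentiallyI[of n0]) (auto simp: H_def indicator_def)
  qed
  then have "(\<lambda>N. \<integral>\<^sup>+t. H N t \<partial>lborel) \<longlonglongrightarrow> (\<integral>\<^sup>+t. (\<Sum>i. g i t) \<partial>lborel)"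
    by (intro nn_integral_LIMSEQ[OF inc Hm])
  moreover have "(\<integral>\<^sup>+t. H N t \<partial>lborel) \<le> K" for N
  proof -
    define h where "h t = (\<Sum>i<N. g i t)" for t
    have [measurable]: "h \<in> borel_measurable borel" unfolding h_def by measurable
    have ind: "indicator {- real N..<real N} t = (\<Sum>k\<in>{- int N..<int N}. indicator {of_int k..<of_int k + 1} t :: ennreal)" for t
    proof -
      have "(\<Sum>k\<in>{- int N..<int N}. indicator {of_int k..<of_int k + 1} t :: ennreal)
         = (\<Sum>k\<in>{- int N..<int N}. if k = \<lfloor>t\<rfloor> then 1 else 0)"
        by (intro sum.cong refl) (auto simp: indicator_def floor_unique)
      also have "\<dots> = (if \<lfloor>t\<rfloor> \<in> {- int N..<int N} then 1 else 0)" by simp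
      also have "\<lfloor>t\<rfloor> \<in> {- int N..<int N} \<longleftrightarrow> t \<in> {- real N..<real N}"
        by (auto simp: le_floor_iff floor_less_iff)
      finally show ?thesis by (simp add: indicator_def)
    qed
    have "(\<integral>\<^sup>+t. H N t \<partial>lborel) = (\<integral>\<^sup>+t. (\<Sum>k\<in>{- int N..<int N}. h t * indicator {of_int k..<of_int k + 1} t) \<partial>lborel)"
      unfolding H_def h_def[symmetric] ind sum_distrib_left ..
    also have "\<dots> = (\<Sum>k\<in>{- int N..<int N}. \<integral>\<^sup>+t. h t * indicator {of_int k..<of_int k + 1} t \<partial>lborel)"
      by (rule nn_integral_sum) measurable
    also have "\<dots> = (\<Sum>k\<in>{- int N..<int N}. \<integral>\<^sup>+s. h (s + of_int k) * indicator {0..<1} s \<partial>lborel)"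
    proof (intro sum.cong refl)
      fix k :: int
      have "(\<integral>\<^sup>+t. h t * indicator {of_int k..<of_int k + 1} t \<partial>lborel)
        = (\<integral>\<^sup>+s. h (of_int k + 1 * s) * indicator {of_int k..<of_int k + 1} (of_int k + 1 * s) \<partial>lborel)"
        by (subst nn_integral_real_affine[where c = 1 and t = "of_int k"]) auto
      also have "\<dots> = (\<integral>\<^sup>+s. h (s + of_int k) * indicator {0..<1} s \<partial>lborel)"
        by (intro nn_integral_cong) (auto simp: indicator_def add.commute)
      finally show "(\<integral>\<^sup>+t. h t * indicator {of_int k..<of_int k + 1} t \<partial>lborel) = \<dots>" .
    qed
    also have "\<dots> = (\<integral>\<^sup>+s. (\<Sum>k\<in>{- int N..<int N}. h (s + of_int k) * indicator {0..<1} s) \<partial>lborel)"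
      by (rule nn_integral_sum[symmetric]) measurable
    also have "\<dots> \<le> (\<integral>\<^sup>+s. K * indicator {0..<1::real} s \<partial>lborel)"
    proof (rule nn_integral_mono)
      fix s :: real
      show "(\<Sum>k\<in>{- int N..<int N}. h (s + of_int k) * indicator {0..<1} s) \<le> K * indicator {0..<1} s"
        using K[of s N] by (auto simp: h_def indicator_def)
    qed
    also have "\<dots> = K" by (subst nn_integral_cmult_indicator) auto
    finally show ?thesis .
  qed
  ultimately show ?thesis by (intro LIMSEQ_le_const2) auto
qed

lemma propagator_eq_integral_wave:
  "propagator t f n = (LINT \<xi>|lebesgue_on torus. fourier f \<xi> * wave t n \<xi>)"
proof -
  have "exp (- \<i> * t * laplacian_symbol \<xi>) * fourier f \<xi> * exp (2 * pi * \<i> * phase n \<xi>) = fourier f \<xi> * wave t n \<xi>" for \<xi>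
  proof -
    have "wave t n \<xi> = exp (\<i> * (2 * pi * phase n \<xi>)) * exp (- \<i> * t * laplacian_symbol \<xi>)"
      unfolding wave_def cis_conv_exp exp_add[symmetric] by (simp add: algebra_simps)
    then show ?thesis by (simp add: mult_ac)
  qed
  then show ?thesis
    unfolding propagator_def laplacian_calculus_def fourier_multiplier_def inverse_fourier_def by (simp only:)
qed

lemma integrable_of_L2_torus:
  assumes "F \<in> L2_torus"
  shows "integrable (lebesgue_on torus) F"
proof -
  interpret finite_measure "lebesgue_on torus" by (rule finite_measure_torus)
  have "integrable (lebesgue_on torus) (\<lambda>\<xi>. 1 * F \<xi>)"
    by (rule integral_Cauchy_Schwarz(1)) (use assms in \<open>auto simp: L2_torus_def\<close>)
  then show ?thesis by simp
qed

lemma continuous_on_evolution: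
  assumes F: "F \<in> L2_torus"
  shows "continuous_on UNIV (\<lambda>t. LINT \<xi>|lebesgue_on torus. F \<xi> * wave t n \<xi>)"
  unfolding continuous_on_sequentially
proof (intro allI ballI impI)
  fix x :: "nat \<Rightarrow> real" and a assume "(\<forall>n. x n \<in> UNIV) \<and> x \<longlonglongrightarrow> a"
  then have x: "x \<longlonglongrightarrow> a" by simp
  have [measurable]: "F \<in> borel_measurable (lebesgue_on torus)" using F by (simp add: L2_torus_def)
  have "(\<lambda>i. LINT \<xi>|lebesgue_on torus. F \<xi> * wave (x i) n \<xi>) \<longlonglongrightarrow> (LINT \<xi>|lebesgue_on torus. F \<xi> * wave a n \<xi>)"
  proof (rule integral_dominated_convergence[where w = "\<lambda>\<xi>. cmod (F \<xi>)"])
    show "integrable (lebesgue_on torus) (\<lambda>\<xi>. cmod (F \<xi>))"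
      using integrable_of_L2_torus[OF F] by simp
    show "AE \<xi> in lebesgue_on torus. (\<lambda>i. F \<xi> * wave (x i) n \<xi>) \<longlonglongrightarrow> F \<xi> * wave a n \<xi>"
      unfolding wave_def by (intro AE_I2 tendsto_intros x)
  qed (auto simp: norm_mult)
  then show "((\<lambda>t. LINT \<xi>|lebesgue_on torus. F \<xi> * wave t n \<xi>) \<circ> x) \<longlonglongrightarrow> (LINT \<xi>|lebesgue_on torus. F \<xi> * wave a n \<xi>)"
    by (simp add: comp_def)
qed

lemma lp_norm_2_square:
  assumes "f \<in> lp_space 2"
  shows "(\<lambda>n. (cmod (f n))\<^sup>2) summable_on UNIV" "(lp_norm 2 f)\<^sup>2 = (\<Sum>\<^sub>\<infinity>n. (cmod (f n))\<^sup>2)"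
proof -
  show "(\<lambda>n. (cmod (f n))\<^sup>2) summable_on UNIV" using assms by (simp add: lp_space_def)
  have "0 \<le> (\<Sum>\<^sub>\<infinity>n. (cmod (f n))\<^sup>2)" by (rule infsum_nonneg) simp
  then show "(lp_norm 2 f)\<^sup>2 = (\<Sum>\<^sub>\<infinity>n. (cmod (f n))\<^sup>2)" by (simp add: lp_norm_def powr_half_sqrt)
qed

text \<open>The spaces increase with the exponent because every value is bounded by the norm. This reduces all
  exponents \<open>r\<close> to those of the form \<open>2 (1 + \<beta>)\<close>.\<close>

lemma lp_embedding:
  fixes W :: "int ^ 'd::finite \<Rightarrow> complex"
  assumes W: "W \<in> lp_space r" and r: "0 < r" "r \<le> \<rho>" and E: "finite E"
  shows "(\<Sum>n\<in>E. cmod (W n) powr \<rho>) \<le> (\<Sum>\<^sub>\<infinity>n. cmod (W n) powr r) powr (\<rho> / r)"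
    and "cmod (W n) powr r \<le> (\<Sum>\<^sub>\<infinity>n. cmod (W n) powr r)"
proof -
  define A where "A = (\<Sum>\<^sub>\<infinity>n. cmod (W n) powr r)"
  have fin: "(\<Sum>n\<in>T. cmod (W n) powr r) \<le> A" if "finite T" for T
    unfolding A_def by (rule finite_sum_le_infsum) (use W that in \<open>auto simp: lp_space_def\<close>)
  show pt: "cmod (W n) powr r \<le> (\<Sum>\<^sub>\<infinity>n. cmod (W n) powr r)" for n using fin[of "{n}"] by (simp add: A_def)
  have A0: "A \<ge> 0" using fin[of "{}"] by simp
  define q where "q = \<rho> / r - 1"
  have q: "q \<ge> 0" "\<rho> = r * (1 + q)" "\<rho> / r = 1 + q" using r by (auto simp: q_def field_simps)
  have "(\<Sum>n\<in>E. cmod (W n) powr \<rho>) \<le> (\<Sum>n\<in>E. cmod (W n) powr r * A powr q)"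
  proof (rule sum_mono)
    fix n
    have "cmod (W n) powr \<rho> = cmod (W n) powr r * (cmod (W n) powr r) powr q"
      unfolding q(2) powr_powr powr_add[symmetric] by (simp add: algebra_simps)
    also have "\<dots> \<le> cmod (W n) powr r * A powr q"
      using pt[of n] q(1) by (intro mult_left_mono powr_mono2) (auto simp: A_def)
    finally show "cmod (W n) powr \<rho> \<le> cmod (W n) powr r * A powr q" .
  qed
  also have "\<dots> = (\<Sum>n\<in>E. cmod (W n) powr r) * A powr q" by (simp add: sum_distrib_right)
  also have "\<dots> \<le> A * A powr q" by (intro mult_right_mono fin E) auto
  also have "\<dots> = A powr (\<rho> / r)" unfolding q(3) powr_add using A0 by simp
  finally show "(\<Sum>n\<in>E. cmod (W n) powr \<rho>) \<le> (\<Sum>\<^sub>\<infinity>n. cmod (W n) powr r) powr (\<rho> / r)" by (simp add: A_def)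
qed

text \<open>For \<open>d \<ge> 5\<close> the choice \<open>\<beta> = (d - 1) / 3\<close> makes \<open>2 (1 +
  \<beta>)\<close> equal to \<open>2 (d + 2) / 3\<close>. For \<open>d = 4\<close> the condition \<open>r < 4\<close>
  leaves room for some \<open>\<beta> < 1\<close>; the maximum with 3 keeps \<open>\<beta>\<close> positive for small
  \<open>r\<close>.\<close>

lemma admissible_exponent:
  fixes r :: real and d :: nat
  assumes "(d = 4 \<and> 1 \<le> r \<and> r < 4) \<or> (d \<ge> 5 \<and> 1 \<le> r \<and> r \<le> 2 * (real d + 2) / 3)"
  shows "\<exists>\<beta> B. \<beta> > 0 \<and> r \<le> 2 * (1 + \<beta>) \<and>
    (\<forall>m S. finite S \<longrightarrow> 0 \<notin> S \<longrightarrow> (\<Sum>k\<in>S. real k powr \<beta> * cmod (propagator_kernel_1d m (real k)) ^ d) \<le> B)"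
proof (cases "d = 4")
  case True
  define \<beta> where "\<beta> = max r 3 / 2 - 1"
  have \<beta>: "\<beta> < 1" "\<beta> > 0" "r \<le> 2 * (1 + \<beta>)" using assms True by (auto simp: \<beta>_def max_def)
  then show ?thesis using kernel_moment_dim4[OF \<beta>(1)] True by blast
next
  case False
  then have d: "d \<ge> 5" "r \<le> 2 * (real d + 2) / 3" using assms by auto
  then have "(real d - 1) / 3 > 0" "r \<le> 2 * (1 + (real d - 1) / 3)" by (simp_all add: field_simps)
  then show ?thesis using kernel_moment_dim_ge5[OF d(1)] by blast
qed

lemma dispersive_system_torus:
  fixes \<beta> B :: real
  assumes \<beta>: "\<beta> > 0"
    and B: "\<And>m S. finite S \<Longrightarrow> 0 \<notin> S \<Longrightarrow>
      (\<Sum>k\<in>S. real k powr \<beta> * cmod (propagator_kernel_1d m (real k)) ^ CARD('d::finite)) \<le> B"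
  shows "dispersive_system (lebesgue_on torus) (\<lambda>k n. wave (of_int k) (n :: int ^ 'd)) (2 * real CARD('d) * B) \<beta>"
proof -
  interpret finite_measure "lebesgue_on (torus :: (real ^ 'd) set)" by (rule finite_measure_torus)
  show ?thesis
    by standard (use \<beta> in \<open>auto simp: wave_orthonormal intro!: wave_decay[OF \<beta> B]\<close>)
qed

theorem proposition2p2:
  fixes r :: real
  assumes "(CARD('d::finite) = 4 \<and> 1 \<le> r \<and> r < 4) \<or>
           (CARD('d) \<ge> 5 \<and> 1 \<le> r \<and> r \<le> 2 * (real CARD('d) + 2) / 3)"
  shows "\<exists>C::real. \<forall>W \<in> lp_space r. \<forall>f \<in> lp_space 2.
           (\<forall>t. mult_op W (propagator t f) \<in> lp_space 2) \<and>
           integrable lborel (\<lambda>t. (lp_norm 2 (mult_op W (propagator t f)))\<^sup>2) \<and>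
           (LINT t|lborel. (lp_norm 2 (mult_op W (propagator t f)))\<^sup>2)
             \<le> C * (lp_norm r W)\<^sup>2 * (lp_norm 2 (f :: int ^ 'd \<Rightarrow> complex))\<^sup>2"
proof -
  have r: "r > 0" using assms by auto
  obtain \<beta> B where \<beta>: "\<beta> > 0" "r \<le> 2 * (1 + \<beta>)"
    and B0: "\<forall>m S. finite S \<longrightarrow> 0 \<notin> S \<longrightarrow>
      (\<Sum>k\<in>S. real k powr \<beta> * cmod (propagator_kernel_1d m (real k)) ^ CARD('d)) \<le> B"
    using admissible_exponent[OF assms] by blast
  note B = B0[rule_format]
  let ?M = "lebesgue_on (torus :: (real ^ 'd) set)"
  interpret dispersive_system ?M "\<lambda>k n. wave (of_int k) (n :: int ^ 'd)" "2 * real CARD('d) * B" \<beta>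
    by (rule dispersive_system_torus[OF \<beta>(1) B])
  show ?thesis
  proof (intro exI[of _ "smoothing_constant * 2"] ballI)
    fix W f :: "int ^ 'd \<Rightarrow> complex" assume W: "W \<in> lp_space r" and f: "f \<in> lp_space 2"
    define F where "F = fourier f"
    have "is_fourier_transform f F"
      unfolding F_def fourier_def by (rule someI_ex[OF fourier_transform_exists[OF lp_norm_2_square(1)[OF f]]])
    then have FL2: "F \<in> L2_torus" and FN: "(LINT \<xi>|?M. (cmod (F \<xi>))\<^sup>2) \<le> 2 * (lp_norm 2 f)\<^sup>2"
      using fourier_transform_norm[OF lp_norm_2_square(1)[OF f]] lp_norm_2_square(2)[OF f]
      by (auto simp: is_fourier_transform_def)
    define N where "N = (LINT \<xi>|?M. (cmod (F \<xi>))\<^sup>2)"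
    have N0: "N \<ge> 0" by (simp add: N_def)
    have [measurable]: "F \<in> borel_measurable ?M" and Fi: "integrable ?M (\<lambda>\<xi>. (cmod (F \<xi>))\<^sup>2)"
      using FL2 by (auto simp: L2_torus_def)
    define u where "u t n = (LINT \<xi>|?M. F \<xi> * wave t n \<xi>)" for t n
    have prop_u: "propagator t f n = u t n" for t n by (simp add: propagator_eq_integral_wave u_def F_def)
    define \<phi> where "\<phi> s \<xi> = F \<xi> * cis (- s * laplacian_symbol \<xi>)" for s \<xi>
    have \<phi>m: "\<phi> s \<in> borel_measurable ?M" for s
    proof -
      have "(\<lambda>\<xi> :: real ^ 'd. cis (- s * laplacian_symbol \<xi>)) \<in> borel_measurable ?M"
        unfolding laplacian_symbol_def
        by (intro borel_measurable_torus borel_measurable_continuous_onI continuous_intros)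
      then show ?thesis unfolding \<phi>_def by measurable
    qed
    have \<phi>n: "cmod (\<phi> s \<xi>) = cmod (F \<xi>)" for s \<xi> by (simp add: \<phi>_def norm_mult)
    have \<phi>i: "integrable ?M (\<lambda>\<xi>. (cmod (\<phi> s \<xi>))\<^sup>2)" for s using Fi by (simp add: \<phi>n)
    \<comment> \<open>The evolution by time \<open>s\<close> is absorbed into the function on the torus.\<close>
    have translate: "(LINT \<xi>|?M. \<phi> s \<xi> * wave t n \<xi>) = u (s + t) n" for s t n
      unfolding u_def \<phi>_def wave_def mult.assoc cis_mult by (simp add: algebra_simps)
    define A where "A = (\<Sum>\<^sub>\<infinity>n. cmod (W n) powr r)"
    have A0: "A \<ge> 0" unfolding A_def by (rule infsum_nonneg) simp
    have Wle: "cmod (W n) powr r \<le> A" for n unfolding A_def by (rule lp_embedding(2)[OF W r order_refl finite.emptyI])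
    have nW: "(lp_norm r W)\<^sup>2 = A powr (2 / r)"
    proof -
      have "(lp_norm r W)\<^sup>2 = A powr (1 / r + 1 / r)" unfolding powr_add by (simp add: lp_norm_def A_def power2_eq_square)
      then show ?thesis by simp
    qed
    define K where "K = smoothing_constant * (lp_norm r W)\<^sup>2 * N"
    have K0: "K \<ge> 0" using smoothing_constant_pos N0 by (simp add: K_def)
    have disc: "(\<Sum>p\<in>P. (cmod (W (snd p)))\<^sup>2 * (cmod (u (s + of_int (fst p)) (snd p)))\<^sup>2) \<le> K" if P: "finite P" for P s
    proof (cases "A = 0")
      case True
      then have "W n = 0" for n using Wle[of n] r by (simp add: powr_nonneg_iff)
      then show ?thesis using K0 by simp
    next
      case False
      then have A: "A > 0" using A0 by simp
      have "(\<Sum>p\<in>P. (cmod (W (snd p)))\<^sup>2 * (cmod (LINT \<xi>|?M. \<phi> s \<xi> * wave (of_int (fst p)) (snd p) \<xi>))\<^sup>2)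
        \<le> smoothing_constant * (A powr (2 * (1 + \<beta>) / r)) powr (1 / (1 + \<beta>)) * (LINT \<xi>|?M. (cmod (\<phi> s \<xi>))\<^sup>2)"
        by (rule discrete_time_smoothing[OF P _ _ _ \<phi>m \<phi>i])
           (use A P lp_embedding(1)[OF W r \<beta>(2), of "snd ` P"] in \<open>simp_all add: A_def\<close>)
      also have "(A powr (2 * (1 + \<beta>) / r)) powr (1 / (1 + \<beta>)) = (lp_norm r W)\<^sup>2"
      proof -
        have "2 * (1 + \<beta>) / r * (1 / (1 + \<beta>)) = 2 / r" using \<beta>(1) r by (simp add: divide_simps)
        then show ?thesis by (simp only: nW powr_powr)
      qed
      finally show ?thesis by (simp add: translate \<phi>n K_def N_def)
    qed
    have bessel: "(\<Sum>n\<in>E. (cmod (u t n))\<^sup>2) \<le> N" if "finite E" for E t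
      using bessel_inequality[OF that \<phi>m \<phi>i, of t 0] by (simp add: translate \<phi>n N_def)
    define g where "g n t = (cmod (W n))\<^sup>2 * (cmod (u t n))\<^sup>2" for n t
    have g: "(cmod (mult_op W (propagator t f) n))\<^sup>2 = g n t" for n t
      by (simp add: mult_op_def prop_u g_def norm_mult power_mult_distrib)
    have g0: "g n t \<ge> 0" for n t by (simp add: g_def)
    have sm: "(\<lambda>n. g n t) summable_on UNIV" for t
    proof (rule nonneg_bdd_above_summable_on)
      show "bdd_above (sum (\<lambda>n. g n t) ` {E. E \<subseteq> UNIV \<and> finite E})"
      proof (rule bdd_aboveI2)
        fix E :: "(int ^ 'd) set" assume "E \<in> {E. E \<subseteq> UNIV \<and> finite E}"
        then have E: "finite E" by simp
        have "cmod (W n) \<le> A powr (1 / r)" for n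
        proof -
          have "(cmod (W n) powr r) powr (1 / r) \<le> A powr (1 / r)" using Wle r by (intro powr_mono2) auto
          then show ?thesis using r by (simp add: powr_powr)
        qed
        then have "(\<Sum>n\<in>E. g n t) \<le> (\<Sum>n\<in>E. (A powr (1 / r))\<^sup>2 * (cmod (u t n))\<^sup>2)"
          unfolding g_def by (intro sum_mono mult_right_mono power_mono) auto
        also have "\<dots> \<le> (A powr (1 / r))\<^sup>2 * N"
          unfolding sum_distrib_left[symmetric] by (intro mult_left_mono bessel E) auto
        finally show "sum (\<lambda>n. g n t) E \<le> (A powr (1 / r))\<^sup>2 * N" .
      qed
    qed (simp add: g0)
    have mem: "mult_op W (propagator t f) \<in> lp_space 2" for t
      unfolding lp_space_def using sm[of t] by (simp add: g)
    define G where "G t = (lp_norm 2 (mult_op W (propagator t f)))\<^sup>2" for t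
    define b where "b = from_nat_into (UNIV :: (int ^ 'd) set)"
    have inf: "infinite (UNIV :: (int ^ 'd) set)"
    proof -
      have "inj (\<lambda>k :: int. (\<chi> j. k) :: int ^ 'd)" by (auto simp: inj_on_def vec_eq_iff)
      then have "infinite (range (\<lambda>k :: int. (\<chi> j. k) :: int ^ 'd))"
        using finite_imageD infinite_UNIV_int by blast
      then show ?thesis by (meson finite_subset subset_UNIV)
    qed
    have b: "bij b" unfolding b_def by (rule bij_betw_from_nat_into[OF countableI_type inf])
    have Gs: "(\<lambda>i. g (b i) t) sums G t" for t
    proof -
      have "G t = (\<Sum>\<^sub>\<infinity>n. g n t)" unfolding G_def lp_norm_2_square(2)[OF mem] g ..
      then have "((\<lambda>n. g n t) has_sum G t) UNIV" using sm by (simp add: has_sum_infsum)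
      then have "((\<lambda>i. g (b i) t) has_sum G t) UNIV"
        using has_sum_reindex_bij_betw[OF b, of "\<lambda>n. g n t"] by simp
      then show ?thesis by (rule has_sum_imp_sums)
    qed
    have um [measurable]: "(\<lambda>t. u t n) \<in> borel_measurable borel" for n
      unfolding u_def by (rule borel_measurable_continuous_onI[OF continuous_on_evolution[OF FL2]])
    have gm [measurable]: "g n \<in> borel_measurable borel" for n unfolding g_def by measurable
    have Ge: "ennreal (G t) = (\<Sum>i. ennreal (g (b i) t))" for t
      unfolding suminf_ennreal2[OF g0 sums_summable[OF Gs]] sums_unique[OF Gs, symmetric] ..
    have Gm: "G \<in> borel_measurable lborel"
    proof -
      have "G t = (\<Sum>i. g (b i) t)" for t by (rule sums_unique[OF Gs])
      then have "G = (\<lambda>t. \<Sum>i. g (b i) t)" by auto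
      then show ?thesis by (simp add: borel_measurable_suminf)
    qed
    have G0: "G t \<ge> 0" for t by (simp add: G_def)
    have "(\<integral>\<^sup>+t. ennreal (G t) \<partial>lborel) \<le> ennreal K"
      unfolding Ge
    proof (rule nn_integral_le_of_unit_shifts)
      fix s :: real and L :: nat
      let ?P = "{- int L..<int L} \<times> b ` {..<L}"
      have injb: "inj_on b {..<L}" using b by (meson bij_is_inj inj_on_subset subset_UNIV)
      have "(\<Sum>k\<in>{- int L..<int L}. \<Sum>i<L. g (b i) (s + of_int k)) = (\<Sum>k\<in>{- int L..<int L}. \<Sum>n\<in>b ` {..<L}. g n (s + of_int k))"
        by (intro sum.cong refl) (simp add: sum.reindex[OF injb])
      also have "\<dots> = (\<Sum>p\<in>?P. g (snd p) (s + of_int (fst p)))"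
        by (simp add: sum.cartesian_product case_prod_beta)
      also have "\<dots> \<le> K" unfolding g_def by (rule disc) auto
      finally have "ennreal (\<Sum>k\<in>{- int L..<int L}. \<Sum>i<L. g (b i) (s + of_int k)) \<le> ennreal K" by (rule ennreal_leI)
      then show "(\<Sum>k\<in>{- int L..<int L}. \<Sum>i<L. ennreal (g (b i) (s + of_int k))) \<le> ennreal K"
        by (simp add: g0 sum_nonneg)
    qed measurable
    then have iG: "integrable lborel G" and "(LINT t|lborel. G t) \<le> K"
    proof -
      assume le: "(\<integral>\<^sup>+t. ennreal (G t) \<partial>lborel) \<le> ennreal K"
      show i: "integrable lborel G"
        by (rule integrableI_nonneg[OF Gm]) (use le G0 in \<open>auto intro: le_less_trans\<close>)
      show "(LINT t|lborel. G t) \<le> K"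
        using le K0 unfolding nn_integral_eq_integral[OF i AE_I2[OF G0]] by (simp add: ennreal_le_iff)
    qed
    moreover have "K \<le> smoothing_constant * 2 * (lp_norm r W)\<^sup>2 * (lp_norm 2 f)\<^sup>2"
    proof -
      have "K \<le> smoothing_constant * (lp_norm r W)\<^sup>2 * (2 * (lp_norm 2 f)\<^sup>2)"
        unfolding K_def N_def using FN smoothing_constant_pos by (intro mult_left_mono) auto
      then show ?thesis by (simp add: mult_ac)
    qed
    ultimately show "(\<forall>t. mult_op W (propagator t f) \<in> lp_space 2) \<and>
           integrable lborel (\<lambda>t. (lp_norm 2 (mult_op W (propagator t f)))\<^sup>2) \<and>
           (LINT t|lborel. (lp_norm 2 (mult_op W (propagator t f)))\<^sup>2)
             \<le> smoothing_constant * 2 * (lp_norm r W)\<^sup>2 * (lp_norm 2 f)\<^sup>2"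
      using mem by (simp add: G_def[abs_def])
  qed
qed

end
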